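(* Consider the one-dimensional totally asymmetric Activated Random Walk (ARW) model on $\mathbb{Z}$ with sleep rate $\lambda\in(0,\infty]$ (jump distribution $p(+1)=1$, so every jump is from $x$ to $x+1$), started from an i.i.d., non-constant initial configuration $(\eta_0(x))_{x\in\mathbb{Z}}$ of active particles with values in $\mathbb{N}_0$ and finite mean $\mu=\mathbb{E}[\eta_0(\boldsymbol{o})]$. Then the critical density is $\mu_c=\frac{\lambda}{1+\lambda}$ (read as $1$ if $\lambda=\infty$), that is: if $\mu<\frac{\lambda}{1+\lambda}$ the system fixates, and if $\mu>\frac{\lambda}{1+\lambda}$ the system does not fixate. Moreover, if $\mu=\frac{\lambda}{1+\lambda}$ the system does not fixate.
   Context: $\boldsymbol{o}$ denotes the origin. ARW model: at time $0^-$ there are $\eta_0(x)$ particles at each site $x$, all active. Each active particle performs, independently, a continuous-time random walk with jump rate $1$ and jump distribution $p(\cdot)$; active particles do not interact among themselves. When $\lambda<\infty$, an active particle that is alone at its site becomes passive at rate $\lambda$. When $\lambda=\infty$, a particle that is alone at its site becomes passive instantaneously. A passive particle does not move and stays passive until the instant another particle is present at its site, when it becomes active again. Thus a site with $n$ active particles sends a particle to $x+y$ at rate $n\,p(y)$ (for $\lambda=\infty$, only when $n\ge 2$). The process with infinitely many particles is well defined (as the limit of systems in which only the particles starting in $[-n,n]$ are kept, $n\to\infty$). Fixation: the system fixates if, almost surely, for every finite box there is a finite random time after which there is no activity (no active particle) in that box. It does not fixate otherwise; by a known zero-one law, the event of fixation has probability $0$ or $1$. *)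

theory Defs
  imports "HOL-Probability.Probability"
begin

text \<open>
  Totally asymmetric Activated Random Walks on the integers, built from a graphical
  (Harris) construction with labelled particles.  Particle \<open>(x, i)\<close> is the \<open>i\<close>-th particle
  initially at \<open>x\<close>.  It carries a Poisson process of rate 1 (jump attempts) and, if
  \<open>lam < \<infinity>\<close>, a Poisson process of rate \<open>lam\<close> (sleep attempts), all independent.
  An attempt is ignored when the particle is not in a state where the move is allowed;
  since the clocks are memoryless, an active particle then jumps at rate 1 and an active
  particle that is alone falls asleep at rate \<open>lam\<close>.
\<close>

type_synonym particle = "int \<times> nat"

datatype clock = Jump | Sleep

definition clocks :: "ereal \<Rightarrow> clock set" where
  "clocks lam = (if lam = \<infinity> then {Jump} else {Jump, Sleep})"

fun clock_rate :: "ereal \<Rightarrow> clock \<Rightarrow> real" where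
  "clock_rate lam Jump = 1"
| "clock_rate lam Sleep = real_of_ereal lam"

text \<open>\<open>(c, p, k)\<close> stands for the \<open>k\<close>-th ring (counting from 0) of the clock \<open>c\<close> of particle \<open>p\<close>.\<close>

type_synonym ring = "clock \<times> particle \<times> nat"

text \<open>The clocks are given by the waiting times \<open>gap c p k\<close> between successive rings.\<close>

fun ring_time :: "(clock \<Rightarrow> particle \<Rightarrow> nat \<Rightarrow> real) \<Rightarrow> ring \<Rightarrow> real" where
  "ring_time gap (c, p, k) = (\<Sum>j\<le>k. gap c p j)"


subsection \<open>Finitely many particles\<close>

text \<open>Position of each particle, and whether it is active.\<close>

type_synonym system = "(particle \<Rightarrow> int) \<times> (particle \<Rightarrow> bool)"

definition alone :: "particle set \<Rightarrow> (particle \<Rightarrow> int) \<Rightarrow> particle \<Rightarrow> bool" where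
  "alone A pos p \<longleftrightarrow> (\<forall>q\<in>A. pos q = pos p \<longrightarrow> q = p)"

text \<open>
  The instantaneous changes of state: particles sharing their site become active; if
  \<open>lam = \<infinity>\<close>, particles alone at their site become passive.
\<close>

fun settle :: "ereal \<Rightarrow> particle set \<Rightarrow> system \<Rightarrow> system" where
  "settle lam A (pos, act) = (pos, \<lambda>p. \<not> alone A pos p \<or> (lam \<noteq> \<infinity> \<and> act p))"

fun apply_ring :: "ereal \<Rightarrow> particle set \<Rightarrow> ring \<Rightarrow> system \<Rightarrow> system" where
  "apply_ring lam A (Jump, p, k) (pos, act) =
     (if act p then settle lam A (pos(p := pos p + 1), act) else (pos, act))"
| "apply_ring lam A (Sleep, p, k) (pos, act) =
     (if alone A pos p then (pos, act(p := False)) else (pos, act))"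

text \<open>
  The state at time \<open>t\<close> of the system with particle set \<open>A\<close>: start with all particles active
  and apply the rings up to time \<open>t\<close> in chronological order.  For finite \<open>A\<close>, almost surely
  these are finitely many and no two are simultaneous, as the sorted list needs.
\<close>

definition finite_system ::
    "ereal \<Rightarrow> particle set \<Rightarrow> (clock \<Rightarrow> particle \<Rightarrow> nat \<Rightarrow> real) \<Rightarrow> real \<Rightarrow> system" where
  "finite_system lam A gap t =
     fold (apply_ring lam A)
       (sorted_key_list_of_set (ring_time gap)
          {(c, p, k). c \<in> clocks lam \<and> p \<in> A \<and> ring_time gap (c, p, k) \<le> t})
       (settle lam A (\<lambda>(x, i). x, \<lambda>_. True))"

text \<open>The numbers of active and of passive particles at a site.\<close>

fun site_state :: "particle set \<Rightarrow> system \<Rightarrow> int \<Rightarrow> nat \<times> nat" where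
  "site_state A (pos, act) x =
     (card {p \<in> A. pos p = x \<and> act p}, card {p \<in> A. pos p = x \<and> \<not> act p})"


subsection \<open>Infinitely many particles\<close>

definition particles_within :: "nat \<Rightarrow> (int \<Rightarrow> nat) \<Rightarrow> particle set" where
  "particles_within n eta0 = {(x, i). x \<in> {- int n..int n} \<and> i < eta0 x}"

text \<open>
  The numbers of active and passive particles at site \<open>x\<close> at time \<open>t\<close>, as the limit in the
  discrete space \<open>nat \<times> nat\<close> of the truncated systems: the value they eventually take.
\<close>

definition arw ::
    "ereal \<Rightarrow> (int \<Rightarrow> nat) \<Rightarrow> (clock \<Rightarrow> particle \<Rightarrow> nat \<Rightarrow> real) \<Rightarrow> real \<Rightarrow> int \<Rightarrow> nat \<times> nat" where
  "arw lam eta0 gap t x =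
     lim (\<lambda>n. let A = particles_within n eta0 in site_state A (finite_system lam A gap t) x)"


subsection \<open>Randomness and fixation\<close>

datatype source = Init int | Gap clock particle nat

text \<open>
  Jointly independent initial occupation numbers and waiting times, the latter
  exponentially distributed.  The law of \<open>eta0\<close> is otherwise unrestricted.
\<close>

definition arw_randomness ::
    "'w measure \<Rightarrow> ereal \<Rightarrow> (int \<Rightarrow> 'w \<Rightarrow> nat) \<Rightarrow>
     (clock \<Rightarrow> particle \<Rightarrow> nat \<Rightarrow> 'w \<Rightarrow> real) \<Rightarrow> bool" where
  "arw_randomness M lam eta0 gap \<longleftrightarrow>
     prob_space.indep_vars M (\<lambda>_. borel)
       (\<lambda>s. case s of Init x \<Rightarrow> (\<lambda>w. real (eta0 x w)) | Gap c p k \<Rightarrow> gap c p k)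
       (range Init \<union> {Gap c p k | c p k. c \<in> clocks lam}) \<and>
     (\<forall>c\<in>clocks lam. \<forall>p k.
       distributed M lborel (gap c p k) (exponential_density (clock_rate lam c)))"

definition fixates ::
    "'w measure \<Rightarrow> ereal \<Rightarrow> (int \<Rightarrow> 'w \<Rightarrow> nat) \<Rightarrow>
     (clock \<Rightarrow> particle \<Rightarrow> nat \<Rightarrow> 'w \<Rightarrow> real) \<Rightarrow> bool" where
  "fixates M lam eta0 gap \<longleftrightarrow>
     (AE w in M. \<forall>a b :: int. \<exists>T\<ge>0. \<forall>t\<ge>T. \<forall>x\<in>{a..b}.
        fst (arw lam (\<lambda>y. eta0 y w) (\<lambda>c p k. gap c p k w) t x) = 0)"

definition critical_density :: "ereal \<Rightarrow> real" where
  "critical_density lam =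
     (if lam = \<infinity> then 1 else real_of_ereal lam / (1 + real_of_ereal lam))"

end

theory Submission
  imports Defs
begin

text \<open>
  Every site \<open>y\<close> carries bits: bit number \<open>j\<close> decides whether the particle that is alone at \<open>y\<close>
  after \<open>j\<close> jumps from \<open>y\<close> falls asleep (probability \<open>rho = lam / (1 + lam)\<close>) or jumps.  The dynamics
  reveals these bits one by one.  Fix the initial configuration and the bits revealed so far, and
  take the mean over the other bits of a function of the number of particles that leave a window
  \<open>[w..x]\<close> when it is stabilised from left to right.  This mean is a martingale under the
  dynamics.  For the event that at least \<open>K\<close> particles leave, it is 1 as soon as \<open>K\<close> particles have
  crossed \<open>x\<close>, and 0 when fewer than \<open>K\<close> have crossed and the window is inactive.  At time 0 it
  averages to the probability that the walk \<open>W \<mapsto> W + e\<close> or \<open>W + e - 1\<close> (truncated at 0, the latter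
  with probability \<open>rho\<close>), with \<open>e\<close> distributed as an initial occupation number, is at least \<open>K\<close>
  after as many steps as the window has sites.

  If \<open>mu < rho\<close>, the walk is tight, so that the flux through \<open>x\<close> is almost surely bounded and the
  system fixates.  If \<open>mu \<ge> rho\<close>, the drift \<open>mu - rho\<close> together with the push at 0 contradicts
  tightness; hence the walk escapes to infinity, and a bounded flux through the origin has
  probability 0.  Infinite volume is reduced to finite systems by barriers: almost surely, for every
  time horizon, arbitrarily far to the left there is a site that no particle could cross in time.
\<close>

section \<open>The abelian martingale\<close>

text \<open>The graphical construction attaches clocks to particles, whereas the abelian argument
  needs instructions attached to sites. The bits bridge the two: when a lone active particle rings,
  its clocks compete at rates 1 and \<open>lam\<close>, so the ring is a sleep with probability
  \<open>lam / (1 + lam)\<close>, independently of the past. A sleeper may be woken by an arrival,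
  but then one departure is certain and the next undecided bit has a higher number, so a revealed
  bit never has to be revised. Harmonicity of a single averaged function thus replaces a comparison
  of different toppling orders.

  The martingale is used only along finitely many rings of finitely many particles. The number
  \<open>m\<close> of rings, the truncation \<open>n\<close> and the time \<open>T\<close> then grow
  in this order, along the naturals, so that limits are countable operations on events. The two
  bounds need different windows: \<open>[-n..x]\<close>, which nothing enters from the left, to
  bound the flux from above, and a fixed \<open>[w..x]\<close> with its inflow neglected to bound it
  from below. At \<open>mu = rho\<close> only the push at 0 is left; it is positive because a
  non-constant law with mean at most 1 charges 0.\<close>

definition step :: "ereal \<Rightarrow> particle set \<Rightarrow> clock \<times> particle \<Rightarrow> system \<Rightarrow> system" where
  "step lam A i = apply_ring lam A (fst i, snd i, 0)"

definition start :: "ereal \<Rightarrow> particle set \<Rightarrow> system" where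
  "start lam A = settle lam A (fst, \<lambda>_. True)"

text \<open>As jumps go one step to the right, this is the number of jumps made from
  \<open>y\<close> so far. Reading it off the positions avoids a counter in the state; it also
  numbers the bits of \<open>y\<close>.\<close>

definition crossed :: "particle set \<Rightarrow> (particle \<Rightarrow> int) \<Rightarrow> int \<Rightarrow> nat" where
  "crossed A pos y = card {p \<in> A. fst p \<le> y \<and> y < pos p}"

text \<open>\<open>Some True\<close> is a revealed sleep, \<open>Some False\<close> a revealed jump, \<open>None\<close> an unrevealed bit; for
  \<open>lam = \<infinity>\<close> all bits are known in advance, a lone particle being passive at once.\<close>

definition blank :: "ereal \<Rightarrow> bool option" where
  "blank lam = (if lam = \<infinity> then Some True else None)"

text \<open>In company a sleep attempt is ignored, and a jump only realises a departure that happens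
  for all values of the bits; so only the rings of active lone particles are informative. By
  \<open>consistent\<close> the bit written here is still unrevealed.\<close>

fun reveal :: "particle set \<Rightarrow> clock \<times> particle \<Rightarrow> system \<Rightarrow> (int \<Rightarrow> nat \<Rightarrow> bool option)
    \<Rightarrow> (int \<Rightarrow> nat \<Rightarrow> bool option)" where
  "reveal A (c, p) (pos, act) D =
     (if act p \<and> alone A pos p
      then D(pos p := (D (pos p))(crossed A pos (pos p) := Some (c = Sleep))) else D)"

definition estep :: "ereal \<Rightarrow> particle set \<Rightarrow> clock \<times> particle
    \<Rightarrow> system \<times> (int \<Rightarrow> nat \<Rightarrow> bool option) \<Rightarrow> system \<times> (int \<Rightarrow> nat \<Rightarrow> bool option)" where
  "estep lam A i = (\<lambda>(s, D). (step lam A i s, reveal A i s D))"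

text \<open>What the revealed bits know about a state. An empty site that particles have left was
  emptied by a lone active one, so the last departure there is a revealed jump. The bit of a lone
  particle, numbered by the departures so far, is unrevealed while the particle is active and a
  sleep when it is passive (preset if \<open>lam = \<infinity>\<close>). Bits of higher number are
  blank.\<close>

fun consistent :: "ereal \<Rightarrow> particle set \<Rightarrow> system \<Rightarrow> (int \<Rightarrow> nat \<Rightarrow> bool option) \<Rightarrow> bool" where
  "consistent lam A (pos, act) D \<longleftrightarrow>
     (\<forall>p\<in>A. fst p \<le> pos p) \<and>
     (\<forall>p\<in>A. \<not> alone A pos p \<longrightarrow> act p) \<and>
     (lam = \<infinity> \<longrightarrow> (\<forall>p\<in>A. act p \<longrightarrow> \<not> alone A pos p)) \<and>
     (\<forall>y j. crossed A pos y < j \<longrightarrow> D y j = blank lam) \<and>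
     (\<forall>y. (\<forall>p\<in>A. pos p \<noteq> y) \<longrightarrow> D y (crossed A pos y) = blank lam \<and>
        (0 < crossed A pos y \<longrightarrow> D y (crossed A pos y - 1) = Some False)) \<and>
     (\<forall>p\<in>A. alone A pos p \<longrightarrow>
        D (pos p) (crossed A pos (pos p)) = (if act p then None else Some True))"

section \<open>Consistency of the revealed bits with the dynamics\<close>

lemma step_simps:
  "step lam A (Jump, p) (pos, act) =
     (if act p then settle lam A (pos(p := pos p + 1), act) else (pos, act))"
  "step lam A (Sleep, p) (pos, act) =
     (if alone A pos p then (pos, act(p := False)) else (pos, act))"
  by (simp_all add: step_def)

lemma crossed_move:
  assumes "finite A" "p \<in> A" "fst p \<le> pos p"
  shows "crossed A (pos(p := pos p + 1)) y = crossed A pos y + (if y = pos p then 1 else 0)"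
proof (cases "y = pos p")
  case True
  have "{q \<in> A. fst q \<le> y \<and> y < (pos(p := pos p + 1)) q}
      = insert p {q \<in> A. fst q \<le> y \<and> y < pos q}"
    using assms True by auto
  then show ?thesis
    using assms True by (simp add: crossed_def)
next
  case False
  have "{q \<in> A. fst q \<le> y \<and> y < (pos(p := pos p + 1)) q} = {q \<in> A. fst q \<le> y \<and> y < pos q}"
    using assms False by auto
  then show ?thesis
    using False by (simp add: crossed_def)
qed

text \<open>Conservation of particles at \<open>y\<close>: both sides count the particles that
  started at or before \<open>y\<close> and are now at or beyond it.\<close>

lemma crossed_flow:
  assumes "finite A" "\<forall>p\<in>A. fst p \<le> pos p"
  shows "crossed A pos y + card {p \<in> A. pos p = y} = crossed A pos (y - 1) + card {p \<in> A. fst p = y}"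
proof -
  have "crossed A pos y + card {p \<in> A. pos p = y} = card {p \<in> A. fst p \<le> y \<and> y \<le> pos p}"
    unfolding crossed_def using assms
    by (subst card_Un_disjoint[symmetric]) (auto intro!: arg_cong[where f = card])
  moreover have "crossed A pos (y - 1) + card {p \<in> A. fst p = y}
      = card {p \<in> A. fst p \<le> y \<and> y \<le> pos p}"
    unfolding crossed_def using assms
    by (subst card_Un_disjoint[symmetric]) (auto intro!: arg_cong[where f = card])
  ultimately show ?thesis by simp
qed

lemma consistent_start:
  assumes "finite A"
  shows "consistent lam A (start lam A) (\<lambda>_ _. blank lam)"
proof -
  have "{p \<in> A. fst p \<le> y \<and> y < fst p} = {}" for y
    by auto
  then have "crossed A fst y = 0" for y
    unfolding crossed_def by (metis card.empty)
  then show ?thesis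
    by (auto simp: start_def blank_def)
qed

lemma consistent_jump:
  assumes fin: "finite A" and p: "p \<in> A" and act: "act p" and c: "consistent lam A (pos, act) D"
  shows "consistent lam A (step lam A (Jump, p) (pos, act)) (reveal A (Jump, p) (pos, act) D)"
proof -
  define y where "y = pos p"
  define pos' where "pos' = pos(p := pos p + 1)"
  define act' where "act' = (\<lambda>q. \<not> alone A pos' q \<or> (lam \<noteq> \<infinity> \<and> act q))"
  define D' where "D' = reveal A (Jump, p) (pos, act) D"
  have s: "step lam A (Jump, p) (pos, act) = (pos', act')"
    using act by (simp add: step_simps pos'_def act'_def)
  have c1: "\<And>q. q \<in> A \<Longrightarrow> fst q \<le> pos q"
    and c2: "\<And>q. q \<in> A \<Longrightarrow> \<not> alone A pos q \<Longrightarrow> act q"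
    and c3: "\<And>q. lam = \<infinity> \<Longrightarrow> q \<in> A \<Longrightarrow> act q \<Longrightarrow> \<not> alone A pos q"
    and c4: "\<And>z j. crossed A pos z < j \<Longrightarrow> D z j = blank lam"
    and c5: "\<And>z. (\<forall>p\<in>A. pos p \<noteq> z) \<Longrightarrow> D z (crossed A pos z) = blank lam"
    and c6: "\<And>z. (\<forall>p\<in>A. pos p \<noteq> z) \<Longrightarrow> 0 < crossed A pos z \<Longrightarrow>
        D z (crossed A pos z - 1) = Some False"
    and c7: "\<And>q. q \<in> A \<Longrightarrow> alone A pos q \<Longrightarrow>
        D (pos q) (crossed A pos (pos q)) = (if act q then None else Some True)"
    using c by auto
  have cr: "crossed A pos' z = crossed A pos z + (if z = y then 1 else 0)" for z
    using crossed_move[of A p pos z] fin p c1 by (simp add: pos'_def y_def)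
  have pos'_q: "pos' q = (if q = p then y + 1 else pos q)" for q
    by (simp add: pos'_def y_def)
  have D'_z: "D' z j = (if alone A pos p \<and> z = y \<and> j = crossed A pos y then Some False else D z j)" for z j
    using act by (simp add: D'_def y_def)
  have r1: "\<forall>q\<in>A. fst q \<le> pos' q"
    using c1 c1[OF p] by (auto simp: pos'_q y_def)
  have r4: "D' z j = blank lam" if "crossed A pos' z < j" for z j
    using that c4[of z j] by (auto simp: D'_z cr split: if_splits)
  have emp: "D' z (crossed A pos' z) = blank lam \<and>
      (0 < crossed A pos' z \<longrightarrow> D' z (crossed A pos' z - 1) = Some False)"
    if e: "\<forall>q\<in>A. pos' q \<noteq> z" for z
  proof (cases "z = y")
    case True
    \<comment> \<open>The jump emptied \<open>y\<close>, so the jumper was alone there and this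
      departure has just been revealed as a jump; the bit after it is untouched.\<close>
    have "alone A pos p"
      using e True by (auto simp: alone_def pos'_q y_def split: if_splits)
    then show ?thesis
      using True c4[of y "Suc (crossed A pos y)"] by (simp add: D'_z cr)
  next
    case False
    have "\<forall>q\<in>A. pos q \<noteq> z"
      using e False by (auto simp: pos'_q y_def split: if_splits)
    then show ?thesis
      using False c5[of z] c6[of z] by (simp add: D'_z cr)
  qed
  have al: "D' (pos' q) (crossed A pos' (pos' q)) = (if act' q then None else Some True)"
    if q: "q \<in> A" and a: "alone A pos' q" for q
  proof -
    \<comment> \<open>A particle alone after the jump is the jumper on a formerly empty site, a
      companion left behind at \<open>y\<close>, or one that the jump did not affect; at
      \<open>y + 1\<close> nobody else can be alone.\<close>
    consider "q = p" | "q \<noteq> p" "pos q = y" | "q \<noteq> p" "pos q = y + 1" | "q \<noteq> p" "pos q \<noteq> y" "pos q \<noteq> y + 1"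
      by blast
    then show ?thesis
    proof cases
      case 1
      have "\<forall>q'\<in>A. pos q' \<noteq> y + 1"
        using a 1 by (auto simp: alone_def pos'_q y_def split: if_splits)
      from c5[OF this] have "D (y + 1) (crossed A pos (y + 1)) = blank lam" .
      then show ?thesis
        using 1 act a by (simp add: D'_z cr pos'_q act'_def blank_def)
    next
      case 2
      \<comment> \<open>The departure moved the site on to a fresh bit, and the companion left
        behind was active; for \<open>lam = \<infinity>\<close> it settles as passive, in accordance
        with the preset bit.\<close>
      have "\<not> alone A pos p" "\<not> alone A pos q"
        using 2 p q by (auto simp: alone_def y_def)
      then have "act q" "D' y (Suc (crossed A pos y)) = blank lam"
        using c2[OF q] c4[of y "Suc (crossed A pos y)"] by (auto simp: D'_z)
      then show ?thesis
        using 2 a by (simp add: cr pos'_q act'_def blank_def)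
    next
      case 3
      then have False
        using a p by (auto simp: alone_def pos'_q)
      then show ?thesis ..
    next
      case 4
      have al: "alone A pos q"
        using a 4 by (auto simp: alone_def pos'_q y_def split: if_splits)
      then have "act' q = act q"
        using a c3[OF _ q] by (auto simp: act'_def)
      then show ?thesis
        using 4 c7[OF q al] by (simp add: D'_z cr pos'_q)
    qed
  qed
  have "consistent lam A (pos', act') D'"
    unfolding consistent.simps
    using r1 r4 emp al by (auto simp: act'_def)
  then show ?thesis
    by (simp add: s D'_def)
qed

lemma consistent_estep:
  assumes fin: "finite A" and p: "p \<in> A" and c: "consistent lam A s D"
  shows "consistent lam A (step lam A (c, p) s) (reveal A (c, p) s D)"
proof -
  obtain pos act where s: "s = (pos, act)" by (cases s)
  show ?thesis
  proof (cases c)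
    case Jump
    show ?thesis
    proof (cases "act p")
      case True
      then show ?thesis
        using consistent_jump[of A p act lam pos D, OF fin p True] assms(3) s Jump by simp
    next
      case False
      then show ?thesis
        using assms(3) by (simp add: s Jump step_simps)
    qed
  next
    case Sleep
    show ?thesis
    proof (cases "act p \<and> alone A pos p")
      case True
      have u: "q = p" if "q \<in> A" "pos q = pos p" for q
        using True that by (auto simp: alone_def)
      have e: "step lam A (c, p) s = (pos, act(p := False))"
        "reveal A (c, p) s D = D(pos p := (D (pos p))(crossed A pos (pos p) := Some True))"
        using True by (simp_all add: s Sleep step_simps)
      show ?thesis
        unfolding e consistent.simps
        using assms(3) True u p unfolding s consistent.simps
        by (intro conjI ballI allI impI) (auto simp: fun_upd_def split: if_splits)
    next
      case False
      then have "step lam A (c, p) s = s"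
        by (auto simp: s Sleep step_simps fun_upd_idem)
      then show ?thesis
        using False assms(3) by (auto simp: s)
    qed
  qed
qed

lemma consistent_fold:
  assumes "finite A" "set l \<subseteq> UNIV \<times> A" "consistent lam A s D"
  shows "case fold (estep lam A) l (s, D) of (s', D') \<Rightarrow> s' = fold (step lam A) l s \<and> consistent lam A s' D'"
  using assms(2,3)
proof (induction l arbitrary: s D)
  case (Cons i l)
  obtain c p where i: "i = (c, p)" by (cases i)
  then have "consistent lam A (step lam A i s) (reveal A i s D)"
    using Cons.prems consistent_estep[OF assms(1)] by auto
  from Cons.IH[OF _ this] Cons.prems show ?case
    by (simp add: estep_def)
qed simp

text \<open>With \<open>k\<close> particles entering \<open>y\<close> and \<open>eta y\<close> starting there, all but the last one certainly leave,
  and the last one follows bit number \<open>k + eta y - 1\<close>.\<close>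

fun outflow_mean :: "(nat \<Rightarrow> real) \<Rightarrow> real \<Rightarrow> (int \<Rightarrow> nat) \<Rightarrow> (int \<Rightarrow> nat \<Rightarrow> bool option)
    \<Rightarrow> int list \<Rightarrow> nat \<Rightarrow> real" where
  "outflow_mean f r eta D [] k = f k"
| "outflow_mean f r eta D (y # ys) k =
     (if k + eta y = 0 then outflow_mean f r eta D ys 0
      else case D y (k + eta y - 1) of
        None \<Rightarrow> (1 - r) * outflow_mean f r eta D ys (k + eta y)
                 + r * outflow_mean f r eta D ys (k + eta y - 1)
      | Some b \<Rightarrow> outflow_mean f r eta D ys (k + eta y - (if b then 1 else 0)))"

section \<open>The mean outflow of a window as a harmonic function\<close>

lemma outflow_mean_irrelevant:
  "y \<notin> set ys \<Longrightarrow> outflow_mean f r eta (D(y := d)) ys k = outflow_mean f r eta D ys k"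
  by (induction ys arbitrary: k) (auto split: option.split)

text \<open>The sites of the window are distinct, so its stabilisation consults bit \<open>j\<close>
  of \<open>y\<close> at most once. The mean is therefore affine in this bit, and an unrevealed bit
  stands for the average over its two values.\<close>

lemma outflow_mean_reveal:
  assumes "distinct ys" "D y j = None"
  shows "(1 - r) * outflow_mean f r eta (D(y := (D y)(j := Some False))) ys k
       + r * outflow_mean f r eta (D(y := (D y)(j := Some True))) ys k
       = outflow_mean f r eta D ys k"
  using assms(1)
proof (induction ys arbitrary: k)
  case (Cons z ys)
  let ?F = "D(y := (D y)(j := Some False))" and ?T = "D(y := (D y)(j := Some True))"
  show ?case
  proof (cases "z = y")
    case True
    then have irr: "outflow_mean f r eta (D(y := d)) ys k = outflow_mean f r eta D ys k" for d k
      using Cons.prems by (intro outflow_mean_irrelevant) auto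
    show ?thesis
    proof (cases "k + eta y - 1 = j")
      case True
      show ?thesis
        using \<open>z = y\<close> assms(2)
        by (cases "k + eta y = 0") (simp_all only: outflow_mean.simps irr True fun_upd_same if_True if_False option.case, simp_all add: algebra_simps)
    next
      case False
      show ?thesis
        using \<open>z = y\<close> False
        by (cases "k + eta y = 0"; cases "D y (k + eta y - 1)")
          (simp_all only: outflow_mean.simps irr fun_upd_same fun_upd_other if_True if_False option.case not_False_eq_True, simp_all add: algebra_simps)
    qed
  next
    case False
    have IH: "(1 - r) * outflow_mean f r eta ?F ys k + r * outflow_mean f r eta ?T ys k
       = outflow_mean f r eta D ys k" for k
      by (rule Cons.IH) (use Cons.prems in simp)
    show ?thesis
      using False
      by (cases "k + eta z = 0"; cases "D z (k + eta z - 1)")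
        (simp_all add: IH[symmetric] del: fun_upd_apply add: fun_upd_other,
          simp_all add: algebra_simps del: fun_upd_apply)
  qed
qed (simp add: algebra_simps)

lemma outflow_mean_bounds:
  assumes "\<And>k. 0 \<le> f k \<and> f k \<le> 1" "0 \<le> r" "r \<le> 1"
  shows "0 \<le> outflow_mean f r eta D ys k \<and> outflow_mean f r eta D ys k \<le> 1"
proof (induction ys arbitrary: k)
  case (Cons y ys)
  have "0 \<le> (1 - r) * outflow_mean f r eta D ys (k + eta y)
         + r * outflow_mean f r eta D ys (k + eta y - 1)"
    using Cons assms by (intro add_nonneg_nonneg mult_nonneg_nonneg) auto
  moreover have "(1 - r) * outflow_mean f r eta D ys (k + eta y)
         + r * outflow_mean f r eta D ys (k + eta y - 1) \<le> (1 - r) * 1 + r * 1"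
    using Cons assms by (intro add_mono mult_left_mono) auto
  ultimately show ?case
    using Cons.IH by (cases "k + eta y = 0"; cases "D y (k + eta y - 1)") simp_all
qed (use assms in auto)

text \<open>Least action: the stabilisation lets out of every site at least as many particles as
  have already left it. By \<open>crossed_flow\<close> this passes from site to site: a site that
  still holds a particle can afford to lose one to sleep, and a site that was emptied has a revealed
  jump as its last bit.\<close>

lemma outflow_mean_eq_1:
  assumes fin: "finite A" and c: "consistent lam A (pos, act) D"
    and eta: "\<And>y. eta y = card {p \<in> A. fst p = y}"
    and K: "K \<le> crossed A pos (z + int n)" and k: "crossed A pos z \<le> k"
  shows "outflow_mean (\<lambda>k. if K \<le> k then 1 else 0) r eta D [z + 1..z + int n] k = 1"
  using K k
proof (induction n arbitrary: z k)
  case (Suc n)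
  let ?y = "z + 1" let ?a = "k + eta ?y"
  have l: "[z + 1..z + int (Suc n)] = ?y # [?y + 1..?y + int n]"
    by (subst upto_rec1) (auto simp: algebra_simps)
  have IH: "outflow_mean (\<lambda>k. if K \<le> k then 1 else 0) r eta D [?y + 1..?y + int n] k' = 1"
    if "crossed A pos ?y \<le> k'" for k'
    using that Suc.prems by (intro Suc.IH) (auto simp: algebra_simps)
  have "crossed A pos ?y + card {p \<in> A. pos p = ?y} = crossed A pos z + eta ?y"
    using crossed_flow[OF fin, of pos ?y] c eta by simp
  then have a: "crossed A pos ?y + card {p \<in> A. pos p = ?y} \<le> ?a"
    using Suc.prems by simp
  show ?case
  proof (cases "crossed A pos ?y \<le> ?a - 1")
    \<comment> \<open>One particle to spare: whatever the bit says, at least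
      \<open>crossed A pos ?y\<close> particles move on.\<close>
    case True
    then show ?thesis
      unfolding l using IH[of ?a] IH[of "?a - 1"] IH[of 0] True
      by (cases "?a = 0"; cases "D ?y (?a - 1)") auto
  next
    case False
    then have "crossed A pos ?y = ?a" "card {p \<in> A. pos p = ?y} = 0"
      using a by auto
    moreover from this fin have "\<forall>p\<in>A. pos p \<noteq> ?y" by auto
    moreover have "\<And>z. (\<forall>p\<in>A. pos p \<noteq> z) \<Longrightarrow> 0 < crossed A pos z \<Longrightarrow>
        D z (crossed A pos z - 1) = Some False"
      using c by auto
    ultimately have "0 < ?a \<Longrightarrow> D ?y (?a - 1) = Some False"
      by metis
    then show ?thesis
      unfolding l using IH[of ?a] IH[of 0] \<open>crossed A pos ?y = ?a\<close> by (cases "?a = 0") auto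
  qed
qed auto

text \<open>The converse bound: in a passive window every site holds at most one particle, whose bit
  is a sleep, so the stabilisation lets out at most as many particles as have left. The inequality
  \<open>k \<le> crossed A pos z\<close> admits \<open>k = 0\<close>, that is, a window treated as
  if nothing had entered it from the left.\<close>

lemma outflow_mean_eq_0:
  assumes fin: "finite A" and c: "consistent lam A (pos, act) D"
    and eta: "\<And>y. eta y = card {p \<in> A. fst p = y}"
    and K: "crossed A pos (z + int n) < K" and k: "k \<le> crossed A pos z"
    and pass: "\<And>p. p \<in> A \<Longrightarrow> pos p \<in> {z + 1..z + int n} \<Longrightarrow> \<not> act p"
  shows "outflow_mean (\<lambda>k. if K \<le> k then 1 else 0) r eta D [z + 1..z + int n] k = 0"
  using K k pass
proof (induction n arbitrary: z k)
  case (Suc n)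
  let ?y = "z + 1" let ?a = "k + eta ?y"
  have l: "[z + 1..z + int (Suc n)] = ?y # [?y + 1..?y + int n]"
    by (subst upto_rec1) (auto simp: algebra_simps)
  have IH: "outflow_mean (\<lambda>k. if K \<le> k then 1 else 0) r eta D [?y + 1..?y + int n] k' = 0"
    if "k' \<le> crossed A pos ?y" for k'
    using that Suc.prems(1) by (intro Suc.IH Suc.prems(3)) (auto simp: algebra_simps)
  have "crossed A pos ?y + card {p \<in> A. pos p = ?y} = crossed A pos z + eta ?y"
    using crossed_flow[OF fin, of pos ?y] c eta by simp
  then have a: "?a \<le> crossed A pos ?y + card {p \<in> A. pos p = ?y}"
    using Suc.prems by simp
  have al: "alone A pos p" if "p \<in> A" "pos p = ?y" for p
    using that Suc.prems(3)[of p] c by auto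
  \<comment> \<open>Two particles on one site would be active.\<close>
  have "card {p \<in> A. pos p = ?y} \<le> Suc 0"
    unfolding card_le_Suc0_iff_eq[OF finite_subset[OF Collect_restrict fin]]
    using al by (auto simp: alone_def)
  show ?case
  proof (cases "?a \<le> crossed A pos ?y")
    case True
    then show ?thesis
      unfolding l using IH by (cases "D ?y (?a - 1)") simp_all
  next
    case False
    with a \<open>card {p \<in> A. pos p = ?y} \<le> Suc 0\<close>
    have ay: "?a = Suc (crossed A pos ?y)" and "card {p \<in> A. pos p = ?y} \<noteq> 0" by auto
    then obtain p where p: "p \<in> A" "pos p = ?y"
      by (metis (mono_tags, lifting) Collect_empty_eq card.empty)
    then have "D ?y (crossed A pos ?y) = Some True"
      using al[OF p] c Suc.prems(3)[of p] by auto
    then show ?thesis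
      unfolding l using IH ay by simp
  qed
qed auto

text \<open>Only rings of active lone particles reveal anything, and for these the jump clock of
  rate 1 and the sleep clock of rate \<open>lam\<close> weigh the two values of the bit as
  \<open>1 - rho\<close> and \<open>rho\<close>. This is where \<open>lam / (1 + lam)\<close>
  enters. For \<open>lam = \<infinity>\<close> a consistent state has no active lone particle, so
  every term is constant.\<close>

lemma outflow_mean_harmonic:
  assumes fin: "finite A" and c: "consistent lam A s D" and lam: "0 < lam" and d: "distinct ys"
  shows "(\<Sum>i\<in>clocks lam \<times> A. clock_rate lam (fst i) *
            outflow_mean f (critical_density lam) eta (reveal A i s D) ys k)
       = (\<Sum>i\<in>clocks lam \<times> A. clock_rate lam (fst i)) * outflow_mean f (critical_density lam) eta D ys k"
proof -
  obtain pos act where s: "s = (pos, act)" by (cases s)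
  let ?h = "\<lambda>D. outflow_mean f (critical_density lam) eta D ys k"
  have "(\<Sum>c\<in>clocks lam. clock_rate lam c * ?h (reveal A (c, p) s D))
      = (\<Sum>c\<in>clocks lam. clock_rate lam c) * ?h D" if p: "p \<in> A" for p
  proof (cases "act p \<and> alone A pos p")
    case True
    then have "lam \<noteq> \<infinity>" and N: "D (pos p) (crossed A pos (pos p)) = None"
      using p c s by auto
    then obtain r where r: "lam = ereal r" "0 < r"
      using lam by (cases lam) auto
    have "?h D * (1 + r) = ((1 - r / (1 + r)) * ?h (reveal A (Jump, p) s D)
        + r / (1 + r) * ?h (reveal A (Sleep, p) s D)) * (1 + r)"
      using outflow_mean_reveal[OF d, where D=D, OF N, of "critical_density lam" f eta k] True r
      by (simp add: s critical_density_def)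
    also have "\<dots> = ((1 - r / (1 + r)) * (1 + r)) * ?h (reveal A (Jump, p) s D)
        + (r / (1 + r) * (1 + r)) * ?h (reveal A (Sleep, p) s D)"
      by (simp only: algebra_simps)
    also have "\<dots> = ?h (reveal A (Jump, p) s D) + r * ?h (reveal A (Sleep, p) s D)"
      using r by (simp add: field_simps)
    finally have "?h D * (1 + r) = ?h (reveal A (Jump, p) s D) + r * ?h (reveal A (Sleep, p) s D)" .
    then show ?thesis
      using r by (simp add: clocks_def algebra_simps)
  next
    case False
    then show ?thesis
      by (auto simp: s sum_distrib_right)
  qed
  then have "(\<Sum>p\<in>A. \<Sum>c\<in>clocks lam. clock_rate lam c * ?h (reveal A (c, p) s D))
      = (\<Sum>p\<in>A. \<Sum>c\<in>clocks lam. clock_rate lam c) * ?h D"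
    by (simp add: sum_distrib_right)
  then show ?thesis
    by (subst (asm) (1 2) sum.swap) (simp add: sum.cartesian_product')
qed

section \<open>Independent exponential clocks\<close>

abbreviation exp_law :: "real \<Rightarrow> real measure" where
  "exp_law r \<equiv> density lborel (exponential_density r)"

definition exp_seq :: "real \<Rightarrow> (nat \<Rightarrow> real) measure" where
  "exp_seq r = PiM UNIV (\<lambda>_. exp_law r)"

text \<open>Letting time \<open>u\<close> pass before the first ring shortens the first waiting time
  only.\<close>

abbreviation lower :: "real \<Rightarrow> (nat \<Rightarrow> real) \<Rightarrow> nat \<Rightarrow> real" where
  "lower u g \<equiv> g(0 := g 0 - u)"

lemma sets_exp_seq: "sets (exp_seq r) = sets (PiM UNIV (\<lambda>_. borel :: real measure))"
  unfolding exp_seq_def by (intro sets_PiM_cong) auto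

lemma prob_space_exp_seq: "0 < r \<Longrightarrow> prob_space (exp_seq r)"
  unfolding exp_seq_def by (intro prob_space_PiM prob_space_exponential_density)

text \<open>Memorylessness: a waiting time exceeds \<open>u\<close> with probability
  \<open>exp (- r * u)\<close>, and its residual then has the original law.\<close>

lemma nn_integral_exp_law_shift:
  assumes u: "0 \<le> u" and [measurable]: "F \<in> borel_measurable borel"
  shows "(\<integral>\<^sup>+x. indicator {u<..} x * F (x - u) \<partial>exp_law r)
       = ennreal (exp (- r * u)) * (\<integral>\<^sup>+x. F x \<partial>exp_law r)"
proof -
  have "(\<integral>\<^sup>+x. indicator {u<..} x * F (x - u) \<partial>exp_law r)
      = (\<integral>\<^sup>+x. ennreal (exponential_density r x) * (indicator {u<..} x * F (x - u)) \<partial>lborel)"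
    by (rule nn_integral_density) measurable
  also have "\<dots> = (\<integral>\<^sup>+x. ennreal (exponential_density r (u + x)) * (indicator {u<..} (u + x) * F (u + x - u)) \<partial>lborel)"
    by (subst nn_integral_real_affine[where c = 1 and t = u]) simp_all
  also have "\<dots> = (\<integral>\<^sup>+x. ennreal (exp (- r * u)) * (ennreal (exponential_density r x) * F x) \<partial>lborel)"
  \<comment> \<open>At \<open>x = 0\<close> the indicator vanishes but the density does not; this
    one point is a null set.\<close>
  proof (rule nn_integral_cong_AE, use AE_lborel_singleton[of 0] in eventually_elim)
    fix x :: real assume "x \<noteq> 0"
    then show "ennreal (exponential_density r (u + x)) * (indicator {u<..} (u + x) * F (u + x - u))
        = ennreal (exp (- r * u)) * (ennreal (exponential_density r x) * F x)"
    proof (cases "0 < x")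
      case True
      then have "exponential_density r (u + x) = exp (- r * u) * exponential_density r x"
        using u by (simp add: exponential_density_def exp_add[symmetric] algebra_simps)
      then show ?thesis
        using True by (simp add: ennreal_mult' mult.assoc)
    next
      case False
      with \<open>x \<noteq> 0\<close> have x: "x < 0" by simp
      then have "indicator {u<..} (u + x) = (0 :: ennreal)" by simp
      moreover have "exponential_density r x = 0"
        unfolding exponential_density_def using x by (simp only: if_True)
      ultimately show ?thesis by (simp only: mult_zero_left mult_zero_right ennreal_0)
    qed
  qed
  also have "\<dots> = ennreal (exp (- r * u)) * (\<integral>\<^sup>+x. ennreal (exponential_density r x) * F x \<partial>lborel)"
    by (rule nn_integral_cmult) simp
  also have "(\<integral>\<^sup>+x. ennreal (exponential_density r x) * F x \<partial>lborel) = (\<integral>\<^sup>+x. F x \<partial>exp_law r)"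
    by (rule nn_integral_density[symmetric]) measurable
  finally show ?thesis .
qed

lemma nn_integral_exp_seq_split:
  assumes r: "0 < r" and F: "F \<in> borel_measurable (PiM UNIV (\<lambda>_. borel))"
  shows "(\<integral>\<^sup>+g. F g \<partial>exp_seq r) = (\<integral>\<^sup>+x. \<integral>\<^sup>+g. F (case_nat x g) \<partial>exp_seq r \<partial>exp_law r)"
proof -
  interpret E: prob_space "exp_law r" using r by (rule prob_space_exponential_density)
  interpret S: sequence_space "exp_law r" by unfold_locales
  interpret Q: prob_space "exp_seq r" using r by (rule prob_space_exp_seq)
  have Fm: "F \<in> borel_measurable (exp_seq r)"
    using F measurable_cong_sets[OF sets_exp_seq refl] by blast
  have cm: "(\<lambda>(s, \<omega>). case_nat s \<omega>) \<in> exp_law r \<Otimes>\<^sub>M exp_seq r \<rightarrow>\<^sub>M exp_seq r"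
    unfolding exp_seq_def by (rule measurable_PiM_single') (auto split: nat.split simp: space_PiM split_beta)
  have "(\<integral>\<^sup>+g. F g \<partial>exp_seq r) = (\<integral>\<^sup>+g. F g \<partial>distr (exp_law r \<Otimes>\<^sub>M exp_seq r) (exp_seq r) (\<lambda>(s, \<omega>). case_nat s \<omega>))"
    using S.PiM_iter by (simp add: exp_seq_def)
  also have "\<dots> = (\<integral>\<^sup>+z. F ((\<lambda>(s, \<omega>). case_nat s \<omega>) z) \<partial>(exp_law r \<Otimes>\<^sub>M exp_seq r))"
    by (subst nn_integral_distr[OF cm]) (auto simp: Fm)
  also have "\<dots> = (\<integral>\<^sup>+x. \<integral>\<^sup>+g. F (case_nat x g) \<partial>exp_seq r \<partial>exp_law r)"
    using measurable_compose[OF cm Fm] by (subst Q.nn_integral_fst[symmetric]) (auto simp: split_beta)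
  finally show ?thesis .
qed

lemma nn_integral_exp_seq_lower:
  assumes r: "0 < r" and u: "0 \<le> u" and F[measurable]: "F \<in> borel_measurable (PiM UNIV (\<lambda>_. borel))"
  shows "(\<integral>\<^sup>+g. indicator {u<..} (g 0) * F (lower u g) \<partial>exp_seq r)
       = ennreal (exp (- r * u)) * (\<integral>\<^sup>+g. F g \<partial>exp_seq r)"
proof -
  interpret Q: prob_space "exp_seq r" using r by (rule prob_space_exp_seq)
  have [measurable_cong]: "sets (exp_seq r) = sets (PiM UNIV (\<lambda>_. borel :: real measure))"
    by (rule sets_exp_seq)
  have m: "(\<lambda>g. g(0 := g 0 - u)) \<in> PiM UNIV (\<lambda>_. borel) \<rightarrow>\<^sub>M PiM UNIV (\<lambda>_. borel :: real measure)"
    by (rule measurable_PiM_single') (auto simp: fun_upd_def)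
  note m[measurable]
  have cm[measurable]: "(\<lambda>(s, \<omega>). case_nat s \<omega>) \<in> borel \<Otimes>\<^sub>M PiM UNIV (\<lambda>_. borel :: real measure) \<rightarrow>\<^sub>M PiM UNIV (\<lambda>_. borel)"
    by (rule measurable_PiM_single') (auto split: nat.split simp: space_PiM split_beta)
  have eq: "(case_nat x g)(0 := x - u) = case_nat (x - u) g" for x and g :: "nat \<Rightarrow> real"
    by (auto simp: fun_eq_iff split: nat.split)
  define G where "G x = (\<integral>\<^sup>+g. F (case_nat x g) \<partial>exp_seq r)" for x
  have [measurable]: "(\<lambda>(x, g). F (case_nat x g)) \<in> borel_measurable (borel \<Otimes>\<^sub>M PiM UNIV (\<lambda>_. borel :: real measure))"
    using measurable_compose[OF cm F] by (simp add: split_beta)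
  have "(\<lambda>(x, g). F (case_nat x g)) \<in> borel_measurable (borel \<Otimes>\<^sub>M exp_seq r)"
    by measurable
  then have [measurable]: "G \<in> borel_measurable borel"
    unfolding G_def by (intro Q.borel_measurable_nn_integral) 
  have "(\<integral>\<^sup>+g. indicator {u<..} (g 0) * F (lower u g) \<partial>exp_seq r)
      = (\<integral>\<^sup>+x. \<integral>\<^sup>+g. indicator {u<..} x * F (case_nat (x - u) g) \<partial>exp_seq r \<partial>exp_law r)"
    by (subst nn_integral_exp_seq_split[OF r]) (measurable, simp only: eq nat.case)
  also have "\<dots> = (\<integral>\<^sup>+x. indicator {u<..} x * G (x - u) \<partial>exp_law r)"
    unfolding G_def by (intro nn_integral_cong nn_integral_cmult) simp
  also have "\<dots> = ennreal (exp (- r * u)) * (\<integral>\<^sup>+x. G x \<partial>exp_law r)"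
    by (rule nn_integral_exp_law_shift[OF u]) simp
  also have "(\<integral>\<^sup>+x. G x \<partial>exp_law r) = (\<integral>\<^sup>+g. F g \<partial>exp_seq r)"
    unfolding G_def by (rule nn_integral_exp_seq_split[OF r F, symmetric])
  finally show ?thesis .
qed

abbreviation clock_space :: "'i set \<Rightarrow> ('i \<Rightarrow> nat \<Rightarrow> real) measure" where
  "clock_space I \<equiv> PiM I (\<lambda>_. PiM UNIV (\<lambda>_. borel))"

definition clock_law :: "('i \<Rightarrow> real) \<Rightarrow> 'i set \<Rightarrow> ('i \<Rightarrow> nat \<Rightarrow> real) measure" where
  "clock_law r I = PiM I (\<lambda>i. exp_seq (r i))"

lemma sets_clock_law: "sets (clock_law r I) = sets (clock_space I)"
  unfolding clock_law_def by (intro sets_PiM_cong sets_exp_seq refl)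

lemma prob_space_clock_law: "(\<And>i. i \<in> I \<Longrightarrow> 0 < r i) \<Longrightarrow> prob_space (clock_law r I)"
  unfolding clock_law_def by (intro prob_space_PiM prob_space_exp_seq)

lemma nn_integral_clock_law_insert:
  assumes I: "finite I" "i \<notin> I" and r: "\<And>j. j \<in> insert i I \<Longrightarrow> 0 < r j"
    and F: "F \<in> borel_measurable (clock_space (insert i I))"
  shows "(\<integral>\<^sup>+g. F g \<partial>clock_law r (insert i I))
       = (\<integral>\<^sup>+y. \<integral>\<^sup>+g. F (g(i := y)) \<partial>clock_law r I \<partial>exp_seq (r i))"
proof -
  define N where "N j = (if j \<in> insert i I then exp_seq (r j) else exp_seq 1)" for j
  have "prob_space (N j)" for j
    unfolding N_def using r prob_space_exp_seq[of 1] by (auto intro: prob_space_exp_seq)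
  then have "product_sigma_finite N"
    unfolding product_sigma_finite_def by (blast intro: prob_space_imp_sigma_finite)
  then interpret product_sigma_finite N .
  have N: "clock_law r (insert i I) = PiM (insert i I) N" "clock_law r I = PiM I N" "N i = exp_seq (r i)"
    unfolding clock_law_def using I by (auto intro!: PiM_cong simp: N_def)
  have "F \<in> borel_measurable (PiM (insert i I) N)"
    unfolding N(1)[symmetric] using F measurable_cong_sets[OF sets_clock_law refl] by blast
  from product_nn_integral_insert_rev[OF I this] show ?thesis
    by (simp only: N)
qed

lemma measurable_clock_spaceI:
  assumes "\<And>i k. i \<in> I \<Longrightarrow> (\<lambda>x. f x i k) \<in> borel_measurable M"
    and "\<And>x. x \<in> space M \<Longrightarrow> f x \<in> extensional I"
  shows "f \<in> M \<rightarrow>\<^sub>M clock_space I"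
proof (rule measurable_PiM_single')
  show "(\<lambda>x. f x i) \<in> M \<rightarrow>\<^sub>M PiM UNIV (\<lambda>_. borel)" if "i \<in> I" for i
    using assms(1)[OF that] by (intro measurable_PiM_single') auto
  show "(\<lambda>x i. f x i) \<in> space M \<rightarrow> (\<Pi>\<^sub>E i\<in>I. space (PiM UNIV (\<lambda>_. borel :: real measure)))"
    using assms(2) by (auto simp: PiE_iff space_PiM)
qed

lemma measurable_clock_component [measurable]:
  assumes "i \<in> I"
  shows "(\<lambda>g. g i k) \<in> borel_measurable (clock_space I)"
proof -
  have "(\<lambda>g. g i) \<in> clock_space I \<rightarrow>\<^sub>M PiM UNIV (\<lambda>_. borel)"
    using assms by (rule measurable_component_singleton)
  moreover have "(\<lambda>h. h k) \<in> PiM UNIV (\<lambda>_. borel) \<rightarrow>\<^sub>M (borel :: real measure)"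
    by simp
  ultimately show ?thesis
    by (rule measurable_compose)
qed

lemma measurable_fst_component:
  "(\<lambda>x. fst x k) \<in> borel_measurable (PiM UNIV (\<lambda>_. borel :: real measure) \<Otimes>\<^sub>M N)"
  by (rule measurable_compose[OF measurable_fst]) simp

lemma measurable_snd_clock_component:
  "i \<in> I \<Longrightarrow> (\<lambda>x. snd x i k) \<in> borel_measurable (N \<Otimes>\<^sub>M clock_space I)"
  by (rule measurable_compose[OF measurable_snd measurable_clock_component])

lemma measurable_lower_clocks:
  "I \<subseteq> J \<Longrightarrow> (\<lambda>g. \<lambda>j\<in>I. lower u (g j)) \<in> clock_space J \<rightarrow>\<^sub>M clock_space I"
proof (rule measurable_clock_spaceI)
  fix i k assume "I \<subseteq> J" "i \<in> I"
  then have [measurable]: "i \<in> J" by auto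
  show "(\<lambda>x. (\<lambda>j\<in>I. lower u (x j)) i k) \<in> borel_measurable (clock_space J)"
  proof (cases "k = 0")
    case True
    have "(\<lambda>x. x i 0 - u) \<in> borel_measurable (clock_space J)" by measurable
    then show ?thesis using True \<open>i \<in> I\<close> by simp
  next
    case False
    have "(\<lambda>x. x i k) \<in> borel_measurable (clock_space J)" by measurable
    then show ?thesis using False \<open>i \<in> I\<close> by simp
  qed
qed simp

lemma measurable_clock_upd:
  "(\<lambda>(y, g). g(i := y)) \<in> PiM UNIV (\<lambda>_. borel) \<Otimes>\<^sub>M clock_space I \<rightarrow>\<^sub>M clock_space (insert i I)"
proof (rule measurable_clock_spaceI)
  fix j k assume "j \<in> insert i I"
  then show "(\<lambda>x. (case x of (y, g) \<Rightarrow> g(i := y)) j k)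
      \<in> borel_measurable (PiM UNIV (\<lambda>_. borel) \<Otimes>\<^sub>M clock_space I)"
    by (cases "j = i") (simp_all add: split_beta measurable_fst_component measurable_snd_clock_component)
qed (auto simp: space_pair_measure space_PiM PiE_iff extensional_def)

lemma measurable_clock_upd_const:
  "(\<lambda>g. g(i := y)) \<in> clock_space I \<rightarrow>\<^sub>M clock_space (insert i I)"
proof (rule measurable_clock_spaceI)
  fix j k assume "j \<in> insert i I"
  then show "(\<lambda>g. (g(i := y)) j k) \<in> borel_measurable (clock_space I)"
    by (cases "j = i") (simp_all add: measurable_clock_component)
qed (auto simp: space_PiM PiE_iff extensional_def)

lemma measurable_clock_indicator:
  "i \<in> I \<Longrightarrow> (\<lambda>g. indicator {u<..} (g i 0) :: ennreal) \<in> borel_measurable (clock_space I)"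
  by (rule measurable_compose[OF measurable_clock_component]) simp_all

lemma measurable_pair_clock_law:
  "measurable (N \<Otimes>\<^sub>M clock_law r I) L = measurable (N \<Otimes>\<^sub>M clock_space I) L"
  by (intro measurable_cong_sets sets_pair_measure_cong sets_clock_law refl)

text \<open>Memorylessness for finitely many independent clocks, one clock at a time: the survival
  probabilities multiply, so the rates add up in the exponent.\<close>

lemma nn_integral_clock_law_lower:
  assumes "finite I" and u: "0 \<le> u" and "\<And>i. i \<in> I \<Longrightarrow> 0 < r i"
    and "F \<in> borel_measurable (clock_space I)"
  shows "(\<integral>\<^sup>+g. (\<Prod>i\<in>I. indicator {u<..} (g i 0)) * F (\<lambda>i\<in>I. lower u (g i)) \<partial>clock_law r I)
       = ennreal (exp (- sum r I * u)) * (\<integral>\<^sup>+g. F g \<partial>clock_law r I)"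
  using assms(1,3,4)
proof (induction I arbitrary: F rule: finite_induct)
  case empty
  have "(\<integral>\<^sup>+g. (\<Prod>i\<in>{}. indicator {u<..} (g i 0)) * F (\<lambda>i\<in>{}. lower u (g i)) \<partial>clock_law r {})
      = (\<integral>\<^sup>+g. F g \<partial>clock_law r {})"
    by (rule nn_integral_cong) (auto simp: clock_law_def space_PiM restrict_def)
  then show ?case
    by (simp only: sum.empty minus_zero mult_zero_left exp_zero ennreal_1 mult_1)
next
  case (insert i I)
  interpret I: prob_space "clock_law r I"
    by (rule prob_space_clock_law) (use insert.prems in simp)
  note [measurable_cong] = sets_clock_law sets_exp_seq
  have r: "0 < r i" "\<And>j. j \<in> I \<Longrightarrow> 0 < r j"
    using insert.prems(1) by simp_all
  note F = insert.prems(2)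
  note upd = measurable_clock_upd[of i I]
  have Fu: "(\<lambda>g. F (g(i := y))) \<in> borel_measurable (clock_space I)" for y
    by (rule measurable_compose[OF measurable_clock_upd_const F])
  define G where "G y = (\<integral>\<^sup>+g. F (g(i := y)) \<partial>clock_law r I)" for y
  have "(\<lambda>(y, g). F (g(i := y))) \<in> borel_measurable (PiM UNIV (\<lambda>_. borel) \<Otimes>\<^sub>M clock_law r I)"
    unfolding measurable_pair_clock_law
    by (rule measurable_compose[OF upd F, unfolded prod.case_distrib[where h = F]])
  then have G[measurable]: "G \<in> borel_measurable (PiM UNIV (\<lambda>_. borel))"
    unfolding G_def by (rule I.borel_measurable_nn_integral)
  let ?F = "\<lambda>g. (\<Prod>j\<in>insert i I. indicator {u<..} (g j 0)) * F (\<lambda>j\<in>insert i I. lower u (g j)) :: ennreal"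
  have "?F \<in> borel_measurable (clock_space (insert i I))"
    by (rule borel_measurable_times_ennreal[OF _ measurable_compose[OF measurable_lower_clocks[OF subset_refl] F]])
      (intro borel_measurable_prod_ennreal measurable_clock_indicator)
  from nn_integral_clock_law_insert[OF insert.hyps insert.prems(1) this]
  have "(\<integral>\<^sup>+g. ?F g \<partial>clock_law r (insert i I))
      = (\<integral>\<^sup>+y. \<integral>\<^sup>+g. ?F (g(i := y)) \<partial>clock_law r I \<partial>exp_seq (r i))" .
  also have "\<dots> = (\<integral>\<^sup>+y. indicator {u<..} (y 0) *
      (\<integral>\<^sup>+g. (\<Prod>j\<in>I. indicator {u<..} (g j 0)) * F ((\<lambda>j\<in>I. lower u (g j))(i := lower u y)) \<partial>clock_law r I)
      \<partial>exp_seq (r i))"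
  proof (rule nn_integral_cong)
    fix y :: "nat \<Rightarrow> real"
    have 1: "(\<Prod>j\<in>insert i I. indicator {u<..} ((g(i := y)) j 0)) = indicator {u<..} (y 0) *
        (\<Prod>j\<in>I. indicator {u<..} (g j 0) :: ennreal)" for g
      using insert.hyps by (auto intro!: arg_cong2[where f = "(*)"] prod.cong)
    have 2: "(\<lambda>j\<in>insert i I. lower u ((g(i := y)) j)) = (\<lambda>j\<in>I. lower u (g j))(i := lower u y)" for g
      using insert.hyps by (auto simp: restrict_def fun_eq_iff)
    note m = measurable_lower_clocks[OF subset_refl, of u I]
    have KM: "(\<lambda>g. (\<Prod>j\<in>I. indicator {u<..} (g j 0)) * F ((\<lambda>j\<in>I. lower u (g j))(i := lower u y)))
        \<in> borel_measurable (clock_law r I)"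
      unfolding measurable_cong_sets[OF sets_clock_law refl]
      by (rule borel_measurable_times_ennreal[OF _ measurable_compose[OF m Fu[of "lower u y"]]])
        (intro borel_measurable_prod_ennreal measurable_clock_indicator)
    show "(\<integral>\<^sup>+g. ?F (g(i := y)) \<partial>clock_law r I) = indicator {u<..} (y 0) *
      (\<integral>\<^sup>+g. (\<Prod>j\<in>I. indicator {u<..} (g j 0)) * F ((\<lambda>j\<in>I. lower u (g j))(i := lower u y)) \<partial>clock_law r I)"
      unfolding 1 2 mult.assoc by (rule nn_integral_cmult[OF KM])
  qed
  also have "\<dots> = (\<integral>\<^sup>+y. indicator {u<..} (y 0) *
      (ennreal (exp (- sum r I * u)) * G (lower u y)) \<partial>exp_seq (r i))"
  proof -
    have "(\<integral>\<^sup>+g. (\<Prod>j\<in>I. indicator {u<..} (g j 0)) * F ((\<lambda>j\<in>I. lower u (g j))(i := lower u y)) \<partial>clock_law r I)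
        = ennreal (exp (- sum r I * u)) * G (lower u y)" for y
      unfolding G_def by (rule insert.IH[OF r(2) Fu])
    then show ?thesis
      by (simp only:)
  qed
  also have "\<dots> = ennreal (exp (- r i * u)) * (\<integral>\<^sup>+y. ennreal (exp (- sum r I * u)) * G y \<partial>exp_seq (r i))"
    by (rule nn_integral_exp_seq_lower[OF r(1) u, of "\<lambda>z. ennreal (exp (- sum r I * u)) * G z"]) simp
  also have "\<dots> = ennreal (exp (- r i * u)) * (ennreal (exp (- sum r I * u)) * (\<integral>\<^sup>+y. G y \<partial>exp_seq (r i)))"
    by (subst nn_integral_cmult) auto
  also have "\<dots> = ennreal (exp (- sum r (insert i I) * u)) * (\<integral>\<^sup>+y. G y \<partial>exp_seq (r i))"
  proof -
    have "ennreal (exp (- r i * u)) * ennreal (exp (- sum r I * u)) = ennreal (exp (- sum r (insert i I) * u))"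
      unfolding ennreal_mult[OF exp_ge_zero exp_ge_zero, symmetric] exp_add[symmetric] sum.insert[OF insert.hyps]
      by (rule arg_cong[where f = "\<lambda>x. ennreal (exp x)"]) (simp add: algebra_simps)
    then show ?thesis
      by (simp only: mult.assoc[symmetric])
  qed
  also have "\<dots> = ennreal (exp (- sum r (insert i I) * u)) * (\<integral>\<^sup>+g. F g \<partial>clock_law r (insert i I))"
    unfolding G_def
    by (rule arg_cong[where f = "(*) _"], rule nn_integral_clock_law_insert[OF insert.hyps insert.prems, symmetric])
  finally show ?case .
qed

section \<open>Restarting the clocks at their first ring\<close>

definition first :: "'i set \<Rightarrow> ('i \<Rightarrow> nat \<Rightarrow> real) \<Rightarrow> 'i \<Rightarrow> bool" where
  "first I g a \<longleftrightarrow> a \<in> I \<and> (\<forall>i\<in>I - {a}. g a 0 < g i 0)"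

text \<open>The clocks seen from the first ring: clock \<open>a\<close> begins its next waiting
  time, the others have already waited for \<open>g a 0\<close>.\<close>

definition advance :: "'i set \<Rightarrow> 'i \<Rightarrow> ('i \<Rightarrow> nat \<Rightarrow> real) \<Rightarrow> 'i \<Rightarrow> nat \<Rightarrow> real" where
  "advance I a g = (\<lambda>i\<in>I. if i = a then (\<lambda>k. g a (Suc k)) else lower (g a 0) (g i))"

lemma first_unique: "first I g a \<Longrightarrow> first I g b \<Longrightarrow> a = b"
  unfolding first_def by (metis DiffI insertE less_asym singletonD)

lemma measurable_first:
  assumes "finite I" "a \<in> I"
  shows "(\<lambda>g. indicator {g. first I g a} g :: ennreal) \<in> borel_measurable (clock_space I)"
proof -
  have "Measurable.pred (clock_space I) (\<lambda>g. first I g a)"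
    unfolding first_def using assms
    by (intro pred_intros_logic pred_intros_finite borel_measurable_pred_less measurable_clock_component) auto
  then have "(\<lambda>g. if first I g a then 1 else 0 :: ennreal) \<in> borel_measurable (clock_space I)"
    by (intro measurable_If) auto
  then show ?thesis
    by (simp add: indicator_def of_bool_def)
qed

lemma AE_exp_law_nonneg: "AE u in exp_law r. 0 \<le> u"
  by (subst AE_density) (auto simp: exponential_density_def)

text \<open>Strong Markov property at the first ring: the clock \<open>a\<close> rings first with
  probability \<open>r a / sum r I\<close>, the time of this ring is exponential with the total
  rate, and the restarted clocks are fresh, all three independently.\<close>

lemma nn_integral_first_advance:
  assumes I: "finite I" "a \<in> I" and r: "\<And>i. i \<in> I \<Longrightarrow> 0 < r i"
    and F: "(\<lambda>(u, g). F u g) \<in> borel_measurable (borel \<Otimes>\<^sub>M clock_space I)"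
  shows "(\<integral>\<^sup>+g. indicator {g. first I g a} g * F (g a 0) (advance I a g) \<partial>clock_law r I)
       = ennreal (r a / sum r I) * (\<integral>\<^sup>+u. \<integral>\<^sup>+g. F u g \<partial>clock_law r I \<partial>exp_law (sum r I))"
proof -
  define J where "J = I - {a}"
  have J: "finite J" "a \<notin> J" "I = insert a J"
    using I by (auto simp: J_def)
  have rJ: "\<And>i. i \<in> J \<Longrightarrow> 0 < r i" and ra: "0 < r a" and rI: "\<And>i. i \<in> insert a J \<Longrightarrow> 0 < r i"
    using r J by auto
  have sums: "sum r I = r a + sum r J" "0 \<le> sum r J"
    using J by (simp, intro sum_nonneg less_imp_le rJ)
  interpret N: prob_space "clock_law r I"
    using r by (rule prob_space_clock_law)
  interpret NJ: prob_space "clock_law r J"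
    using rJ by (rule prob_space_clock_law)
  interpret Q: prob_space "exp_seq (r a)"
    using ra by (rule prob_space_exp_seq)
  note [measurable_cong] = sets_clock_law sets_exp_seq
  let ?P = "PiM UNIV (\<lambda>_. borel) :: (nat \<Rightarrow> real) measure"
  let ?S = "\<lambda>y g. (\<lambda>j\<in>J. lower (y 0) (g j))(a := (\<lambda>k. y (Suc k)))"
  have S: "(\<lambda>(y, g). ?S y g) \<in> ?P \<Otimes>\<^sub>M clock_space J \<rightarrow>\<^sub>M clock_space I"
  proof (rule measurable_clock_spaceI)
    fix j k assume "j \<in> I"
    then show "(\<lambda>x. (case x of (y, g) \<Rightarrow> ?S y g) j k) \<in> borel_measurable (?P \<Otimes>\<^sub>M clock_space J)"
      using J by (cases "j = a"; cases "k = 0")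
        (auto simp: split_beta intro!: borel_measurable_diff measurable_fst_component measurable_snd_clock_component)
  qed (auto simp: J(3) extensional_def)
  note U = measurable_clock_upd[of a J, folded J(3)]
  have FS: "(\<lambda>(y, g). F (y 0) (?S y g)) \<in> borel_measurable (?P \<Otimes>\<^sub>M clock_space J)"
  proof -
    have "(\<lambda>x. (fst x 0, (\<lambda>(y, g). ?S y g) x)) \<in> ?P \<Otimes>\<^sub>M clock_space J \<rightarrow>\<^sub>M borel \<Otimes>\<^sub>M clock_space I"
      using S by (intro measurable_Pair) auto
    from measurable_compose[OF this F] show ?thesis by (simp only: case_prod_unfold fst_conv snd_conv)
  qed
  let ?K = "\<lambda>(y :: nat \<Rightarrow> real) g. (\<Prod>i\<in>J. indicator {y 0<..} (g i 0)) * F (y 0) (?S y g)"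
  have K: "(\<lambda>(y, g). ?K y g) \<in> borel_measurable (?P \<Otimes>\<^sub>M clock_space J)"
    unfolding split_beta
  proof (intro borel_measurable_times_ennreal borel_measurable_prod_ennreal)
    fix i assume i: "i \<in> J"
    have "(\<lambda>x. if fst x 0 < snd x i 0 then 1 else 0 :: ennreal) \<in> borel_measurable (?P \<Otimes>\<^sub>M clock_space J)"
      by (rule measurable_If[OF _ _
            predE[OF borel_measurable_pred_less[OF measurable_fst_component measurable_snd_clock_component[OF i]]]])
        simp_all
    moreover have "indicator {s<..} t = (if s < t then 1 else 0 :: ennreal)" for s t :: real
      by simp
    ultimately show "(\<lambda>x. indicator {fst x 0<..} (snd x i 0) :: ennreal) \<in> borel_measurable (?P \<Otimes>\<^sub>M clock_space J)"
      by (simp only:)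
  qed (rule FS[unfolded case_prod_unfold])
  have adv: "(\<lambda>g. advance I a g) \<in> clock_space I \<rightarrow>\<^sub>M clock_space I"
  proof (rule measurable_clock_spaceI)
    fix j k assume "j \<in> I"
    then show "(\<lambda>g. advance I a g j k) \<in> borel_measurable (clock_space I)"
      using I by (cases "j = a"; cases "k = 0")
        (auto simp: advance_def intro!: borel_measurable_diff measurable_clock_component)
  qed (simp add: advance_def)
  have "(\<lambda>g. (g a 0, advance I a g)) \<in> clock_space I \<rightarrow>\<^sub>M borel \<Otimes>\<^sub>M clock_space I"
    using adv I by (intro measurable_Pair) auto
  from measurable_compose[OF this F]
  have FA: "(\<lambda>g. F (g a 0) (advance I a g)) \<in> borel_measurable (clock_space I)"
    by simp
  have "(\<lambda>g. indicator {g. first I g a} g * F (g a 0) (advance I a g)) \<in> borel_measurable (clock_space I)"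
    using FA I by (intro borel_measurable_times_ennreal measurable_first) auto
  then have "(\<integral>\<^sup>+g. indicator {g. first I g a} g * F (g a 0) (advance I a g) \<partial>clock_law r I)
      = (\<integral>\<^sup>+y. \<integral>\<^sup>+g. indicator {g. first I g a} (g(a := y)) * F (y 0) (advance I a (g(a := y))) \<partial>clock_law r J
          \<partial>exp_seq (r a))"
    using nn_integral_clock_law_insert[OF J(1,2) rI] unfolding J(3) by simp
  also have "\<dots> = (\<integral>\<^sup>+y. \<integral>\<^sup>+g. ?K y g \<partial>clock_law r J \<partial>exp_seq (r a))"
  proof (intro nn_integral_cong arg_cong2[where f = "(*)"] arg_cong2[where f = F] refl)
    fix y and g
    have "first I (g(a := y)) a \<longleftrightarrow> (\<forall>i\<in>J. y 0 < g i 0)"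
      using J(2) by (auto simp: first_def J(3))
    then show "indicator {g. first I g a} (g(a := y)) = (\<Prod>i\<in>J. indicator {y 0<..} (g i 0) :: ennreal)"
      using J(1) by (auto simp: indicator_def prod_zero_iff intro!: prod.neutral[symmetric])
    show "advance I a (g(a := y)) = ?S y g"
      using J(2) by (auto simp: advance_def J(3) fun_eq_iff)
  qed
  also have "\<dots> = (\<integral>\<^sup>+u. \<integral>\<^sup>+w. \<integral>\<^sup>+g. ?K (case_nat u w) g \<partial>clock_law r J \<partial>exp_seq (r a) \<partial>exp_law (r a))"
    using K by (intro nn_integral_exp_seq_split[OF ra] NJ.borel_measurable_nn_integral)
      (simp add: measurable_pair_clock_law)
  \<comment> \<open>Given the first ring of \<open>a\<close> at time \<open>u\<close>, the other
    clocks must survive \<open>u\<close>, at the cost of an exponential factor; their residuals and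
    the later waiting times of \<open>a\<close> together form a fresh family.\<close>
  also have "\<dots> = (\<integral>\<^sup>+u. ennreal (exp (- sum r J * u)) * (\<integral>\<^sup>+g. F u g \<partial>clock_law r I) \<partial>exp_law (r a))"
  proof (rule nn_integral_cong_AE, use AE_exp_law_nonneg in eventually_elim)
    fix u :: real assume u: "0 \<le> u"
    have Fu: "F u \<in> borel_measurable (clock_space I)"
      using measurable_compose[OF measurable_Pair1'[of u] F] by simp
    have FU: "(\<lambda>(y, g). F u (g(a := y))) \<in> borel_measurable (?P \<Otimes>\<^sub>M clock_law r J)"
      unfolding measurable_pair_clock_law
      by (rule measurable_compose[OF U Fu, unfolded prod.case_distrib[where h = "F u"]])
    have FUw: "(\<lambda>g. F u (g(a := w))) \<in> borel_measurable (clock_space J)" for w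
      using measurable_compose[OF measurable_clock_upd_const Fu[unfolded J(3)]] .
    have "(\<integral>\<^sup>+w. \<integral>\<^sup>+g. ?K (case_nat u w) g \<partial>clock_law r J \<partial>exp_seq (r a))
        = (\<integral>\<^sup>+w. \<integral>\<^sup>+g. (\<Prod>i\<in>J. indicator {u<..} (g i 0)) * F u ((\<lambda>j\<in>J. lower u (g j))(a := w)) \<partial>clock_law r J \<partial>exp_seq (r a))"
      by simp
    also have "\<dots> = (\<integral>\<^sup>+w. ennreal (exp (- sum r J * u)) * (\<integral>\<^sup>+g. F u (g(a := w)) \<partial>clock_law r J) \<partial>exp_seq (r a))"
      using nn_integral_clock_law_lower[OF J(1) u rJ FUw] by simp
    also have "\<dots> = ennreal (exp (- sum r J * u)) * (\<integral>\<^sup>+w. \<integral>\<^sup>+g. F u (g(a := w)) \<partial>clock_law r J \<partial>exp_seq (r a))"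
    proof (rule nn_integral_cmult)
      show "(\<lambda>w. \<integral>\<^sup>+g. F u (g(a := w)) \<partial>clock_law r J) \<in> borel_measurable (exp_seq (r a))"
        using NJ.borel_measurable_nn_integral[OF FU] by measurable
    qed
    also have "(\<integral>\<^sup>+w. \<integral>\<^sup>+g. F u (g(a := w)) \<partial>clock_law r J \<partial>exp_seq (r a)) = (\<integral>\<^sup>+g. F u g \<partial>clock_law r I)"
      using nn_integral_clock_law_insert[OF J(1,2) rI, where F = "F u"] Fu by (simp add: J(3))
    finally show "(\<integral>\<^sup>+w. \<integral>\<^sup>+g. ?K (case_nat u w) g \<partial>clock_law r J \<partial>exp_seq (r a))
        = ennreal (exp (- sum r J * u)) * (\<integral>\<^sup>+g. F u g \<partial>clock_law r I)" .
  qed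
  also have "\<dots> = ennreal (r a / sum r I) * (\<integral>\<^sup>+u. \<integral>\<^sup>+g. F u g \<partial>clock_law r I \<partial>exp_law (sum r I))"
  proof -
    define H where "H u = (\<integral>\<^sup>+g. F u g \<partial>clock_law r I)" for u
    have "(\<lambda>(u, g). F u g) \<in> borel_measurable (borel \<Otimes>\<^sub>M clock_law r I)"
      using F by measurable
    then have H[measurable]: "H \<in> borel_measurable borel"
      unfolding H_def by (rule N.borel_measurable_nn_integral)
    have "(\<integral>\<^sup>+u. ennreal (exp (- sum r J * u)) * H u \<partial>exp_law (r a))
        = (\<integral>\<^sup>+u. ennreal (exponential_density (r a) u) * (ennreal (exp (- sum r J * u)) * H u) \<partial>lborel)"
      by (rule nn_integral_density) simp_all
    also have "\<dots> = (\<integral>\<^sup>+u. ennreal (r a / sum r I) * (ennreal (exponential_density (sum r I) u) * H u) \<partial>lborel)"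
    proof (rule nn_integral_cong)
      fix u :: real
      have R: "0 < sum r I"
        using ra sums by simp
      have nonneg: "0 \<le> exponential_density s u" if "0 < s" for s
        using that by (simp add: exponential_density_def)
      have e: "exp (- u * r a) * exp (- sum r J * u) = exp (- u * sum r I)"
        unfolding exp_add[symmetric] sums(1) by (simp add: algebra_simps)
      \<comment> \<open>The survival factor of the other clocks turns the density of rate
        \<open>r a\<close> into that of the total rate, up to the probability that \<open>a\<close>
        is first.\<close>
      have *: "exponential_density (r a) u * exp (- sum r J * u)
          = r a / sum r I * exponential_density (sum r I) u"
      proof (cases "u < 0")
        case False
        then show ?thesis
          unfolding exponential_density_def if_not_P[OF False] mult.assoc e using R by simp
      qed (simp add: exponential_density_def)
      have "ennreal (exponential_density (r a) u) * (ennreal (exp (- sum r J * u)) * H u)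
          = ennreal (exponential_density (r a) u * exp (- sum r J * u)) * H u"
        by (simp only: ennreal_mult[OF nonneg[OF ra] exp_ge_zero] mult.assoc)
      also have "\<dots> = ennreal (r a / sum r I) * (ennreal (exponential_density (sum r I) u) * H u)"
        unfolding * using ra R by (simp only: ennreal_mult[OF _ nonneg[OF R]] less_imp_le divide_pos_pos mult.assoc)
      finally show "ennreal (exponential_density (r a) u) * (ennreal (exp (- sum r J * u)) * H u)
          = ennreal (r a / sum r I) * (ennreal (exponential_density (sum r I) u) * H u)" .
    qed
    also have "\<dots> = ennreal (r a / sum r I) * (\<integral>\<^sup>+u. ennreal (exponential_density (sum r I) u) * H u \<partial>lborel)"
      by (rule nn_integral_cmult) simp
    also have "(\<integral>\<^sup>+u. ennreal (exponential_density (sum r I) u) * H u \<partial>lborel) = (\<integral>\<^sup>+u. H u \<partial>exp_law (sum r I))"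
      by (rule nn_integral_density[symmetric]) simp_all
    finally show ?thesis
      by (simp add: H_def)
  qed
  finally show ?thesis .
qed

text \<open>Restarting the clocks after each ring is the shape that an induction by
  \<open>nn_integral_first_advance\<close> needs, and the bound \<open>m\<close> on the number of
  rings makes the recursion end. At a tie no clock is \<open>first\<close> and the list stops; ties
  are excluded by \<open>regular\<close>.\<close>

primrec rings :: "nat \<Rightarrow> 'i set \<Rightarrow> ('i \<Rightarrow> nat \<Rightarrow> real) \<Rightarrow> real \<Rightarrow> 'i list" where
  "rings 0 I g t = []"
| "rings (Suc m) I g t =
     (if \<exists>a. first I g a \<and> g a 0 \<le> t
      then let a = THE a. first I g a in a # rings m I (advance I a g) (t - g a 0) else [])"

lemma rings_Suc_first:
  assumes "first I g a"
  shows "rings (Suc m) I g t =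
     (if g a 0 \<le> t then a # rings m I (advance I a g) (t - g a 0) else [])"
proof -
  have u: "first I g = (\<lambda>b. b = a)"
    using assms first_unique[OF assms] by (intro ext) metis
  show ?thesis
    by (simp add: u Let_def)
qed

lemma set_rings: "set (rings m I g t) \<subseteq> I"
proof (induction m arbitrary: g t)
  case (Suc m)
  show ?case
  proof (cases "\<exists>a. first I g a")
    case True
    then obtain a where "first I g a" by auto
    then show ?thesis
      using Suc by (auto simp: rings_Suc_first first_def simp del: rings.simps)
  qed simp
qed simp

lemma length_rings: "length (rings m I g t) \<le> m"
proof (induction m arbitrary: g t)
  case (Suc m)
  then show ?case by (simp add: Let_def)
qed simp

lemma measurable_advance:
  assumes "a \<in> I"
  shows "(\<lambda>g. advance I a g) \<in> clock_space I \<rightarrow>\<^sub>M clock_space I"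
proof (rule measurable_clock_spaceI)
  fix j k assume "j \<in> I"
  then show "(\<lambda>g. advance I a g j k) \<in> borel_measurable (clock_space I)"
    using assms by (cases "j = a"; cases "k = 0")
      (auto simp: advance_def intro!: borel_measurable_diff measurable_clock_component)
qed (simp add: advance_def)

lemma pred_first:
  assumes "finite I" "a \<in> I"
  shows "Measurable.pred (clock_space I) (\<lambda>g. first I g a)"
  unfolding first_def using assms
  by (intro pred_intros_logic pred_intros_finite borel_measurable_pred_less measurable_clock_component) auto

lemma sets_rings_eq:
  assumes I: "finite I"
  shows "{x \<in> space (borel \<Otimes>\<^sub>M clock_space I). rings m I (snd x) (fst x) = l}
     \<in> sets (borel \<Otimes>\<^sub>M clock_space I)"
proof (induction m arbitrary: l)
  case 0
  have "{x \<in> space (borel \<Otimes>\<^sub>M clock_space I). rings 0 I (snd x) (fst x) = l}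
      = (if l = [] then space (borel \<Otimes>\<^sub>M clock_space I) else {})"
    by auto
  also have "\<dots> \<in> sets (borel \<Otimes>\<^sub>M clock_space I)"
    by (cases "l = []") (simp_all only: simp_thms if_True if_False sets.top sets.empty_sets)
  finally show ?case .
next
  case (Suc m)
  let ?N = "borel \<Otimes>\<^sub>M clock_space I :: (real \<times> _) measure"
  have ring: "{x \<in> space ?N. first I (snd x) a \<and> snd x a 0 \<le> fst x} \<in> sets ?N" if a: "a \<in> I" for a
  proof -
    have "{x \<in> space ?N. first I (snd x) a} \<in> sets ?N"
      by (rule predE[OF measurable_compose[OF measurable_snd pred_first[OF I a]]])
    moreover have "{x \<in> space ?N. snd x a 0 \<le> fst x} \<in> sets ?N"
      by (rule borel_measurable_le[OF measurable_snd_clock_component[OF a] measurable_fst])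
    ultimately have "{x \<in> space ?N. first I (snd x) a} \<inter> {x \<in> space ?N. snd x a 0 \<le> fst x} \<in> sets ?N"
      by (rule sets.Int)
    then show ?thesis
      by (rule back_subst[where P = "\<lambda>X. X \<in> sets ?N"]) auto
  qed
  show ?case
  proof (cases l)
    case Nil
    have "{x \<in> space ?N. rings (Suc m) I (snd x) (fst x) = l}
        = space ?N - (\<Union>a\<in>I. {x \<in> space ?N. first I (snd x) a \<and> snd x a 0 \<le> fst x})"
      by (auto simp: Nil Let_def first_def)
    then show ?thesis
      by (simp only:) (intro sets.Diff sets.top sets.finite_UN ring I)
  next
    case (Cons a l')
    let ?f = "\<lambda>x. (fst x - snd x a 0, advance I a (snd x)) :: real \<times> _"
    have eq: "{x \<in> space ?N. rings (Suc m) I (snd x) (fst x) = l}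
        = (if a \<in> I then {x \<in> space ?N. first I (snd x) a \<and> snd x a 0 \<le> fst x} \<inter>
            {x \<in> space ?N. rings m I (snd (?f x)) (fst (?f x)) = l'} else {})"
    proof -
      have "rings (Suc m) I g t = l \<longleftrightarrow> first I g a \<and> g a 0 \<le> t \<and> rings m I (advance I a g) (t - g a 0) = l'" for g t
      proof (cases "\<exists>b. first I g b")
        case True
        then obtain b where b: "first I g b" by auto
        have "first I g c \<longleftrightarrow> c = b" for c
          using b first_unique[OF b] by metis
        then show ?thesis
          unfolding rings_Suc_first[OF b] by (auto simp: Cons)
      qed (simp add: Cons)
      then show ?thesis
        by (auto simp: first_def)
    qed
    show ?thesis
    proof (cases "a \<in> I")
      case True
      have f: "?f \<in> ?N \<rightarrow>\<^sub>M ?N"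
        using True by (intro measurable_Pair borel_measurable_diff measurable_fst
            measurable_snd_clock_component measurable_compose[OF measurable_snd measurable_advance])
      have "{x \<in> space ?N. rings m I (snd (?f x)) (fst (?f x)) = l'}
          = ?f -` {x \<in> space ?N. rings m I (snd x) (fst x) = l'} \<inter> space ?N"
        using measurable_space[OF f] by auto
      also have "\<dots> \<in> sets ?N"
        using f Suc by (rule measurable_sets)
      finally show ?thesis
        unfolding eq if_P[OF True] by (rule sets.Int[OF ring[OF True]])
    next
      case False
      then show ?thesis
        unfolding eq by (simp only: if_False sets.empty_sets)
    qed
  qed
qed

text \<open>Only finitely many lists occur, so every function of the list is measurable as soon as
  the events of taking a given value are.\<close>

lemma measurable_rings:
  assumes I: "finite I"
  shows "(\<lambda>x. H (rings m I (snd x) (fst x)) :: ennreal) \<in> borel_measurable (borel \<Otimes>\<^sub>M clock_space I)"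
proof -
  let ?X = "{l. set l \<subseteq> I \<and> length l \<le> m}"
  have "(\<lambda>x. rings m I (snd x) (fst x)) \<in> borel \<Otimes>\<^sub>M clock_space I \<rightarrow>\<^sub>M count_space ?X"
    unfolding measurable_count_space_eq2[OF finite_lists_length_le[OF I]]
  proof (intro conjI ballI Pi_I CollectI set_rings length_rings)
    fix l
    show "(\<lambda>x. rings m I (snd x) (fst x)) -` {l} \<inter> space (borel \<Otimes>\<^sub>M clock_space I) \<in> sets (borel \<Otimes>\<^sub>M clock_space I)"
      by (rule back_subst[where P = "\<lambda>X. X \<in> sets (borel \<Otimes>\<^sub>M clock_space I)", OF sets_rings_eq[OF I, of m l]]) auto
  qed
  then show ?thesis
    by (rule measurable_compose) simp
qed

lemma measurable_rings_fixed:
  assumes I: "finite I"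
  shows "(\<lambda>g. H (rings m I g t) :: ennreal) \<in> borel_measurable (clock_space I)"
  using measurable_compose[OF measurable_Pair1' measurable_rings[OF I], of t H m] by (simp only: fst_conv snd_conv space_borel UNIV_I simp_thms)

lemma sets_exp_law_atMost: "{..t} \<in> sets (exp_law R)"
  by simp

text \<open>Optional stopping in elementary form: a function of the state that is harmonic for the
  rate-weighted choice of the next ring keeps its mean along the rings up to \<open>t\<close>, for
  every bound \<open>m\<close>. Which clock rings first is independent of when it rings, so the
  horizon only decides whether a further step is taken.\<close>

theorem nn_integral_fold_rings:
  fixes H :: "'s \<Rightarrow> real"
  assumes I: "finite I" and r: "\<And>i. i \<in> I \<Longrightarrow> 0 < r i"
    and H: "\<And>s. 0 \<le> H s"
    and inv: "\<And>s i. P s \<Longrightarrow> i \<in> I \<Longrightarrow> P (f i s)"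
    and harmonic: "\<And>s. P s \<Longrightarrow> (\<Sum>i\<in>I. r i * H (f i s)) = sum r I * H s"
    and s: "P s"
  shows "(\<integral>\<^sup>+g. ennreal (H (fold f (rings m I g t) s)) \<partial>clock_law r I) = ennreal (H s)"
proof -
  interpret N: prob_space "clock_law r I"
    using r by (rule prob_space_clock_law)
  show ?thesis
  proof (cases "I = {}")
    case True
    then have "rings m I g t = []" for g
      using set_rings[of m I g t] by auto
    then show ?thesis
      by (simp add: N.emeasure_space_1)
  next
    case False
    define R where "R = sum r I"
    have R: "0 < R"
      unfolding R_def using I False r by (intro sum_pos) auto
    interpret E: prob_space "exp_law R"
      using R by (rule prob_space_exponential_density)
    show ?thesis
      using s
    proof (induction m arbitrary: s t)
      case 0
      then show ?case by (simp add: N.emeasure_space_1)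
    next
      case (Suc m)
      \<comment> \<open>The probability that some clock rings by time \<open>t\<close>, the minimum
        of the clocks being exponential with the total rate.\<close>
      define p where "p = (\<integral>\<^sup>+u. indicator {..t} u \<partial>exp_law R)"
      have p1: "p \<le> 1"
        unfolding p_def using E.emeasure_le_1 by simp
      let ?B = "\<lambda>a. {g. first I g a}"
      have mI: "(\<lambda>x. indicator {..t} (fst x) :: ennreal) \<in> borel_measurable (borel \<Otimes>\<^sub>M clock_space I)"
        by (rule measurable_compose[OF measurable_fst]) simp
      have ind_m: "(\<lambda>g. indicator {..t} (g a 0) :: ennreal) \<in> borel_measurable (clock_law r I)" if "a \<in> I" for a
        unfolding measurable_cong_sets[OF sets_clock_law refl]
        by (rule measurable_compose[OF measurable_clock_component[OF that]]) simp
      have first_m: "(\<lambda>g. indicator (?B a) g :: ennreal) \<in> borel_measurable (clock_law r I)" if "a \<in> I" for a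
        unfolding measurable_cong_sets[OF sets_clock_law refl] using I that by (rule measurable_first)
      have tail: "(\<integral>\<^sup>+g. indicator (?B a) g * (indicator {..t} (g a 0) *
            ennreal (H (fold f (rings m I (advance I a g) (t - g a 0)) (f a s)))) \<partial>clock_law r I)
          = ennreal (r a / R) * (p * ennreal (H (f a s)))" if a: "a \<in> I" for a
      proof -
        have m': "(\<lambda>x. (t - fst x, snd x)) \<in> borel \<Otimes>\<^sub>M clock_space I \<rightarrow>\<^sub>M borel \<Otimes>\<^sub>M clock_space I"
          by (intro measurable_Pair borel_measurable_diff measurable_const measurable_fst measurable_snd) simp
        have "(\<lambda>x. ennreal (H (fold f (rings m I (snd x) (t - fst x)) (f a s))))
            \<in> borel_measurable (borel \<Otimes>\<^sub>M clock_space I)"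
          using measurable_compose[OF m' measurable_rings[OF I, of "\<lambda>l. ennreal (H (fold f l (f a s)))" m]]
          by (simp only: fst_conv snd_conv)
        from borel_measurable_times_ennreal[OF mI this]
        have "(\<lambda>(u, g). indicator {..t} u * ennreal (H (fold f (rings m I g (t - u)) (f a s))))
            \<in> borel_measurable (borel \<Otimes>\<^sub>M clock_space I)"
          by (simp only: case_prod_unfold)
        from nn_integral_first_advance[where r = r and F = "\<lambda>u g. indicator {..t} u * ennreal (H (fold f (rings m I g (t - u)) (f a s)))", OF I a r this]
        have "(\<integral>\<^sup>+g. indicator (?B a) g * (indicator {..t} (g a 0) *
            ennreal (H (fold f (rings m I (advance I a g) (t - g a 0)) (f a s)))) \<partial>clock_law r I)
          = ennreal (r a / R) * (\<integral>\<^sup>+u. \<integral>\<^sup>+g. indicator {..t} u * ennreal (H (fold f (rings m I g (t - u)) (f a s)))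
              \<partial>clock_law r I \<partial>exp_law R)"
          by (simp only: R_def)
        also have "\<dots> = ennreal (r a / R) * (\<integral>\<^sup>+u. indicator {..t} u * ennreal (H (f a s)) \<partial>exp_law R)"
        proof -
          have "(\<integral>\<^sup>+g. indicator {..t} u * ennreal (H (fold f (rings m I g (t - u)) (f a s))) \<partial>clock_law r I)
              = indicator {..t} u * ennreal (H (f a s))" for u
          proof -
            have "(\<lambda>g. ennreal (H (fold f (rings m I g (t - u)) (f a s)))) \<in> borel_measurable (clock_law r I)"
              unfolding measurable_cong_sets[OF sets_clock_law refl]
              by (rule measurable_rings_fixed[OF I])
            from nn_integral_cmult[OF this] Suc.IH[OF inv[OF Suc.prems a]] show ?thesis
              by (simp only:)
          qed
          then show ?thesis by (simp only:)
        qed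
        also have "\<dots> = ennreal (r a / R) * (p * ennreal (H (f a s)))"
          unfolding p_def by (simp only: nn_integral_multc[OF borel_measurable_indicator[OF sets_exp_law_atMost]])
        finally show ?thesis .
      qed
      have hit: "(\<integral>\<^sup>+g. indicator (?B a) g * indicator {..t} (g a 0) \<partial>clock_law r I)
          = ennreal (r a / R) * p" if a: "a \<in> I" for a
      proof -
        have "(\<lambda>(u, g). indicator {..t} u :: ennreal) \<in> borel_measurable (borel \<Otimes>\<^sub>M clock_space I)"
          using mI by (simp only: case_prod_unfold)
        from nn_integral_first_advance[where r = r and F = "\<lambda>u g. indicator {..t} u", OF I a r this]
        show ?thesis
          by (simp only: R_def[symmetric] p_def nn_integral_const N.emeasure_space_1 mult_1_right)
      qed
      define A where "A = {g. \<exists>a. first I g a \<and> g a 0 \<le> t}"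
      have indA: "indicator A g = (\<Sum>a\<in>I. indicator (?B a) g * indicator {..t} (g a 0) :: ennreal)" for g
      proof (cases "\<exists>a. first I g a")
        case True
        then obtain a where a: "first I g a" by auto
        have u: "first I g b \<longleftrightarrow> b = a" for b
          using a first_unique[OF a] by metis
        have "(\<Sum>b\<in>I. indicator (?B b) g * indicator {..t} (g b 0) :: ennreal)
            = (\<Sum>b\<in>I. if b = a then indicator {..t} (g a 0) else 0)"
          by (intro sum.cong refl) (simp add: u indicator_def)
        also have "\<dots> = indicator {..t} (g a 0)"
          using I a by (simp add: first_def)
        also have "\<dots> = indicator A g"
          by (simp add: A_def indicator_def u)
        finally show ?thesis ..
      qed (auto simp: A_def)
      have As: "A \<inter> space (clock_law r I) \<in> sets (clock_law r I)"
      proof -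
        have "(\<lambda>g. indicator A g :: ennreal) \<in> borel_measurable (clock_law r I)"
          unfolding indA by (intro borel_measurable_sum borel_measurable_times_ennreal first_m ind_m)
        then show ?thesis
          by (rule borel_measurable_indicator_iff[THEN iffD1])
      qed
      have sumr: "(\<Sum>a\<in>I. ennreal (r a / R) * (p * ennreal (h a))) = p * ennreal ((\<Sum>a\<in>I. r a * h a) / R)"
        if "\<And>a. 0 \<le> h a" for h
      proof -
        have "(\<Sum>a\<in>I. ennreal (r a / R) * (p * ennreal (h a))) = (\<Sum>a\<in>I. p * ennreal (r a * h a / R))"
        proof (rule sum.cong[OF refl])
          fix a assume "a \<in> I"
          then have "ennreal (r a / R) * ennreal (h a) = ennreal (r a * h a / R)"
            using r[of a] R that[of a] by (subst ennreal_mult[symmetric]) auto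
          then show "ennreal (r a / R) * (p * ennreal (h a)) = p * ennreal (r a * h a / R)"
            by (metis mult.left_commute)
        qed
        also have "\<dots> = p * ennreal ((\<Sum>a\<in>I. r a * h a) / R)"
        proof -
          have "0 \<le> r a * h a / R" if "a \<in> I" for a
            using r[OF that] R \<open>\<And>a. 0 \<le> h a\<close>[of a] by simp
          then show ?thesis
            unfolding sum_distrib_left[symmetric] sum_divide_distrib by (simp only: sum_ennreal)
        qed
        finally show ?thesis .
      qed
      \<comment> \<open>The clocks share the probability \<open>p\<close> in the proportions
        \<open>r a / R\<close>, which add up to 1.\<close>
      have emA: "emeasure (clock_law r I) (A \<inter> space (clock_law r I)) = p"
      proof -
        have "emeasure (clock_law r I) (A \<inter> space (clock_law r I))
            = (\<integral>\<^sup>+g. indicator (A \<inter> space (clock_law r I)) g \<partial>clock_law r I)"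
          using As by (rule nn_integral_indicator[symmetric])
        also have "\<dots> = (\<integral>\<^sup>+g. indicator A g \<partial>clock_law r I)"
          by (rule nn_integral_cong) (simp add: indicator_def)
        also have "\<dots> = (\<Sum>a\<in>I. \<integral>\<^sup>+g. indicator (?B a) g * indicator {..t} (g a 0) \<partial>clock_law r I)"
          unfolding indA by (intro nn_integral_sum borel_measurable_times_ennreal first_m ind_m)
        also have "\<dots> = (\<Sum>a\<in>I. ennreal (r a / R) * (p * ennreal 1))"
          by (intro sum.cong refl) (simp only: hit ennreal_1 mult_1_right)
        also have "\<dots> = p"
          using sumr[of "\<lambda>_. 1"] R by (simp add: R_def)
        finally show ?thesis .
      qed
      have co: "(\<integral>\<^sup>+g. indicator (- A) g * ennreal (H s) \<partial>clock_law r I) = (1 - p) * ennreal (H s)"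
      proof -
        let ?S = "space (clock_law r I)"
        have "(\<integral>\<^sup>+g. indicator (- A) g * ennreal (H s) \<partial>clock_law r I)
            = (\<integral>\<^sup>+g. ennreal (H s) * indicator (?S - A \<inter> ?S) g \<partial>clock_law r I)"
          by (rule nn_integral_cong) (simp add: indicator_def)
        also have "\<dots> = ennreal (H s) * emeasure (clock_law r I) (?S - A \<inter> ?S)"
          by (intro nn_integral_cmult_indicator sets.compl_sets As)
        also have "emeasure (clock_law r I) (?S - A \<inter> ?S) = 1 - p"
        proof -
          have "emeasure (clock_law r I) (A \<inter> ?S) \<noteq> \<infinity>"
            by simp
          from emeasure_compl[OF As this] show ?thesis
            by (simp only: emA N.emeasure_space_1)
        qed
        finally show ?thesis by (simp add: mult.commute)
      qed
      \<comment> \<open>Either a first ring comes by time \<open>t\<close> and the rest is the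
        restarted process from the new state, or nothing happens.\<close>
      have split: "ennreal (H (fold f (rings (Suc m) I g t) s))
          = (\<Sum>a\<in>I. indicator (?B a) g * (indicator {..t} (g a 0) *
              ennreal (H (fold f (rings m I (advance I a g) (t - g a 0)) (f a s)))))
            + indicator (- A) g * ennreal (H s)" for g
      proof (cases "\<exists>a. first I g a \<and> g a 0 \<le> t")
        case True
        then obtain a where a: "first I g a" "g a 0 \<le> t" by auto
        have u: "first I g b \<longleftrightarrow> b = a" for b
          using a first_unique[OF a(1)] by metis
        have "(\<Sum>b\<in>I. indicator (?B b) g * (indicator {..t} (g b 0) *
              ennreal (H (fold f (rings m I (advance I b g) (t - g b 0)) (f b s)))))
            = (\<Sum>b\<in>I. if b = a then ennreal (H (fold f (rings m I (advance I a g) (t - g a 0)) (f a s))) else 0)"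
          using a(2) by (intro sum.cong refl) (simp add: u indicator_def)
        also have "\<dots> = ennreal (H (fold f (rings m I (advance I a g) (t - g a 0)) (f a s)))"
          using I a by (simp add: first_def)
        finally show ?thesis
          using a True by (simp add: rings_Suc_first[OF a(1)] A_def del: rings.simps)
      next
        case False
        then have "(\<Sum>b\<in>I. indicator (?B b) g * (indicator {..t} (g b 0) *
              ennreal (H (fold f (rings m I (advance I b g) (t - g b 0)) (f b s))))) = 0"
          using I by (intro sum.neutral) (auto simp: indicator_def)
        moreover have "rings (Suc m) I g t = []"
          using False unfolding rings.simps by (rule if_not_P)
        moreover have "indicator (- A) g = (1 :: ennreal)"
          using False unfolding A_def by simp
        ultimately show ?thesis
          by (simp del: rings.simps)
      qed
      have "(\<integral>\<^sup>+g. ennreal (H (fold f (rings (Suc m) I g t) s)) \<partial>clock_law r I)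
          = (\<Sum>a\<in>I. \<integral>\<^sup>+g. indicator (?B a) g * (indicator {..t} (g a 0) *
              ennreal (H (fold f (rings m I (advance I a g) (t - g a 0)) (f a s)))) \<partial>clock_law r I)
            + (\<integral>\<^sup>+g. indicator (- A) g * ennreal (H s) \<partial>clock_law r I)"
      proof -
        have m1: "(\<lambda>g. indicator (?B a) g * (indicator {..t} (g a 0) *
              ennreal (H (fold f (rings m I (advance I a g) (t - g a 0)) (f a s)))))
            \<in> borel_measurable (clock_law r I)" if a: "a \<in> I" for a
        proof -
          have "(\<lambda>g. (t - g a 0, advance I a g)) \<in> clock_space I \<rightarrow>\<^sub>M borel \<Otimes>\<^sub>M clock_space I"
            using a by (intro measurable_Pair borel_measurable_diff measurable_clock_component measurable_advance) auto
          from measurable_compose[OF this measurable_rings[OF I, of "\<lambda>l. ennreal (H (fold f l (f a s)))" m]]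
          have "(\<lambda>g. ennreal (H (fold f (rings m I (advance I a g) (t - g a 0)) (f a s))))
              \<in> borel_measurable (clock_law r I)"
            unfolding measurable_cong_sets[OF sets_clock_law refl] by (simp only: fst_conv snd_conv)
          with a show ?thesis
            by (intro borel_measurable_times_ennreal first_m ind_m)
        qed
        have mA: "(\<lambda>g. indicator (- A) g * ennreal (H s)) \<in> borel_measurable (clock_law r I)"
        proof (intro borel_measurable_times_ennreal borel_measurable_const)
          have "- A \<inter> space (clock_law r I) = space (clock_law r I) - A \<inter> space (clock_law r I)" by auto
          then show "(\<lambda>g. indicator (- A) g :: ennreal) \<in> borel_measurable (clock_law r I)"
            using sets.compl_sets[OF As] by (intro borel_measurable_indicator_iff[THEN iffD2]) (simp only:)
        qed
        show ?thesis
          unfolding split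
          by (subst nn_integral_add[OF borel_measurable_sum[OF m1] mA]) (simp_all only: nn_integral_sum[OF m1])
      qed
      \<comment> \<open>Harmonicity: the average of \<open>H\<close> over the next ring is
        \<open>H s\<close>, just as when no ring comes.\<close>
      also have "\<dots> = p * ennreal (H s) + (1 - p) * ennreal (H s)"
      proof -
        have "(\<Sum>a\<in>I. r a * H (f a s)) / R = H s"
          using harmonic[OF Suc.prems] R by (simp add: R_def)
        moreover have "(\<Sum>a\<in>I. \<integral>\<^sup>+g. indicator (?B a) g * (indicator {..t} (g a 0) *
              ennreal (H (fold f (rings m I (advance I a g) (t - g a 0)) (f a s)))) \<partial>clock_law r I)
            = (\<Sum>a\<in>I. ennreal (r a / R) * (p * ennreal (H (f a s))))"
          by (intro sum.cong refl) (rule tail)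
        ultimately show ?thesis
          by (simp only: co sumr[of "\<lambda>a. H (f a s)", OF H])
      qed
      also have "\<dots> = (p + (1 - p)) * ennreal (H s)"
        by (simp add: distrib_right)
      also have "p + (1 - p) = 1"
        using p1 by (simp add: add_diff_inverse_ennreal)
      finally show ?case by simp
    qed
  qed
qed

section \<open>Finite systems and barriers\<close>

lemma (in linorder) sorted_key_list_of_set_eqI:
  fixes key :: "'b \<Rightarrow> 'a"
  assumes "inj_on key S" "set xs = S" "sorted (map key xs)" "distinct xs"
  shows "sorted_key_list_of_set key S = xs"
proof -
  interpret folding_insort_key "(\<le>)" "(<)" S key
    by standard (rule assms(1))
  show ?thesis
    using idem_if_sorted_distinct[of xs] assms by simp
qed

lemma (in linorder) sorted_key_list_of_set_props:
  fixes key :: "'b \<Rightarrow> 'a"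
  assumes "inj_on key S" "finite S"
  shows "set (sorted_key_list_of_set key S) = S"
    and "sorted (map key (sorted_key_list_of_set key S))"
    and "distinct (sorted_key_list_of_set key S)"
proof -
  interpret folding_insort_key "(\<le>)" "(<)" S key
    by standard (rule assms(1))
  show "set (sorted_key_list_of_set key S) = S"
    using assms by simp
  show "sorted (map key (sorted_key_list_of_set key S))"
    by simp
  show "distinct (sorted_key_list_of_set key S)"
    using distinct_sorted_key_list_of_set[OF subset_refl] by (rule distinct_if_distinct_map)
qed

definition ring_sum :: "('i \<Rightarrow> nat \<Rightarrow> real) \<Rightarrow> 'i \<times> nat \<Rightarrow> real" where
  "ring_sum g r = (\<Sum>j\<le>snd r. g (fst r) j)"

definition rings_until :: "'i set \<Rightarrow> ('i \<Rightarrow> nat \<Rightarrow> real) \<Rightarrow> real \<Rightarrow> ('i \<times> nat) set" where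
  "rings_until I g t = {r \<in> I \<times> UNIV. ring_sum g r \<le> t}"

text \<open>Translates ring numbers of the advanced clocks into those of the original ones: only
  clock \<open>a\<close> has used up its ring number 0.\<close>

definition bump :: "'i \<Rightarrow> 'i \<times> nat \<Rightarrow> 'i \<times> nat" where
  "bump a r = (fst r, if fst r = a then Suc (snd r) else snd r)"

lemma ring_sum_advance:
  assumes "i \<in> I"
  shows "ring_sum (advance I a g) (i, k) = ring_sum g (bump a (i, k)) - g a 0"
proof (cases "i = a")
  case True
  then show ?thesis
    using assms by (simp add: ring_sum_def bump_def advance_def sum.atMost_Suc_shift del: sum.atMost_Suc)
next
  case False
  have "(\<Sum>j\<le>k. lower u h j) = (\<Sum>j\<le>k. h j) - u" for u and h :: "nat \<Rightarrow> real"
    by (induction k) auto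
  then show ?thesis
    using assms False by (simp add: ring_sum_def bump_def advance_def del: fun_upd_apply)
qed

lemma ring_sum_ge_first:
  assumes "\<And>k. 0 < g i k"
  shows "g i 0 \<le> ring_sum g (i, k)"
  by (induction k) (use assms in \<open>auto simp: ring_sum_def intro: add_increasing2 less_imp_le\<close>)

text \<open>The earliest ring is the first ring of the clock with the smallest first waiting time,
  and removing it leaves the rings of the advanced clocks. This links the sorted list in
  \<open>finite_system\<close> to the recursion for which expectations are computed.\<close>

lemma map_fst_sorted_rings:
  assumes "finite I" "\<And>i k. i \<in> I \<Longrightarrow> 0 < g i k" "inj_on (ring_sum g) (I \<times> UNIV)"
    and "finite (rings_until I g t)" "card (rings_until I g t) \<le> m"
  shows "map fst (sorted_key_list_of_set (ring_sum g) (rings_until I g t)) = rings m I g t"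
  using assms(2-)
proof (induction m arbitrary: g t)
  case 0
  then have "rings_until I g t = {}" by simp
  then show ?case
    by (simp add: sorted_key_list_of_set_eqI[of "ring_sum g" "{}" "[]"])
next
  case (Suc m)
  show ?case
  proof (cases "rings_until I g t = {}")
    case True
    have "\<not> (first I g a \<and> g a 0 \<le> t)" for a
    proof
      assume "first I g a \<and> g a 0 \<le> t"
      then have "(a, 0) \<in> rings_until I g t"
        by (simp add: rings_until_def ring_sum_def first_def)
      with True show False by simp
    qed
    then have "rings (Suc m) I g t = []"
      unfolding rings.simps by (intro if_not_P) blast
    then show ?thesis
      using True by (simp add: sorted_key_list_of_set_eqI[of "ring_sum g" "{}" "[]"])
  next
    case False
    then obtain i0 k0 where r0: "i0 \<in> I" "ring_sum g (i0, k0) \<le> t"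
      by (auto simp: rings_until_def)
    define a where "a = arg_min_on (\<lambda>i. g i 0) I"
    have aI: "a \<in> I" and amin: "\<And>i. i \<in> I \<Longrightarrow> g a 0 \<le> g i 0"
      unfolding a_def using arg_min_if_finite[of I "\<lambda>i. g i 0"] assms(1) r0(1)
      by (auto intro: arg_min_least)
    have fa: "first I g a"
      unfolding first_def
    proof (intro conjI ballI aI)
      fix i assume i: "i \<in> I - {a}"
      have "g a 0 \<noteq> g i 0"
        using inj_onD[OF Suc.prems(2), of "(a, 0)" "(i, 0)"] i aI by (auto simp: ring_sum_def)
      with amin[of i] i show "g a 0 < g i 0" by auto
    qed
    have ge: "g a 0 \<le> ring_sum g (i, k)" if "i \<in> I" for i k
      using amin[OF that] ring_sum_ge_first[of g i k] Suc.prems(1)[OF that] by simp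
    have at: "g a 0 \<le> t"
      using ge[OF r0(1)] r0(2) by (rule order_trans)
    let ?g = "advance I a g" let ?t = "t - g a 0"
    have pos: "0 < ?g i k" if i: "i \<in> I" for i k
      using fa i Suc.prems(1)[OF i] by (auto simp: advance_def first_def)
    have ibump: "inj_on (bump a) X" for X
      by (auto simp: inj_on_def bump_def prod_eq_iff split: if_splits)
    have key: "ring_sum ?g r = ring_sum g (bump a r) - g a 0" if "r \<in> I \<times> UNIV" for r
      using that ring_sum_advance[of "fst r" I a g "snd r"] by (cases r) auto
    have bI: "bump a r \<in> I \<times> UNIV \<longleftrightarrow> r \<in> I \<times> UNIV" for r
      by (auto simp: bump_def mem_Times_iff)
    have inj: "inj_on (ring_sum ?g) (I \<times> UNIV)"
    proof (rule inj_onI)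
      fix r r' assume r: "r \<in> I \<times> UNIV" "r' \<in> I \<times> (UNIV :: nat set)" "ring_sum ?g r = ring_sum ?g r'"
      then have "bump a r = bump a r'"
        using key bI by (intro inj_onD[OF Suc.prems(2)]) auto
      with ibump[of UNIV] show "r = r'"
        by (auto dest: injD)
    qed
    \<comment> \<open>Apart from the earliest one, the rings up to \<open>t\<close> are those of the
      restarted clocks up to \<open>t - g a 0\<close>, renumbered.\<close>
    have eq: "rings_until I g t = insert (a, 0) (bump a ` rings_until I ?g ?t)"
    proof (intro set_eqI iffI)
      fix r assume r: "r \<in> rings_until I g t"
      show "r \<in> insert (a, 0) (bump a ` rings_until I ?g ?t)"
      proof (cases "r = (a, 0)")
        case False
        then have "r = bump a (fst r, if fst r = a then snd r - 1 else snd r)"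
          by (cases r) (auto simp: bump_def)
        then obtain r' where r': "r = bump a r'" by blast
        then have "r' \<in> rings_until I ?g ?t"
          using r bI[of r'] key[of r'] by (auto simp: rings_until_def)
        with r' show ?thesis by auto
      qed simp
    next
      fix r assume "r \<in> insert (a, 0) (bump a ` rings_until I ?g ?t)"
      then show "r \<in> rings_until I g t"
      proof
        assume "r \<in> bump a ` rings_until I ?g ?t"
        then obtain r' where "r = bump a r'" "r' \<in> rings_until I ?g ?t" by auto
        then show ?thesis
          using bI[of r'] key[of r'] by (auto simp: rings_until_def)
      qed (use aI at in \<open>simp add: rings_until_def ring_sum_def\<close>)
    qed
    have notin: "(a, 0) \<notin> bump a ` rings_until I ?g ?t"
      by (auto simp: bump_def)
    have fin: "finite (rings_until I ?g ?t)"
      using Suc.prems(3) eq ibump by (auto dest: finite_imageD)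
    have "card (rings_until I g t) = Suc (card (rings_until I ?g ?t))"
      unfolding eq using notin fin by (simp add: card_image[OF ibump])
    then have card: "card (rings_until I ?g ?t) \<le> m"
      using Suc.prems(4) by simp
    let ?xs = "sorted_key_list_of_set (ring_sum ?g) (rings_until I ?g ?t)"
    have injS: "inj_on (ring_sum ?g) (rings_until I ?g ?t)"
      using inj by (rule inj_on_subset) (auto simp: rings_until_def)
    note xs = sorted_key_list_of_set_props[OF injS fin]
    have "sorted_key_list_of_set (ring_sum g) (rings_until I g t) = (a, 0) # map (bump a) ?xs"
    proof (rule sorted_key_list_of_set_eqI)
      show "inj_on (ring_sum g) (rings_until I g t)"
        using Suc.prems(2) by (rule inj_on_subset) (auto simp: rings_until_def)
      show "set ((a, 0) # map (bump a) ?xs) = rings_until I g t"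
        by (simp add: xs eq)
      have E: "map (ring_sum g \<circ> bump a) ?xs = map (\<lambda>x. x + g a 0) (map (ring_sum ?g) ?xs)"
        using xs(1) key by (auto simp: rings_until_def)
      have "sorted (map (\<lambda>x. x + g a 0) (map (ring_sum ?g) ?xs))"
        using xs(2) by (simp add: sorted_map)
      then have "sorted (map (ring_sum g) (map (bump a) ?xs))"
        by (simp only: map_map E)
      moreover have "\<forall>r\<in>set (map (bump a) ?xs). ring_sum g (a, 0) \<le> ring_sum g r"
      proof
        fix r assume "r \<in> set (map (bump a) ?xs)"
        then have "r \<in> rings_until I g t"
          using xs(1) eq by auto
        then show "ring_sum g (a, 0) \<le> ring_sum g r"
          using ge[of "fst r" "snd r"] by (simp add: ring_sum_def[of g "(a, 0)"] rings_until_def mem_Times_iff)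
      qed
      ultimately show "sorted (map (ring_sum g) ((a, 0) # map (bump a) ?xs))"
        by simp
      show "distinct ((a, 0) # map (bump a) ?xs)"
        using xs notin ibump by (simp add: distinct_map)
    qed
    then have "map fst (sorted_key_list_of_set (ring_sum g) (rings_until I g t)) = a # map fst ?xs"
      by (simp add: bump_def comp_def)
    also have "map fst ?xs = rings m I ?g ?t"
      by (rule Suc.IH[OF pos inj fin card])
    finally show ?thesis
      using at by (simp only: rings_Suc_first[OF fa] if_True)
  qed
qed

section \<open>Histories of finite systems\<close>

definition regular :: "ereal \<Rightarrow> (clock \<Rightarrow> particle \<Rightarrow> nat \<Rightarrow> real) \<Rightarrow> bool" where
  "regular lam gap \<longleftrightarrow> (\<forall>c\<in>clocks lam. \<forall>p k. 0 < gap c p k) \<and>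
     inj_on (ring_time gap) {(c, p, k). c \<in> clocks lam} \<and>
     (\<forall>c\<in>clocks lam. \<forall>p t. finite {k. ring_time gap (c, p, k) \<le> t})"

definition ring_set :: "ereal \<Rightarrow> (clock \<Rightarrow> particle \<Rightarrow> nat \<Rightarrow> real) \<Rightarrow> particle set \<Rightarrow> real \<Rightarrow> ring set" where
  "ring_set lam gap A t = {(c, p, k). c \<in> clocks lam \<and> p \<in> A \<and> ring_time gap (c, p, k) \<le> t}"

definition ring_list :: "ereal \<Rightarrow> (clock \<Rightarrow> particle \<Rightarrow> nat \<Rightarrow> real) \<Rightarrow> particle set \<Rightarrow> real \<Rightarrow> ring list" where
  "ring_list lam gap A t = sorted_key_list_of_set (ring_time gap) (ring_set lam gap A t)"

abbreviation label :: "ring \<Rightarrow> clock \<times> particle" where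
  "label r \<equiv> (fst r, fst (snd r))"

definition history :: "ereal \<Rightarrow> (clock \<Rightarrow> particle \<Rightarrow> nat \<Rightarrow> real) \<Rightarrow> particle set \<Rightarrow> real \<Rightarrow> (clock \<times> particle) list" where
  "history lam gap A t = map label (ring_list lam gap A t)"

lemma finite_clocks: "finite (clocks lam)"
  by (simp add: clocks_def)

lemma apply_ring_step: "apply_ring lam A r s = step lam A (label r) s"
proof -
  obtain c p k where "r = (c, p, k)" by (metis prod.collapse)
  then show ?thesis
    by (cases c; cases s) (simp_all add: step_def)
qed

lemma finite_system_history: "finite_system lam A gap t = fold (step lam A) (history lam gap A t) (start lam A)"
proof -
  have "(\<lambda>(x, i). x) = (fst :: particle \<Rightarrow> int)"
    by auto
  moreover have "fold (apply_ring lam A) l s = fold (step lam A) (map label l) s" for l s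
    by (induction l arbitrary: s) (simp_all add: apply_ring_step)
  ultimately show ?thesis
    by (simp add: finite_system_def history_def ring_list_def ring_set_def start_def)
qed

context
  fixes lam :: ereal and gap :: "clock \<Rightarrow> particle \<Rightarrow> nat \<Rightarrow> real"
  assumes reg: "regular lam gap"
begin

lemma gap_pos: "c \<in> clocks lam \<Longrightarrow> 0 < gap c p k"
  using reg unfolding regular_def by blast

lemma finite_ring_set: "finite A \<Longrightarrow> finite (ring_set lam gap A t)"
proof -
  assume "finite A"
  have "ring_set lam gap A t = (\<Union>c\<in>clocks lam. \<Union>p\<in>A. (\<lambda>k. (c, p, k)) ` {k. ring_time gap (c, p, k) \<le> t})"
    by (auto simp: ring_set_def simp del: ring_time.simps)
  also have "finite \<dots>"
    using reg \<open>finite A\<close> unfolding regular_def by (intro finite_UN_I finite_imageI finite_clocks) blast+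
  finally show ?thesis .
qed

lemma inj_on_ring_set: "inj_on (ring_time gap) (ring_set lam gap A t)"
  using reg unfolding regular_def by (auto simp: ring_set_def intro: inj_on_subset simp del: ring_time.simps)

lemma ring_list_props:
  assumes "finite A"
  shows "set (ring_list lam gap A t) = ring_set lam gap A t"
    and "sorted (map (ring_time gap) (ring_list lam gap A t))"
    and "distinct (ring_list lam gap A t)"
  unfolding ring_list_def by (rule sorted_key_list_of_set_props[OF inj_on_ring_set finite_ring_set[OF assms]])+

lemma ring_list_eqI:
  assumes "set xs = ring_set lam gap A t" "sorted (map (ring_time gap) xs)" "distinct xs"
  shows "ring_list lam gap A t = xs"
  unfolding ring_list_def using inj_on_ring_set assms by (rule sorted_key_list_of_set_eqI)

lemma history_rings:
  assumes A: "finite A" and m: "card (ring_set lam gap A t) \<le> m"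
  shows "history lam gap A t = rings m (clocks lam \<times> A) (case_prod gap) t"
proof -
  let ?I = "clocks lam \<times> A" and ?g = "case_prod gap"
  define f where "f r = (fst (fst r), snd (fst r), snd r)" for r :: "(clock \<times> particle) \<times> nat"
  have key: "ring_time gap (f r) = ring_sum ?g r" for r
    by (simp add: f_def ring_sum_def case_prod_unfold)
  have f: "inj_on f X" for X
    by (auto simp: inj_on_def f_def prod_eq_iff)
  have img: "f ` rings_until ?I ?g t = ring_set lam gap A t"
  proof (intro set_eqI iffI)
    fix r assume "r \<in> ring_set lam gap A t"
    then obtain c p k where r: "r = (c, p, k)" "c \<in> clocks lam" "p \<in> A" "ring_time gap (c, p, k) \<le> t"
      by (auto simp: ring_set_def simp del: ring_time.simps)
    have "f ((c, p), k) = r" by (simp add: f_def r)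
    moreover have "((c, p), k) \<in> rings_until ?I ?g t"
      using r key[of "((c, p), k)"] by (simp add: rings_until_def f_def del: ring_time.simps)
    ultimately show "r \<in> f ` rings_until ?I ?g t" by blast
  next
    fix r assume "r \<in> f ` rings_until ?I ?g t"
    then obtain q where q: "r = f q" "q \<in> rings_until ?I ?g t" by auto
    with key[of q] show "r \<in> ring_set lam gap A t"
      by (auto simp: rings_until_def ring_set_def f_def simp del: ring_time.simps)
  qed
  have fin: "finite (rings_until ?I ?g t)"
    by (rule finite_imageD[OF _ f]) (simp only: img finite_ring_set[OF A])
  have card: "card (rings_until ?I ?g t) \<le> m"
    using m card_image[OF f, of "rings_until ?I ?g t"] img by simp
  have inj: "inj_on (ring_sum ?g) (?I \<times> UNIV)"
  proof (rule inj_onI)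
    fix r r' assume r: "r \<in> ?I \<times> UNIV" "r' \<in> ?I \<times> (UNIV :: nat set)" "ring_sum ?g r = ring_sum ?g r'"
    have "inj_on (ring_time gap) {(c, p, k). c \<in> clocks lam}"
      using reg by (simp add: regular_def)
    then have "f r = f r'"
      by (rule inj_onD) (use r key in \<open>auto simp: f_def\<close>)
    with f[of UNIV] show "r = r'"
      by (auto dest: injD)
  qed
  let ?xs = "sorted_key_list_of_set (ring_sum ?g) (rings_until ?I ?g t)"
  have "inj_on (ring_sum ?g) (rings_until ?I ?g t)"
    using inj by (rule inj_on_subset) (auto simp: rings_until_def)
  note xs = sorted_key_list_of_set_props[OF this fin]
  have "ring_list lam gap A t = map f ?xs"
  proof (rule ring_list_eqI)
    show "set (map f ?xs) = ring_set lam gap A t"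
      by (simp add: xs img)
    show "sorted (map (ring_time gap) (map f ?xs))"
      using xs(2) by (simp add: comp_def key del: ring_time.simps)
    show "distinct (map f ?xs)"
      using xs f by (simp add: distinct_map)
  qed
  then have "history lam gap A t = map fst ?xs"
    by (simp add: history_def f_def comp_def)
  also have "\<dots> = rings m ?I ?g t"
    using reg A fin card inj
    by (intro map_fst_sorted_rings) (auto simp: finite_clocks regular_def)
  finally show ?thesis .
qed

lemma ring_list_split:
  assumes A: "finite A" and st: "s \<le> t"
  shows "ring_list lam gap A t = ring_list lam gap A s @ filter (\<lambda>r. s < ring_time gap r) (ring_list lam gap A t)"
proof (rule ring_list_eqI)
  note P = ring_list_props[OF A]
  show "set (ring_list lam gap A s @ filter (\<lambda>r. s < ring_time gap r) (ring_list lam gap A t)) = ring_set lam gap A t"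
    using st by (auto simp: P ring_set_def simp del: ring_time.simps)
  show "sorted (map (ring_time gap) (ring_list lam gap A s @ filter (\<lambda>r. s < ring_time gap r) (ring_list lam gap A t)))"
    using P(2)[of t] P(2)[of s]
    by (auto simp: sorted_append P ring_set_def sorted_filter simp del: ring_time.simps)
  show "distinct (ring_list lam gap A s @ filter (\<lambda>r. s < ring_time gap r) (ring_list lam gap A t))"
    using P(3) by (auto simp: P ring_set_def simp del: ring_time.simps)
qed

text \<open>The last conclusion lets statements about all times between \<open>s\<close> and
  \<open>t\<close> be used in inductions along the list: every prefix of the continuation is what
  has happened by some intermediate time.\<close>

lemma history_split:
  assumes "finite A" "s \<le> t"
  obtains l where "history lam gap A t = history lam gap A s @ l"
    and "\<And>c p k. c \<in> clocks lam \<Longrightarrow> p \<in> A \<Longrightarrow> s < ring_time gap (c, p, k) \<Longrightarrow>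
      ring_time gap (c, p, k) \<le> t \<Longrightarrow> (c, p) \<in> set l"
    and "\<And>l1 l2. l = l1 @ l2 \<Longrightarrow> \<exists>u. s \<le> u \<and> u \<le> t \<and> history lam gap A u = history lam gap A s @ l1"
proof
  let ?xs = "filter (\<lambda>r. s < ring_time gap r) (ring_list lam gap A t)"
  note P = ring_list_props[OF assms(1)]
  note split = ring_list_split[OF assms]
  show "history lam gap A t = history lam gap A s @ map label ?xs"
    unfolding history_def by (subst split) simp
  show "(c, p) \<in> set (map label ?xs)"
    if "c \<in> clocks lam" "p \<in> A" "s < ring_time gap (c, p, k)" "ring_time gap (c, p, k) \<le> t" for c p k
  proof -
    have "(c, p, k) \<in> set ?xs"
      using that by (simp add: P ring_set_def del: ring_time.simps)
    then have "label (c, p, k) \<in> label ` set ?xs" by blast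
    then show ?thesis by simp
  qed
  show "\<exists>u. s \<le> u \<and> u \<le> t \<and> history lam gap A u = history lam gap A s @ l1"
    if "map label ?xs = l1 @ l2" for l1 l2
  proof -
    obtain xs1 xs2 where xs: "?xs = xs1 @ xs2" "l1 = map label xs1"
      using \<open>map label ?xs = l1 @ l2\<close> by (auto simp: map_eq_append_conv)
    show ?thesis
    proof (cases "xs1 = []")
      case True
      then show ?thesis
        using assms(2) xs by auto
    next
      case False
      \<comment> \<open>At the time of its last ring exactly the rings of the prefix have happened
        since \<open>s\<close>: ring times are distinct, so the next ring comes strictly
        later.\<close>
      define u where "u = ring_time gap (last xs1)"
      have last: "last xs1 \<in> set ?xs"
        using False xs by simp
      then have su: "s < u" "u \<le> t"
        by (auto simp: u_def P ring_set_def simp del: ring_time.simps)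
      have full: "ring_list lam gap A t = (ring_list lam gap A s @ xs1) @ xs2"
        using split xs by simp
      have so: "sorted (map (ring_time gap) ((ring_list lam gap A s @ xs1) @ xs2))"
        using P(2)[of t] full by simp
      have inj: "inj_on (ring_time gap) (set ((ring_list lam gap A s @ xs1) @ xs2))"
        using inj_on_ring_set[of A t] P(1)[of t] full by simp
      have di: "distinct ((ring_list lam gap A s @ xs1) @ xs2)"
        using P(3)[of t] full by simp
      have le: "ring_time gap r \<le> u" if "r \<in> set xs1" for r
      proof -
        have "xs1 = butlast xs1 @ [last xs1]" using False by simp
        moreover have "sorted (map (ring_time gap) xs1)"
          using so by (simp add: sorted_append)
        ultimately have "sorted (map (ring_time gap) (butlast xs1 @ [last xs1]))" by simp
        then have "\<forall>r\<in>set (butlast xs1). ring_time gap r \<le> u"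
          by (simp add: sorted_append u_def)
        moreover have "r = last xs1 \<or> r \<in> set (butlast xs1)"
          using that \<open>xs1 = butlast xs1 @ [last xs1]\<close> by (metis Un_iff empty_iff empty_set insert_iff list.set(2) set_append)
        ultimately show ?thesis by (auto simp: u_def)
      qed
      have gt: "u < ring_time gap r" if r: "r \<in> set xs2" for r
      proof -
        have l: "last xs1 \<in> set xs1" using False by simp
        then have "u \<le> ring_time gap r"
          using so r by (auto simp: sorted_append u_def)
        moreover have "last xs1 \<noteq> r"
          using di l r by auto
        then have "u \<noteq> ring_time gap r"
          unfolding u_def using inj l r by (auto dest: inj_onD)
        ultimately show ?thesis by simp
      qed
      have "ring_list lam gap A u = ring_list lam gap A s @ xs1"
      proof (rule ring_list_eqI)
        have "ring_set lam gap A u = {r \<in> ring_set lam gap A t. ring_time gap r \<le> u}"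
          using su by (auto simp: ring_set_def simp del: ring_time.simps)
        also have "\<dots> = {r \<in> set ((ring_list lam gap A s @ xs1) @ xs2). ring_time gap r \<le> u}"
          using P(1)[of t] full by simp
        also have "\<dots> = set (ring_list lam gap A s @ xs1)"
          using le gt su by (fastforce simp: P ring_set_def simp del: ring_time.simps)
        finally show "set (ring_list lam gap A s @ xs1) = ring_set lam gap A u" ..
        show "sorted (map (ring_time gap) (ring_list lam gap A s @ xs1))"
          using so by (simp add: sorted_append)
        show "distinct (ring_list lam gap A s @ xs1)"
          using di by auto
      qed
      then show ?thesis
        using su xs by (auto simp: history_def intro!: exI[of _ u])
    qed
  qed
qed

lemma history_subset:
  assumes "finite A" "B \<subseteq> A"
  shows "history lam gap B t = filter (\<lambda>i. snd i \<in> B) (history lam gap A t)"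
proof -
  note P = ring_list_props[OF assms(1)]
  have "ring_list lam gap B t = filter (\<lambda>r. fst (snd r) \<in> B) (ring_list lam gap A t)"
  proof (rule ring_list_eqI)
    show "set (filter (\<lambda>r. fst (snd r) \<in> B) (ring_list lam gap A t)) = ring_set lam gap B t"
      using assms(2) by (auto simp: P ring_set_def simp del: ring_time.simps)
    show "sorted (map (ring_time gap) (filter (\<lambda>r. fst (snd r) \<in> B) (ring_list lam gap A t)))"
      using P(2) by (rule sorted_filter)
    show "distinct (filter (\<lambda>r. fst (snd r) \<in> B) (ring_list lam gap A t))"
      using P(3) by simp
  qed
  then show ?thesis
    by (simp add: history_def filter_map comp_def)
qed

lemma ring_time_strict_mono: "c \<in> clocks lam \<Longrightarrow> k < k' \<Longrightarrow> ring_time gap (c, p, k) < ring_time gap (c, p, k')"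
proof -
  assume c: "c \<in> clocks lam" and "k < k'"
  have "strict_mono (\<lambda>k. ring_time gap (c, p, k))"
    using gap_pos[OF c] by (intro strict_monoI_Suc) simp
  from strict_monoD[OF this \<open>k < k'\<close>] show ?thesis .
qed

lemma count_history_le:
  assumes A: "finite A" and c: "c \<in> clocks lam" and k: "t < ring_time gap (c, p, k)"
  shows "count_list (history lam gap A t) (c, p) \<le> k"
proof -
  let ?xs = "ring_list lam gap A t"
  note P = ring_list_props[OF A]
  have "count_list (history lam gap A t) (c, p) = length (filter (\<lambda>r. label r = (c, p)) ?xs)"
    unfolding history_def by (induction ?xs) (auto simp: count_list_eq_length_filter filter_map comp_def eq_commute)
  also have "\<dots> = card (set (filter (\<lambda>r. label r = (c, p)) ?xs))"
    by (rule distinct_card[OF distinct_filter[OF P(3)], symmetric])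
  also have "\<dots> \<le> card ((\<lambda>k. (c, p, k)) ` {..<k})"
  proof (rule card_mono)
    show "set (filter (\<lambda>r. label r = (c, p)) ?xs) \<subseteq> (\<lambda>k. (c, p, k)) ` {..<k}"
    proof
      fix r assume r: "r \<in> set (filter (\<lambda>r. label r = (c, p)) ?xs)"
      then have "r \<in> ring_set lam gap A t" "label r = (c, p)"
        by (simp_all add: P(1) del: ring_time.simps)
      then obtain j where j: "r = (c, p, j)" "ring_time gap (c, p, j) \<le> t"
        by (cases r) (auto simp: ring_set_def simp del: ring_time.simps)
      have "j < k"
      proof (rule ccontr)
        assume "\<not> j < k"
        then have "ring_time gap (c, p, k) \<le> ring_time gap (c, p, j)"
          using ring_time_strict_mono[OF c, of k j p] by (cases "j = k") auto
        with j k show False by simp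
      qed
      with j show "r \<in> (\<lambda>k. (c, p, k)) ` {..<k}" by auto
    qed
  qed simp
  also have "\<dots> = k"
    by (subst card_image) (auto simp: inj_on_def)
  finally show ?thesis .
qed

lemma set_history: "finite A \<Longrightarrow> set (history lam gap A t) \<subseteq> clocks lam \<times> A"
  by (auto simp: history_def ring_list_props ring_set_def)

end

text \<open>The fixed points of \<open>settle\<close>: company implies activity and, for
  \<open>lam = \<infinity>\<close>, a lone particle is passive. The \<open>act p\<close> on the
  right leaves lone particles free when \<open>lam\<close> is finite.\<close>

fun settled :: "ereal \<Rightarrow> particle set \<Rightarrow> system \<Rightarrow> bool" where
  "settled lam A (pos, act) \<longleftrightarrow>
     (\<forall>p\<in>A. act p \<longleftrightarrow> \<not> alone A pos p \<or> (lam \<noteq> \<infinity> \<and> act p))"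

lemma consistent_settled: "consistent lam A s D \<Longrightarrow> settled lam A s"
  by (cases s) auto

section \<open>Trajectories along a history and their locality\<close>

definition reach :: "ereal \<Rightarrow> particle set \<Rightarrow> (clock \<times> particle) list \<Rightarrow> system" where
  "reach lam A l = fold (step lam A) l (start lam A)"

lemma reach_snoc: "reach lam A (l @ [i]) = step lam A i (reach lam A l)"
  by (simp add: reach_def)

lemma consistent_reach:
  assumes "finite A" "set l \<subseteq> UNIV \<times> A"
  shows "\<exists>D. consistent lam A (reach lam A l) D"
  using consistent_fold[OF assms consistent_start[OF assms(1), of lam]]
  by (auto simp: reach_def split: prod.splits)

lemma settled_reach: "finite A \<Longrightarrow> set l \<subseteq> UNIV \<times> A \<Longrightarrow> settled lam A (reach lam A l)"
  using consistent_reach consistent_settled by blast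

lemma fst_step:
  "fst (step lam A (c, p) s) = (if c = Jump \<and> snd s p then (fst s)(p := fst s p + 1) else fst s)"
  by (cases s; cases c) (simp_all add: step_simps)

lemma snd_step:
  assumes "settled lam A s" "p \<in> A" "q \<in> A"
  shows "snd (step lam A (c, p) s) q \<longleftrightarrow>
     (if c = Sleep \<and> q = p then \<not> alone A (fst s) p
      else \<not> alone A (fst (step lam A (c, p) s)) q \<or> (lam \<noteq> \<infinity> \<and> snd s q))"
proof -
  obtain pos act where s: "s = (pos, act)" by (cases s)
  have q: "act q \<longleftrightarrow> \<not> alone A pos q \<or> (lam \<noteq> \<infinity> \<and> act q)"
    and p: "\<not> alone A pos p \<Longrightarrow> act p"
    using assms s by auto
  show ?thesis
  proof (cases c)
    case Jump
    show ?thesis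
      using q by (cases "act p") (simp_all add: s Jump step_simps)
  next
    case Sleep
    show ?thesis
      using q p by (auto simp: s Sleep step_simps)
  qed
qed

lemma reach_bounds:
  assumes "finite A" "set l \<subseteq> UNIV \<times> A"
  shows "fst p \<le> fst (reach lam A l) p \<and>
    fst (reach lam A l) p \<le> fst p + int (count_list l (Jump, p))"
  using assms(2)
proof (induction l rule: rev_induct)
  case Nil
  then show ?case by (simp add: reach_def start_def)
next
  case (snoc i l)
  obtain c q where i: "i = (c, q)" by (cases i)
  have "fst p \<le> fst (reach lam A l) p \<and> fst (reach lam A l) p \<le> fst p + int (count_list l (Jump, p))"
    using snoc by auto
  then show ?case
    by (auto simp: reach_snoc i fst_step)
qed

text \<open>Motion is to the right only: if no particle from the left gets past \<open>y\<close>,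
  then what happens in \<open>(y, x]\<close> is decided by the particles that start there. Beyond
  \<open>x\<close> the two systems may differ, as \<open>A\<close> has further particles there, but
  nothing returns from beyond \<open>x\<close>; hence the second alternative.\<close>

lemma reach_local:
  assumes fin: "finite A" and B: "B = {p \<in> A. y < fst p \<and> fst p \<le> x}"
    and l: "set l \<subseteq> UNIV \<times> A"
    and slow: "\<And>p. p \<in> A \<Longrightarrow> fst p \<le> y \<Longrightarrow> fst p + int (count_list l (Jump, p)) \<le> y"
  shows "\<forall>p\<in>B. (fst (reach lam A l) p = fst (reach lam B (filter (\<lambda>i. snd i \<in> B) l)) p \<and>
       snd (reach lam A l) p = snd (reach lam B (filter (\<lambda>i. snd i \<in> B) l)) p) \<or>
       (x < fst (reach lam A l) p \<and> x < fst (reach lam B (filter (\<lambda>i. snd i \<in> B) l)) p)"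
  using l slow
proof (induction l rule: rev_induct)
  \<comment> \<open>At a site in \<open>(y, x]\<close> both systems show the same company: an
    outsider either has not passed \<open>y\<close> or started beyond \<open>x\<close>.\<close>
  have alone: "alone A f p \<longleftrightarrow> alone B g p"
    if f: "\<And>q. q \<in> A \<Longrightarrow> fst q \<le> f q" "\<And>q. q \<in> A \<Longrightarrow> fst q \<le> y \<Longrightarrow> f q \<le> y"
      and fg: "\<And>q. q \<in> B \<Longrightarrow> f q = g q \<or> (x < f q \<and> x < g q)"
      and p: "p \<in> B" "f p \<le> x" for f g p
  proof -
    have gp: "g p = f p" using fg[OF p(1)] p(2) by auto
    have py: "y < f p" using p f(1)[of p] B by force
    have "q \<in> B \<and> g q = f p" if "q \<in> A" "f q = f p" for q
      using that f[of q] fg[of q] p(2) py B by force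
    moreover have "q \<in> A \<and> f q = f p" if "q \<in> B" "g q = g p" for q
      using that fg[of q] p(2) gp B by force
    ultimately show ?thesis
      unfolding alone_def gp by blast
  qed
  {
    case Nil
    have "fst q \<le> fst q" for q :: particle by simp
    show ?case
    proof
      fix p assume p: "p \<in> B"
      then have "alone A fst p \<longleftrightarrow> alone B fst p"
        by (intro alone) (use B in auto)
      then show "(fst (reach lam A []) p = fst (reach lam B (filter (\<lambda>i. snd i \<in> B) [])) p \<and>
         snd (reach lam A []) p = snd (reach lam B (filter (\<lambda>i. snd i \<in> B) [])) p) \<or>
         (x < fst (reach lam A []) p \<and> x < fst (reach lam B (filter (\<lambda>i. snd i \<in> B) [])) p)"
        by (simp add: reach_def start_def)
    qed
  next
    case (snoc i l)
    obtain c r where i: "i = (c, r)" by (cases i)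
    let ?lB = "filter (\<lambda>i. snd i \<in> B) l" and ?lB' = "filter (\<lambda>i. snd i \<in> B) (l @ [i])"
    let ?s = "reach lam A l" and ?t = "reach lam B ?lB"
    let ?s' = "reach lam A (l @ [i])" and ?t' = "reach lam B ?lB'"
    have finB: "finite B" using fin B by auto
    have l: "set l \<subseteq> UNIV \<times> A" and r: "r \<in> A" using snoc.prems i by auto
    have lB: "set ?lB \<subseteq> UNIV \<times> B" "set ?lB' \<subseteq> UNIV \<times> B" by (auto simp: mem_Times_iff)
    have slow: "fst p + int (count_list l (Jump, p)) \<le> y" if "p \<in> A" "fst p \<le> y" for p
      using snoc.prems(2)[OF that] by (auto split: if_splits)
    note IH = snoc.IH[OF l slow]
    have sA: "settled lam A ?s" by (rule settled_reach[OF fin l])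
    have sB: "settled lam B ?t" by (rule settled_reach[OF finB lB(1)])
    have s': "?s' = step lam A (c, r) ?s" by (simp add: reach_snoc i)
    have t': "?t' = (if r \<in> B then step lam B (c, r) ?t else ?t)" by (simp add: reach_snoc i)
    have bs': "fst q \<le> fst ?s' q" for q
      using reach_bounds[OF fin snoc.prems(1)] by blast
    have bs: "fst q \<le> fst ?s q" for q
      using reach_bounds[OF fin l] by blast
    have sl': "fst ?s' q \<le> y" if "q \<in> A" "fst q \<le> y" for q
      using reach_bounds[OF fin snoc.prems(1), where p = q and lam = lam] snoc.prems(2)[OF that] by linarith
    have sl: "fst ?s q \<le> y" if "q \<in> A" "fst q \<le> y" for q
      using reach_bounds[OF fin l, where p = q and lam = lam] slow[OF that] by linarith
    have pos: "fst ?s' p = fst ?t' p \<or> (x < fst ?s' p \<and> x < fst ?t' p)" if p: "p \<in> B" for p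
      unfolding s' t' using bspec[OF IH p] p by (auto simp: fst_step)
    show ?case
    proof
      fix p assume p: "p \<in> B"
      then have pA: "p \<in> A" using B by auto
      show "(fst ?s' p = fst ?t' p \<and> snd ?s' p = snd ?t' p) \<or> (x < fst ?s' p \<and> x < fst ?t' p)"
      proof (cases "fst ?s' p \<le> x")
        case True
        have "fst ?s p \<le> fst ?s' p" by (simp add: s' fst_step)
        with True have le: "fst ?s p \<le> x" by simp
        then have eq: "fst ?s p = fst ?t p" "snd ?s p = snd ?t p"
          using bspec[OF IH p] by auto
        have al': "alone A (fst ?s') p \<longleftrightarrow> alone B (fst ?t') p"
          using bs' sl' pos p True by (rule alone)
        have IHp: "fst ?s q = fst ?t q \<or> (x < fst ?s q \<and> x < fst ?t q)" if "q \<in> B" for q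
          using bspec[OF IH that] by auto
        have al: "alone A (fst ?s) p \<longleftrightarrow> alone B (fst ?t) p"
          using bs sl IHp p le by (rule alone)
        have "snd ?t' p \<longleftrightarrow> (if c = Sleep \<and> p = r then \<not> alone B (fst ?t) r
            else \<not> alone B (fst ?t') p \<or> (lam \<noteq> \<infinity> \<and> snd ?t p))"
        proof (cases "r \<in> B")
          case True
          then show ?thesis
            unfolding t' using snd_step[OF sB True p, of c] by simp
        next
          case False
          then have "p \<noteq> r" using p by auto
          moreover have "snd ?t p \<longleftrightarrow> \<not> alone B (fst ?t) p \<or> (lam \<noteq> \<infinity> \<and> snd ?t p)"
            using sB p by (cases ?t) auto
          ultimately show ?thesis unfolding t' using False by simp
        qed
        moreover have "snd ?s' p \<longleftrightarrow> (if c = Sleep \<and> p = r then \<not> alone A (fst ?s) r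
            else \<not> alone A (fst ?s') p \<or> (lam \<noteq> \<infinity> \<and> snd ?s p))"
          unfolding s' by (rule snd_step[OF sA r pA])
        ultimately have "snd ?s' p = snd ?t' p"
          using al al' eq by auto
        then show ?thesis
          using pos[OF p] True by auto
      next
        case False
        then show ?thesis
          using pos[OF p] by (cases "fst ?s' p = fst ?t' p") auto
      qed
    qed
  }
qed

text \<open>Rings are counted from 0, so ring number \<open>y - fst p\<close> is the earliest that
  could carry \<open>p\<close> from \<open>y\<close> to \<open>y + 1\<close>, namely if no attempt
  was ignored. The condition involves only clocks and initial numbers, not the dynamics, and this
  makes its probability accessible.\<close>

definition barrier :: "(clock \<Rightarrow> particle \<Rightarrow> nat \<Rightarrow> real) \<Rightarrow> (int \<Rightarrow> nat) \<Rightarrow> real \<Rightarrow> int \<Rightarrow> bool" where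
  "barrier gap eta T y \<longleftrightarrow>
     (\<forall>p. fst p \<le> y \<longrightarrow> snd p < eta (fst p) \<longrightarrow> T < ring_time gap (Jump, p, nat (y - fst p)))"

definition window :: "(int \<Rightarrow> nat) \<Rightarrow> int \<Rightarrow> int \<Rightarrow> particle set" where
  "window eta y x = {p. y < fst p \<and> fst p \<le> x \<and> snd p < eta (fst p)}"

lemma finite_particles: "finite (particles_within n eta)"
proof -
  have "particles_within n eta = (SIGMA x:{- int n..int n}. {..<eta x})"
    by (auto simp: particles_within_def)
  then show ?thesis by simp
qed

lemma window_within:
  assumes "nat \<bar>y\<bar> \<le> n" "nat \<bar>x\<bar> \<le> n"
  shows "window eta y x = {p \<in> particles_within n eta. y < fst p \<and> fst p \<le> x}"
  using assms by (auto simp: window_def particles_within_def)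

lemma finite_window: "finite (window eta y x)"
  using window_within[of y "max (nat \<bar>y\<bar>) (nat \<bar>x\<bar>)" x eta] finite_particles by auto

lemma site_state_eq:
  "site_state A s z = (card {p \<in> A. fst s p = z \<and> snd s p}, card {p \<in> A. fst s p = z \<and> \<not> snd s p})"
  by (cases s) simp

lemma Jump_in_clocks [simp]: "Jump \<in> clocks lam"
  by (simp add: clocks_def)

context
  fixes lam :: ereal and gap :: "clock \<Rightarrow> particle \<Rightarrow> nat \<Rightarrow> real"
  assumes reg: "regular lam gap"
begin

abbreviation (input) state :: "particle set \<Rightarrow> real \<Rightarrow> system" where
  "state A t \<equiv> finite_system lam A gap t"

lemma state_reach: "state A t = reach lam A (history lam gap A t)"
  by (simp add: finite_system_history reach_def)

lemma set_history': "finite A \<Longrightarrow> set (history lam gap A t) \<subseteq> UNIV \<times> A"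
  using set_history[OF reg, of A t] by auto

lemma
  assumes bar: "barrier gap eta T y" and t: "t \<le> T"
    and n: "nat \<bar>y\<bar> \<le> n" "nat \<bar>x\<bar> \<le> n"
  shows crossed_window: "\<And>z. y \<le> z \<Longrightarrow> z \<le> x \<Longrightarrow>
      crossed (particles_within n eta) (fst (state (particles_within n eta) t)) z
    = crossed (window eta y x) (fst (state (window eta y x) t)) z"
    and at_window: "\<And>z Q. y < z \<Longrightarrow> z \<le> x \<Longrightarrow>
      {p \<in> particles_within n eta. fst (state (particles_within n eta) t) p = z \<and>
          Q (snd (state (particles_within n eta) t) p)}
    = {p \<in> window eta y x. fst (state (window eta y x) t) p = z \<and> Q (snd (state (window eta y x) t) p)}"
proof -
  let ?A = "particles_within n eta" and ?B = "window eta y x"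
  let ?s = "state ?A t" and ?t = "state ?B t"
  note B = window_within[OF n, of eta]
  \<comment> \<open>The barrier leaves at most \<open>y - fst p\<close> jump attempts by time
    \<open>t\<close>, so the particle has not moved past \<open>y\<close>.\<close>
  have slow: "fst p + int (count_list (history lam gap ?A t) (Jump, p)) \<le> y" if "p \<in> ?A" "fst p \<le> y" for p
  proof -
    have "t < ring_time gap (Jump, p, nat (y - fst p))"
      using bar that t by (force simp: barrier_def particles_within_def)
    from count_history_le[OF reg finite_particles[of n eta] Jump_in_clocks this]
    have "int (count_list (history lam gap ?A t) (Jump, p)) \<le> y - fst p"
      using that by (simp add: le_nat_iff)
    then show ?thesis by linarith
  qed
  have hB: "history lam gap ?B t = filter (\<lambda>i. snd i \<in> ?B) (history lam gap ?A t)"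
    by (rule history_subset[OF reg finite_particles]) (use B in auto)
  have R: "(fst ?s p = fst ?t p \<and> snd ?s p = snd ?t p) \<or> (x < fst ?s p \<and> x < fst ?t p)" if "p \<in> ?B" for p
    using reach_local[OF finite_particles B set_history'[OF finite_particles] slow, of lam] that
    unfolding state_reach hB by blast
  have lo: "fst ?s p \<le> y" if "p \<in> ?A" "fst p \<le> y" for p
    using reach_bounds[OF finite_particles set_history'[OF finite_particles], where lam = lam and p = p] slow[OF that]
    unfolding state_reach by (meson order_trans)
  have ge: "fst p \<le> fst ?s p" for p
    using reach_bounds[OF finite_particles set_history'[OF finite_particles]] unfolding state_reach by blast
  show "crossed ?A (fst ?s) z = crossed ?B (fst ?t) z" if z: "y \<le> z" "z \<le> x" for z
  proof -
    have "p \<in> ?A \<and> fst p \<le> z \<and> z < fst ?s p \<longleftrightarrow> p \<in> ?B \<and> fst p \<le> z \<and> z < fst ?t p" for p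
      using R[of p] lo[of p] z B by force
    then show ?thesis by (simp add: crossed_def)
  qed
  show "{p \<in> ?A. fst ?s p = z \<and> Q (snd ?s p)} = {p \<in> ?B. fst ?t p = z \<and> Q (snd ?t p)}" if z: "y < z" "z \<le> x" for z Q
  proof -
    have "p \<in> ?A \<and> fst ?s p = z \<and> Q (snd ?s p) \<longleftrightarrow> p \<in> ?B \<and> fst ?t p = z \<and> Q (snd ?t p)" for p
    proof (cases "p \<in> ?B")
      case True
      then show ?thesis using R[of p] z B by force
    next
      case False
      then show ?thesis using lo[of p] ge[of p] z B by force
    qed
    then show ?thesis by blast
  qed
qed

text \<open>To the right of a barrier the truncated systems agree at \<open>z\<close> for all large
  \<open>n\<close>. Hence the limit that defines \<open>arw\<close> exists there and is computed by
  a finite system.\<close>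

lemma arw_window:
  assumes "barrier gap eta T y" "t \<le> T" "y < z" "z \<le> x"
  shows "arw lam eta gap t z = site_state (window eta y x) (state (window eta y x) t) z"
proof -
  let ?N = "max (nat \<bar>y\<bar>) (nat \<bar>x\<bar>)"
  have "site_state (particles_within n eta) (state (particles_within n eta) t) z
      = site_state (window eta y x) (state (window eta y x) t) z" if "?N \<le> n" for n
  proof -
    have n: "nat \<bar>y\<bar> \<le> n" "nat \<bar>x\<bar> \<le> n" using that by auto
    show ?thesis
      unfolding site_state_eq using at_window[OF assms(1,2) n assms(3,4), of "\<lambda>b. b"] at_window[OF assms(1,2) n assms(3,4), of Not]
      by simp
  qed
  then have "\<forall>\<^sub>F n in sequentially. site_state (particles_within n eta) (state (particles_within n eta) t) z
      = site_state (window eta y x) (state (window eta y x) t) z"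
    by (intro eventually_sequentiallyI[of ?N])
  then show ?thesis
    unfolding arw_def Let_def by (intro limI tendsto_eventually)
qed

end

section \<open>Sites through which the flux stagnates\<close>

lemma crossed_step:
  assumes "finite A" "p \<in> A" "fst p \<le> fst s p"
  shows "crossed A (fst (step lam A (c, p) s)) z
    = crossed A (fst s) z + (if c = Jump \<and> snd s p \<and> fst s p = z then 1 else 0)"
  using crossed_move[of A p "fst s" z] assms by (auto simp: fst_step)

lemma crossed_reach_snoc:
  assumes "finite A" "set (l @ [(c, p)]) \<subseteq> UNIV \<times> A"
  shows "crossed A (fst (reach lam A (l @ [(c, p)]))) z = crossed A (fst (reach lam A l)) z +
    (if c = Jump \<and> snd (reach lam A l) p \<and> fst (reach lam A l) p = z then 1 else 0)"
  unfolding reach_snoc using assms reach_bounds[OF assms(1), of l p lam] by (intro crossed_step) auto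

lemma crossed_reach_mono:
  assumes "finite A" "set (l @ l') \<subseteq> UNIV \<times> A"
  shows "crossed A (fst (reach lam A l)) z \<le> crossed A (fst (reach lam A (l @ l'))) z"
  using assms(2)
proof (induction l' rule: rev_induct)
  case (snoc i l')
  obtain c p where i: "i = (c, p)" by (cases i)
  show ?case
    using snoc crossed_reach_snoc[OF assms(1), of "l @ l'" c p lam z] i by auto
qed simp

lemma crossed_reach_passive:
  assumes "finite A" "set (l @ l') \<subseteq> UNIV \<times> A"
    and "\<And>l1 l2 p. l' = l1 @ l2 \<Longrightarrow> p \<in> A \<Longrightarrow> fst (reach lam A (l @ l1)) p = z \<Longrightarrow> \<not> snd (reach lam A (l @ l1)) p"
  shows "crossed A (fst (reach lam A (l @ l'))) z = crossed A (fst (reach lam A l)) z"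
  using assms(2,3)
proof (induction l' rule: rev_induct)
  case (snoc i l')
  obtain c p where i: "i = (c, p)" by (cases i)
  have "crossed A (fst (reach lam A (l @ l'))) z = crossed A (fst (reach lam A l)) z"
    by (rule snoc.IH) (use snoc.prems in auto)
  then show ?case
    using crossed_reach_snoc[OF assms(1), of "l @ l'" c p lam z] snoc.prems(1) snoc.prems(2)[of l' "[i]" p] i
    by auto
qed simp

text \<open>Constant crossings of \<open>x - 1\<close> and \<open>x\<close> mean that nobody arrives
  at \<open>x\<close> or leaves it. A particle there that attempts a jump must have been passive,
  hence alone, and nobody comes to wake it.\<close>

lemma reach_undisturbed:
  assumes fin: "finite A" and l: "set (l @ l') \<subseteq> UNIV \<times> A"
    and const: "\<And>z. z \<in> {x - 1, x} \<Longrightarrow>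
      crossed A (fst (reach lam A (l @ l'))) z = crossed A (fst (reach lam A l)) z"
  shows "{p \<in> A. fst (reach lam A (l @ l')) p = x} = {p \<in> A. fst (reach lam A l) p = x} \<and>
    (\<forall>p\<in>A. fst (reach lam A l) p = x \<longrightarrow> (Jump, p) \<in> set l' \<longrightarrow> \<not> snd (reach lam A (l @ l')) p)"
  using l const
proof (induction l' rule: rev_induct)
  case (snoc i l')
  obtain c q where i: "i = (c, q)" by (cases i)
  let ?base = "reach lam A l" and ?s = "reach lam A (l @ l')" and ?s' = "reach lam A (l @ l' @ [i])"
  have ll: "set (l @ l') \<subseteq> UNIV \<times> A" and q: "q \<in> A"
    and li: "set ((l @ l') @ [(c, q)]) \<subseteq> UNIV \<times> A"
    using snoc.prems(1) i by auto
  have s': "?s' = step lam A (c, q) ?s"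
    using reach_snoc[of lam A "l @ l'" i] i by simp
  have cr: "crossed A (fst ?s') z = crossed A (fst ?s) z + (if c = Jump \<and> snd ?s q \<and> fst ?s q = z then 1 else 0)" for z
    using crossed_reach_snoc[OF fin li, of lam z] i by simp
  have mono: "crossed A (fst ?base) z \<le> crossed A (fst ?s) z" for z
    by (rule crossed_reach_mono[OF fin ll])
  have eq: "crossed A (fst ?s) z = crossed A (fst ?base) z"
    and nojump: "\<not> (c = Jump \<and> snd ?s q \<and> fst ?s q = z)" if "z \<in> {x - 1, x}" for z
    using snoc.prems(2)[OF that] cr[of z] mono[of z] by (auto split: if_splits)
  note IH = snoc.IH[OF ll eq]
  have P: "{p \<in> A. fst ?s p = x} = {p \<in> A. fst ?base p = x}"
    and Q: "\<And>p. p \<in> A \<Longrightarrow> fst ?base p = x \<Longrightarrow> (Jump, p) \<in> set l' \<Longrightarrow> \<not> snd ?s p"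
    using IH by auto
  have same: "fst ?s' p = x \<longleftrightarrow> fst ?s p = x" for p
    using nojump[of x] nojump[of "x - 1"] by (auto simp: s' fst_step)
  have sA: "settled lam A ?s"
    by (rule settled_reach[OF fin ll])
  have pas: "\<not> snd ?s' p" if p: "p \<in> A" "fst ?base p = x" "(Jump, p) \<in> set (l' @ [i])" for p
  proof -
    have px: "fst ?s p = x" using P p by auto
    \<comment> \<open>A jump attempt of an active particle at \<open>x\<close> would have raised the
      number of crossings of \<open>x\<close>.\<close>
    have np: "\<not> snd ?s p"
    proof (cases "i = (Jump, p)")
      case True
      then show ?thesis using nojump[of x] px i by auto
    next
      case False
      then show ?thesis using Q p by auto
    qed
    then have al: "alone A (fst ?s) p"
      using sA p(1) by (cases ?s) auto
    have al': "alone A (fst ?s') p"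
      using al same px unfolding alone_def by metis
    show ?thesis
      unfolding s' using snd_step[OF sA q p(1), of c] al al' np by (auto simp: s'[symmetric])
  qed
  show ?case
    using same P pas by auto
qed simp


section \<open>From finite approximations to the infinite system\<close>

definition tame :: "ereal \<Rightarrow> (clock \<Rightarrow> particle \<Rightarrow> nat \<Rightarrow> real) \<Rightarrow> (int \<Rightarrow> nat) \<Rightarrow> bool" where
  "tame lam gap eta \<longleftrightarrow> regular lam gap \<and> (\<forall>(T :: nat) x. \<exists>y<x. barrier gap eta (real T) y)"

text \<open>The approximation for which probabilities can be computed: finitely many particles and
  at most \<open>m\<close> rings. For large \<open>m\<close> it is the state of the truncated system
  at time \<open>T\<close>.\<close>

definition cut :: "ereal \<Rightarrow> (clock \<Rightarrow> particle \<Rightarrow> nat \<Rightarrow> real) \<Rightarrow> (int \<Rightarrow> nat) \<Rightarrow> nat \<Rightarrow> nat \<Rightarrow> nat \<Rightarrow> system" where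
  "cut lam gap eta n m T = (let A = particles_within n eta in
     reach lam A (rings m (clocks lam \<times> A) (case_prod gap) (real T)))"

definition flux :: "ereal \<Rightarrow> (clock \<Rightarrow> particle \<Rightarrow> nat \<Rightarrow> real) \<Rightarrow> (int \<Rightarrow> nat) \<Rightarrow> nat \<Rightarrow> nat \<Rightarrow> nat \<Rightarrow> int \<Rightarrow> nat" where
  "flux lam gap eta n m T x = crossed (particles_within n eta) (fst (cut lam gap eta n m T)) x"

definition quiet :: "ereal \<Rightarrow> (clock \<Rightarrow> particle \<Rightarrow> nat \<Rightarrow> real) \<Rightarrow> (int \<Rightarrow> nat) \<Rightarrow> nat \<Rightarrow> nat \<Rightarrow> nat \<Rightarrow> int set \<Rightarrow> bool" where
  "quiet lam gap eta n m T X \<longleftrightarrow>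
     (\<forall>p\<in>particles_within n eta. fst (cut lam gap eta n m T) p \<in> X \<longrightarrow> \<not> snd (cut lam gap eta n m T) p)"

context
  fixes lam :: ereal and gap :: "clock \<Rightarrow> particle \<Rightarrow> nat \<Rightarrow> real" and eta :: "int \<Rightarrow> nat"
  assumes tame: "tame lam gap eta"
begin

lemma tame_regular: "regular lam gap"
  using tame by (simp add: tame_def)

definition dam :: "int \<Rightarrow> nat \<Rightarrow> int" where
  "dam x T = (SOME y. y < x \<and> barrier gap eta (real T) y)"

lemma dam: "dam x T < x" "barrier gap eta (real T) (dam x T)"
proof -
  have "\<exists>y. y < x \<and> barrier gap eta (real T) y"
    using tame by (auto simp: tame_def)
  from someI_ex[OF this] show "dam x T < x" "barrier gap eta (real T) (dam x T)"
    by (auto simp: dam_def)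
qed

abbreviation (input) state' :: "particle set \<Rightarrow> real \<Rightarrow> system" where
  "state' A t \<equiv> finite_system lam A gap t"

lemma eventually_cut:
  "\<forall>\<^sub>F m in sequentially. cut lam gap eta n m T = state' (particles_within n eta) (real T)"
proof (rule eventually_sequentiallyI)
  fix m assume "card (ring_set lam gap (particles_within n eta) (real T)) \<le> m"
  from history_rings[OF tame_regular finite_particles this]
  show "cut lam gap eta n m T = state' (particles_within n eta) (real T)"
    by (simp add: cut_def Let_def state_reach[OF tame_regular])
qed

text \<open>Up to time \<open>T\<close> no particle crosses the dam, so that on \<open>[w..x]\<close> the whole system agrees with
  the finite system of the particles between the dam and \<open>x\<close>.\<close>

definition local :: "int \<Rightarrow> int \<Rightarrow> nat \<Rightarrow> particle set" where
  "local w x T = window eta (dam w T) x"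

definition local_flux :: "int \<Rightarrow> int \<Rightarrow> nat \<Rightarrow> real \<Rightarrow> int \<Rightarrow> nat" where
  "local_flux w x T t z = crossed (local w x T) (fst (state' (local w x T) t)) z"

lemma eventually_local:
  assumes "w \<le> x" "t \<le> real T"
  shows "\<forall>\<^sub>F n in sequentially.
    (\<forall>z. w - 1 \<le> z \<longrightarrow> z \<le> x \<longrightarrow>
      crossed (particles_within n eta) (fst (state' (particles_within n eta) t)) z = local_flux w x T t z) \<and>
    (\<forall>z Q. w \<le> z \<longrightarrow> z \<le> x \<longrightarrow>
      {p \<in> particles_within n eta. fst (state' (particles_within n eta) t) p = z \<and>
          Q (snd (state' (particles_within n eta) t) p)}
      = {p \<in> local w x T. fst (state' (local w x T) t) p = z \<and> Q (snd (state' (local w x T) t) p)})"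
proof (rule eventually_sequentiallyI)
  fix n assume n: "max (nat \<bar>dam w T\<bar>) (nat \<bar>x\<bar>) \<le> n"
  then have n: "nat \<bar>dam w T\<bar> \<le> n" "nat \<bar>x\<bar> \<le> n" by auto
  show "(\<forall>z. w - 1 \<le> z \<longrightarrow> z \<le> x \<longrightarrow>
      crossed (particles_within n eta) (fst (state' (particles_within n eta) t)) z = local_flux w x T t z) \<and>
    (\<forall>z Q. w \<le> z \<longrightarrow> z \<le> x \<longrightarrow>
      {p \<in> particles_within n eta. fst (state' (particles_within n eta) t) p = z \<and>
          Q (snd (state' (particles_within n eta) t) p)}
      = {p \<in> local w x T. fst (state' (local w x T) t) p = z \<and> Q (snd (state' (local w x T) t) p)})"
    unfolding local_flux_def local_def
    using dam(1)[where x = w and T = T]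
    by (intro conjI allI impI crossed_window[OF tame_regular dam(2) assms(2) n] at_window[OF tame_regular dam(2) assms(2) n])
      simp_all
qed

text \<open>Different horizons choose different dams, so the two finite systems have different
  particles. They are compared through a truncated system with large \<open>n\<close>, which agrees
  with both.\<close>

lemma local_eq:
  assumes "w \<le> x" "t \<le> real T" "t \<le> real T'"
  shows "w - 1 \<le> z \<Longrightarrow> z \<le> x \<Longrightarrow> local_flux w x T t z = local_flux w x T' t z"
    and "w \<le> z \<Longrightarrow> z \<le> x \<Longrightarrow>
      {p \<in> local w x T. fst (state' (local w x T) t) p = z} = {p \<in> local w x T'. fst (state' (local w x T') t) p = z}"
proof -
  show "local_flux w x T t z = local_flux w x T' t z" if z: "w - 1 \<le> z" "z \<le> x"
  proof -
    have "\<forall>\<^sub>F n in sequentially. crossed (particles_within n eta) (fst (state' (particles_within n eta) t)) z = local_flux w x T'' t z"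
      if "t \<le> real T''" for T''
      by (rule eventually_mono[OF eventually_local[OF assms(1) that]]) (use z in blast)
    from eventually_happens'[OF sequentially_bot eventually_conj[OF this[OF assms(2)] this[OF assms(3)]]]
    show ?thesis by auto
  qed
  show "{p \<in> local w x T. fst (state' (local w x T) t) p = z} = {p \<in> local w x T'. fst (state' (local w x T') t) p = z}"
    if z: "w \<le> z" "z \<le> x"
  proof -
    have "\<forall>\<^sub>F n in sequentially.
        {p \<in> particles_within n eta. fst (state' (particles_within n eta) t) p = z \<and> True}
        = {p \<in> local w x T''. fst (state' (local w x T'') t) p = z \<and> True}"
      if "t \<le> real T''" for T''
      by (rule eventually_mono[OF eventually_local[OF assms(1) that]])
        (drule conjunct2, drule spec[of _ z], drule spec[of _ "\<lambda>_. True"], simp add: z)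
    from eventually_happens'[OF sequentially_bot eventually_conj[OF this[OF assms(2)] this[OF assms(3)]]]
    show ?thesis by auto
  qed
qed

lemma eventually_flux:
  assumes "w - 1 \<le> z" "z \<le> x" "w \<le> x"
  shows "\<forall>\<^sub>F n in sequentially. \<forall>\<^sub>F m in sequentially. flux lam gap eta n m T z = local_flux w x T (real T) z"
  using eventually_local[OF assms(3) order_refl, where T = T]
proof eventually_elim
  case (elim n)
  from elim[THEN conjunct1, rule_format, OF assms(1,2)]
  have "crossed (particles_within n eta) (fst (state' (particles_within n eta) (real T))) z
      = local_flux w x T (real T) z" .
  with eventually_cut[where n = n and T = T] show ?case
    by (auto elim!: eventually_mono simp: flux_def)
qed

lemma eventually_quiet:
  assumes "w \<le> x" "\<And>z. w \<le> z \<Longrightarrow> z \<le> x \<Longrightarrow> fst (arw lam eta gap (real T) z) = 0"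
  shows "\<forall>\<^sub>F n in sequentially. \<forall>\<^sub>F m in sequentially. quiet lam gap eta n m T {w..x}"
  using eventually_local[OF assms(1) order_refl, where T = T]
proof eventually_elim
  case (elim n)
  let ?A = "particles_within n eta" and ?B = "local w x T"
  have "\<not> snd (state' ?A (real T)) p" if p: "p \<in> ?A" "fst (state' ?A (real T)) p \<in> {w..x}" for p
  proof
    assume act: "snd (state' ?A (real T)) p"
    define z where "z = fst (state' ?A (real T)) p"
    have z: "w \<le> z" "z \<le> x" using p by (auto simp: z_def)
    have "arw lam eta gap (real T) z = site_state ?B (state' ?B (real T)) z"
      unfolding local_def using dam[where x = w and T = T] z by (intro arw_window[OF tame_regular]) auto
    then have "card {q \<in> ?B. fst (state' ?B (real T)) q = z \<and> snd (state' ?B (real T)) q} = 0"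
      using assms(2)[OF z] by (cases "state' ?B (real T)") simp
    moreover have "{q \<in> ?A. fst (state' ?A (real T)) q = z \<and> snd (state' ?A (real T)) q}
        = {q \<in> ?B. fst (state' ?B (real T)) q = z \<and> snd (state' ?B (real T)) q}"
      using elim[THEN conjunct2, rule_format, OF z, of "\<lambda>b. b"] .
    moreover have "finite ?B" by (simp add: local_def finite_window)
    ultimately have "{q \<in> ?A. fst (state' ?A (real T)) q = z \<and> snd (state' ?A (real T)) q} = {}"
      by simp
    moreover have "p \<in> {q \<in> ?A. fst (state' ?A (real T)) q = z \<and> snd (state' ?A (real T)) q}"
      using p act by (simp add: z_def)
    ultimately show False by blast
  qed
  then show ?case
    using eventually_cut[where n = n and T = T] by (auto elim!: eventually_mono simp: quiet_def)
qed

lemma local_flux_mono: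
  assumes "w - 1 \<le> z" "z \<le> x" "w \<le> x" "s \<le> t"
  shows "local_flux w x T s z \<le> local_flux w x T t z"
proof -
  have fin: "finite (local w x T)" by (simp add: local_def finite_window)
  obtain l where "history lam gap (local w x T) t = history lam gap (local w x T) s @ l"
    using history_split[OF tame_regular fin assms(4)] by metis
  then show ?thesis
    using crossed_reach_mono[OF fin, of "history lam gap (local w x T) s" l lam z]
      set_history'[OF tame_regular fin, where t = t]
    by (simp add: local_flux_def state_reach[OF tame_regular])
qed

lemma local_flux_mono_nat:
  assumes "w - 1 \<le> z" "z \<le> x" "w \<le> x" "T \<le> T'"
  shows "local_flux w x T (real T) z \<le> local_flux w x T' (real T') z"
  using local_eq(1)[where w = w and x = x and t = "real T" and T = T and T' = T' and z = z]
    local_flux_mono[where w = w and z = z and x = x and s = "real T" and t = "real T'" and T = T'] assms by simp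

lemma nat_incseq_eventually_const:
  fixes f :: "nat \<Rightarrow> nat"
  assumes "\<And>i j. i \<le> j \<Longrightarrow> f i \<le> f j" "\<And>i. f i < K"
  shows "\<exists>N. \<forall>i\<ge>N. f i = f N"
proof -
  have "finite (range f)"
    using assms(2) by (intro finite_subset[of "range f" "{..<K}"]) auto
  then have "Max (range f) \<in> range f" by (intro Max_in) auto
  then obtain N where N: "f N = Max (range f)" by auto
  have "f i = f N" if "N \<le> i" for i
    using assms(1)[OF that] Max_ge[OF \<open>finite (range f)\<close>, of "f i"] N by auto
  then show ?thesis by blast
qed

text \<open>Crossings increase with time, so if bounded at \<open>x - 1\<close> and \<open>x\<close>
  they are eventually constant. From then on the particles at \<open>x\<close> are a fixed finite
  set, and each of them is passive once its jump clock has rung again. The hypothesis negates the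
  event whose probability is estimated later.\<close>

lemma passive_if_flux_bounded:
  assumes K: "\<And>z. z \<in> {x - 1, x} \<Longrightarrow> \<exists>K. \<not> (\<forall>\<^sub>F T in sequentially. \<forall>\<^sub>F n in sequentially.
      \<forall>\<^sub>F m in sequentially. K \<le> flux lam gap eta n m T z)"
  shows "\<exists>t0\<ge>0. \<forall>t\<ge>t0. fst (arw lam eta gap t x) = 0"
proof -
  let ?c = "\<lambda>z T. local_flux x x T (real T) z" and ?L = "local x x"
  have fin: "finite (?L T)" for T by (simp add: local_def finite_window)
  have const: "\<exists>N. \<forall>i\<ge>N. ?c z i = ?c z N" if z: "z \<in> {x - 1, x}" for z
  proof -
    have zx: "x - 1 \<le> z" "z \<le> x" using z by auto
    obtain K where "\<not> (\<forall>\<^sub>F T in sequentially. \<forall>\<^sub>F n in sequentially.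
      \<forall>\<^sub>F m in sequentially. K \<le> flux lam gap eta n m T z)"
      using K[OF z] by blast
    then have fr: "\<exists>\<^sub>F T in sequentially. \<not> (\<forall>\<^sub>F n in sequentially.
      \<forall>\<^sub>F m in sequentially. K \<le> flux lam gap eta n m T z)"
      by (simp add: not_eventually)
    have lt: "?c z T < K" if "\<not> (\<forall>\<^sub>F n in sequentially. \<forall>\<^sub>F m in sequentially. K \<le> flux lam gap eta n m T z)" for T
    proof (rule ccontr)
      assume "\<not> ?c z T < K"
      then have "\<forall>\<^sub>F n in sequentially. \<forall>\<^sub>F m in sequentially. K \<le> flux lam gap eta n m T z"
        using eventually_flux[OF zx order_refl, of T] by (auto elim!: eventually_mono)
      with that show False by simp
    qed
    have mono: "?c z i \<le> ?c z j" if "i \<le> j" for i j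
      using zx that by (intro local_flux_mono_nat) auto
    \<comment> \<open>The flux is below \<open>K\<close> for arbitrarily late times, hence always,
      by monotonicity.\<close>
    have "?c z i < K" for i
    proof -
      obtain T where "i \<le> T" "?c z T < K"
        using fr lt by (auto simp: frequently_sequentially)
      then show ?thesis using mono[of i T] by simp
    qed
    with mono show ?thesis by (intro nat_incseq_eventually_const) auto
  qed
  obtain N1 N2 where N1: "\<forall>i\<ge>N1. ?c (x - 1) i = ?c (x - 1) N1" and N2: "\<forall>i\<ge>N2. ?c x i = ?c x N2"
    using const[of x] const[of "x - 1"] by auto
  define N where "N = max N1 N2"
  have cN: "?c z i = ?c z N" if "N \<le> i" "z \<in> {x - 1, x}" for i z
    using that N1 N2 unfolding N_def by (metis empty_iff insert_iff max.bounded_iff max.cobounded1 max.cobounded2)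
  define P where "P = {p \<in> ?L N. fst (state' (?L N) (real N)) p = x}"
  have finP: "finite P" using fin by (simp add: P_def)
  have "\<exists>k. real N < ring_time gap (Jump, p, k)" for p
  proof -
    have "finite {k. ring_time gap (Jump, p, k) \<le> real N}"
      using tame_regular Jump_in_clocks unfolding regular_def by blast
    then obtain k where "k \<notin> {k. ring_time gap (Jump, p, k) \<le> real N}"
      using ex_new_if_finite[OF infinite_UNIV_nat] by blast
    then show ?thesis
      by (intro exI[of _ k]) (simp add: not_le del: ring_time.simps)
  qed
  then obtain k where k: "\<And>p. real N < ring_time gap (Jump, p, k p)" by metis
  \<comment> \<open>By this time every particle sitting at \<open>x\<close> at time \<open>N\<close>
    has attempted a jump after time \<open>N\<close>.\<close>
  define t0 where "t0 = Max (insert (real N) ((\<lambda>p. ring_time gap (Jump, p, k p)) ` P))"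
  have t0: "real N \<le> t0" "\<And>p. p \<in> P \<Longrightarrow> ring_time gap (Jump, p, k p) \<le> t0"
    unfolding t0_def using finP by (auto intro!: Max_ge simp del: ring_time.simps)
  have "fst (arw lam eta gap t x) = 0" if t: "t0 \<le> t" for t
  proof -
    define T where "T = nat \<lceil>t\<rceil>"
    have tT: "t \<le> real T" unfolding T_def by linarith
    have Nt: "real N \<le> t" using t t0 by simp
    then have NT: "N \<le> T" using tT by linarith
    let ?A = "?L T"
    obtain l where l: "history lam gap ?A t = history lam gap ?A (real N) @ l"
      and ringl: "\<And>c p k. c \<in> clocks lam \<Longrightarrow> p \<in> ?A \<Longrightarrow> real N < ring_time gap (c, p, k) \<Longrightarrow>
        ring_time gap (c, p, k) \<le> t \<Longrightarrow> (c, p) \<in> set l"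
      using history_split[OF tame_regular fin Nt] by metis
    have PA: "P = {p \<in> ?A. fst (state' ?A (real N)) p = x}"
      unfolding P_def using NT by (intro local_eq(2)) auto
    have same: "local_flux x x T t z = local_flux x x T (real N) z" if z: "z \<in> {x - 1, x}" for z
    proof (rule antisym)
      show "local_flux x x T (real N) z \<le> local_flux x x T t z"
        using z Nt by (intro local_flux_mono) auto
      have "local_flux x x T t z \<le> local_flux x x T (real T) z"
        using z tT by (intro local_flux_mono) auto
      also have "\<dots> = local_flux x x N (real N) z"
        using cN[OF NT z] .
      also have "\<dots> = local_flux x x T (real N) z"
        using z NT by (intro local_eq(1)) auto
      finally show "local_flux x x T t z \<le> local_flux x x T (real N) z" .
    qed
    have "set (history lam gap ?A (real N) @ l) \<subseteq> UNIV \<times> ?A"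
      using set_history'[OF tame_regular fin[of T], where t = t] l by simp
    from reach_undisturbed[OF fin this, of x lam] same
    have R: "{p \<in> ?A. fst (state' ?A t) p = x} = {p \<in> ?A. fst (state' ?A (real N)) p = x}"
      "\<forall>p\<in>?A. fst (state' ?A (real N)) p = x \<longrightarrow> (Jump, p) \<in> set l \<longrightarrow> \<not> snd (state' ?A t) p"
      by (auto simp: local_flux_def state_reach[OF tame_regular] l)
    have "\<not> snd (state' ?A t) p" if p: "p \<in> ?A" "fst (state' ?A t) p = x" for p
    proof -
      have "p \<in> P" using p R PA by blast
      then have "(Jump, p) \<in> set l"
        using p k t0(2)[of p] t by (intro ringl[of Jump p "k p"]) (auto simp del: ring_time.simps)
      then show ?thesis using R p by blast
    qed
    then have "{p \<in> ?A. fst (state' ?A t) p = x \<and> snd (state' ?A t) p} = {}" by blast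
    moreover have "arw lam eta gap t x = site_state ?A (state' ?A t) x"
      unfolding local_def using dam[where x = x and T = T] tT by (intro arw_window[OF tame_regular]) auto
    ultimately show ?thesis
      by (simp only: site_state_eq fst_conv card.empty)
  qed
  moreover have "0 \<le> t0" using t0(1) by simp
  ultimately show ?thesis by blast
qed

text \<open>Without active particles at \<open>x\<close> nobody crosses \<open>x\<close> any more,
  so \<open>K\<close> can be read off at a time after which \<open>x\<close> stays passive. It does
  not depend on \<open>w\<close>: the window may grow to the left while \<open>K\<close> is
  fixed.\<close>

lemma flux_bounded_if_passive:
  assumes "\<And>a b :: int. \<exists>t0\<ge>0. \<forall>t\<ge>t0. \<forall>x\<in>{a..b}. fst (arw lam eta gap t x) = 0"
  shows "\<exists>K. \<forall>w\<le>x. \<forall>\<^sub>F T in sequentially. \<forall>\<^sub>F n in sequentially. \<forall>\<^sub>F m in sequentially.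
    flux lam gap eta n m T x < K \<and> quiet lam gap eta n m T {w..x}"
proof -
  let ?L = "local x x"
  have fin: "finite (?L T)" for T by (simp add: local_def finite_window)
  obtain t0 where t0: "0 \<le> t0" "\<And>t. t0 \<le> t \<Longrightarrow> fst (arw lam eta gap t x) = 0"
    using assms[of x x] by auto
  define N where "N = nat \<lceil>t0\<rceil>"
  have N: "t0 \<le> real N" unfolding N_def by linarith
  define K where "K = Suc (local_flux x x N (real N) x)"
  have bound: "local_flux x x T (real T) x < K" if NT: "N \<le> T" for T
  proof -
    let ?A = "?L T"
    obtain l where l: "history lam gap ?A (real T) = history lam gap ?A (real N) @ l"
      and pre: "\<And>l1 l2. l = l1 @ l2 \<Longrightarrow> \<exists>u. real N \<le> u \<and> u \<le> real T \<and>
        history lam gap ?A u = history lam gap ?A (real N) @ l1"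
      using history_split[OF tame_regular fin of_nat_mono[OF NT]] by metis
    have sub: "set (history lam gap ?A (real N) @ l) \<subseteq> UNIV \<times> ?A"
      using set_history'[OF tame_regular fin[of T], where t = "real T"] l by simp
    have "local_flux x x T (real T) x = local_flux x x T (real N) x"
      unfolding local_flux_def state_reach[OF tame_regular] l
    \<comment> \<open>Every state met between \<open>N\<close> and \<open>T\<close> is the state at
      some time \<open>u\<close> in between, when \<open>x\<close> carries no active
      particle.\<close>
    proof (rule crossed_reach_passive[OF fin sub])
      fix l1 l2 p
      let ?r = "reach lam ?A (history lam gap ?A (real N) @ l1)"
      assume "l = l1 @ l2" and p: "p \<in> ?A" "fst ?r p = x"
      from pre[OF this(1)] obtain u where u: "real N \<le> u" "u \<le> real T"
        and h: "history lam gap ?A u = history lam gap ?A (real N) @ l1" by blast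
      have "arw lam eta gap u x = site_state ?A (state' ?A u) x"
        unfolding local_def using dam[where x = x and T = T] u by (intro arw_window[OF tame_regular]) auto
      moreover have "fst (arw lam eta gap u x) = 0"
        using t0(2) N u by simp
      ultimately have "card {q \<in> ?A. fst ?r q = x \<and> snd ?r q} = 0"
        unfolding state_reach[OF tame_regular] h by (cases ?r) simp
      then have "{q \<in> ?A. fst ?r q = x \<and> snd ?r q} = {}"
        using fin by simp
      with p show "\<not> snd ?r p" by blast
    qed
    also have "\<dots> = local_flux x x N (real N) x"
      using NT by (intro local_eq(1)) auto
    finally show ?thesis by (simp add: K_def)
  qed
  have "\<forall>\<^sub>F T in sequentially. \<forall>\<^sub>F n in sequentially. \<forall>\<^sub>F m in sequentially.
    flux lam gap eta n m T x < K \<and> quiet lam gap eta n m T {w..x}" if w: "w \<le> x" for w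
  proof -
    obtain t1 where "\<forall>t\<ge>t1. \<forall>z\<in>{w..x}. fst (arw lam eta gap t z) = 0"
      using assms[of w x] by blast
    then have t1: "\<And>t z. t1 \<le> t \<Longrightarrow> z \<in> {w..x} \<Longrightarrow> fst (arw lam eta gap t z) = 0"
      by blast
    show ?thesis
    proof (rule eventually_sequentiallyI)
      fix T assume T: "max N (nat \<lceil>t1\<rceil>) \<le> T"
      then have "N \<le> T" "t1 \<le> real T" by linarith+
      have q: "\<forall>\<^sub>F n in sequentially. \<forall>\<^sub>F m in sequentially. quiet lam gap eta n m T {w..x}"
        using w t1[OF \<open>t1 \<le> real T\<close>] by (intro eventually_quiet) auto
      have "\<forall>\<^sub>F n in sequentially. \<forall>\<^sub>F m in sequentially. flux lam gap eta n m T x = local_flux x x T (real T) x"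
        by (rule eventually_flux) auto
      with q show "\<forall>\<^sub>F n in sequentially. \<forall>\<^sub>F m in sequentially.
          flux lam gap eta n m T x < K \<and> quiet lam gap eta n m T {w..x}"
      proof eventually_elim
        case (elim n)
        then show ?case
          by eventually_elim (use bound[OF \<open>N \<le> T\<close>] in simp)
      qed
    qed
  qed
  then show ?thesis by blast
qed

end

section \<open>The reflected random walk\<close>

locale reflected_walk =
  fixes q :: "nat pmf" and r :: real
  assumes r0: "0 < r" and r1: "r \<le> 1"
begin

text \<open>One step is one site of a window: inflow \<open>k\<close>, initial number
  \<open>e\<close> and the bit of the last particle. Truncated subtraction is the reflection at 0:
  if \<open>k + e = 0\<close>, there is no particle to fall asleep.\<close>

definition move :: "nat \<Rightarrow> nat pmf" where
  "move k = bind_pmf q (\<lambda>e. map_pmf (\<lambda>b. if b then k + e - 1 else k + e) (bernoulli_pmf r))"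

primrec walk :: "nat \<Rightarrow> nat \<Rightarrow> nat pmf" where
  "walk 0 k = return_pmf k"
| "walk (Suc n) k = bind_pmf (move k) (walk n)"

lemma walk_add: "walk (m + n) k = bind_pmf (walk m k) (walk n)"
proof (induction m arbitrary: k)
  case (Suc m)
  then have "walk (m + n) = (\<lambda>k. bind_pmf (walk m k) (walk n))" by auto
  then show ?case by (simp add: bind_assoc_pmf)
qed (simp add: bind_return_pmf)

lemma walk_Suc': "walk (Suc n) k = bind_pmf (walk n k) move"
proof -
  have "walk 0 = return_pmf" by auto
  then have "walk (Suc 0) = move" by (auto simp: bind_return_pmf')
  then show ?thesis using walk_add[of n "Suc 0" k] by (simp del: walk.simps)
qed

lemma nn_integral_move:
  "(\<integral>\<^sup>+w. f w \<partial>move k) = (\<integral>\<^sup>+e. ennreal (1 - r) * f (k + e) + ennreal r * f (k + e - 1) \<partial>q)"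
  unfolding move_def nn_integral_bind_pmf nn_integral_map_pmf
  using r0 r1 by (intro nn_integral_cong) (simp add: nn_integral_bernoulli_pmf mult.commute add.commute)

lemma nn_integral_move_mono:
  assumes "mono f" "j \<le> k"
  shows "(\<integral>\<^sup>+w. f w \<partial>move j) \<le> (\<integral>\<^sup>+w. f w \<partial>move k)"
  unfolding nn_integral_move using assms
  by (intro nn_integral_mono add_mono mult_left_mono) (auto intro: monoD)

lemma nn_integral_walk_mono:
  assumes "mono f" "j \<le> k"
  shows "(\<integral>\<^sup>+w. f w \<partial>walk n j) \<le> (\<integral>\<^sup>+w. f w \<partial>walk n k)"
  using assms(2)
proof (induction n arbitrary: j k)
  case 0
  then show ?case using assms(1) by (simp add: monoD)
next
  case (Suc n)
  then have "mono (\<lambda>k. \<integral>\<^sup>+w. f w \<partial>walk n k)"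
    by (intro monoI) auto
  from nn_integral_move_mono[OF this Suc.prems] show ?case
    by (simp add: nn_integral_bind_pmf)
qed

text \<open>After its first move the walk from 0 is at a point at least 0, so monotonicity in the
  starting point makes it stochastically increasing in time.\<close>

lemma nn_integral_walk_Suc_ge:
  assumes "mono f"
  shows "(\<integral>\<^sup>+w. f w \<partial>walk n 0) \<le> (\<integral>\<^sup>+w. f w \<partial>walk (Suc n) 0)"
proof -
  have "(\<integral>\<^sup>+w. f w \<partial>walk n 0) = (\<integral>\<^sup>+j. \<integral>\<^sup>+w. f w \<partial>walk n 0 \<partial>move 0)"
    by (simp add: measure_pmf.emeasure_space_1[simplified])
  also have "\<dots> \<le> (\<integral>\<^sup>+j. \<integral>\<^sup>+w. f w \<partial>walk n j \<partial>move 0)"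
    by (intro nn_integral_mono nn_integral_walk_mono[OF assms]) simp
  finally show ?thesis
    by (simp add: nn_integral_bind_pmf)
qed

definition above :: "nat \<Rightarrow> nat \<Rightarrow> nat \<Rightarrow> real" where
  "above n k K = measure_pmf.prob (walk n k) {K..}"

lemma above_nn_integral: "ennreal (above n k K) = (\<integral>\<^sup>+w. indicator {K..} w \<partial>walk n k)"
  by (simp add: above_def measure_pmf.emeasure_eq_measure)

lemma above_bounds: "0 \<le> above n k K" "above n k K \<le> 1"
  by (simp_all add: above_def)

lemma above_0: "above 0 k K = (if K \<le> k then 1 else 0)"
  by (simp add: above_def)

lemma above_Suc:
  "ennreal (above (Suc n) k K)
     = (\<integral>\<^sup>+e. ennreal ((1 - r) * above n (k + e) K + r * above n (k + e - 1) K) \<partial>q)"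
  unfolding above_nn_integral walk.simps nn_integral_bind_pmf nn_integral_move
  using r0 r1 by (intro nn_integral_cong)
    (simp add: above_nn_integral[symmetric] above_bounds ennreal_mult)

lemma mono_indicator_atLeast: "mono (indicator {K::nat..} :: nat \<Rightarrow> ennreal)"
  by (auto simp: mono_def indicator_def)

lemma above_mono: "j \<le> k \<Longrightarrow> above n j K \<le> above n k K"
  using nn_integral_walk_mono[OF mono_indicator_atLeast, of j k n K]
  by (simp add: above_nn_integral[symmetric] above_bounds ennreal_le_iff del: nn_integral_indicator)

lemma above_Suc_ge: "above n 0 K \<le> above (Suc n) 0 K"
  using nn_integral_walk_Suc_ge[OF mono_indicator_atLeast, of n K]
  by (simp add: above_nn_integral[symmetric] above_bounds ennreal_le_iff del: nn_integral_indicator walk.simps)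

lemma above_incseq: "incseq (\<lambda>n. above n 0 K)"
  by (intro incseq_SucI above_Suc_ge)

lemma above_antimono: "K \<le> L \<Longrightarrow> above n k L \<le> above n k K"
  unfolding above_def by (intro measure_pmf.finite_measure_mono) auto

text \<open>A step goes down by at most one.\<close>

lemma above_1: "K + n \<le> k \<Longrightarrow> above n k K = 1"
proof (induction n arbitrary: k)
  case (Suc n)
  have "ennreal (above (Suc n) k K) = (\<integral>\<^sup>+e. 1 \<partial>q)"
    unfolding above_Suc using Suc by (intro nn_integral_cong) simp
  then show ?case
    by (simp add: measure_pmf.emeasure_space_1[simplified] ennreal_eq_1)
qed (simp add: above_0)

text \<open>The limit exists since the walk from 0 increases stochastically. Tightness of the walk
  is \<open>limit\<close> tending to 0 at infinity, and escape to infinity is \<open>limit\<close>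
  being constantly 1.\<close>

definition limit :: "nat \<Rightarrow> real" where
  "limit K = lim (\<lambda>n. above n 0 K)"

lemma above_tendsto: "(\<lambda>n. above n 0 K) \<longlonglongrightarrow> limit K"
proof -
  have "convergent (\<lambda>n. above n 0 K)"
    using above_bounds by (intro Bseq_mono_convergent BseqI'[of _ 1]) (auto intro: incseqD[OF above_incseq])
  then show ?thesis
    by (simp add: limit_def convergent_LIMSEQ_iff)
qed

lemma above_le_limit: "above n 0 K \<le> limit K"
  by (rule incseq_le[OF above_incseq above_tendsto])

lemma limit_bounds: "0 \<le> limit K" "limit K \<le> 1"
  using above_bounds by (auto intro: order_trans[OF _ above_le_limit[of 0]] LIMSEQ_le_const2[OF above_tendsto])

lemma limit_antimono: "K \<le> L \<Longrightarrow> limit L \<le> limit K"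
  by (intro LIMSEQ_le[OF above_tendsto above_tendsto]) (auto intro: above_antimono)

text \<open>Condition on the position after \<open>m\<close> steps. From \<open>K + n\<close> or
  higher, \<open>n\<close> further steps cannot lead below \<open>K\<close>; from any other point
  the chance is at least the one from 0.\<close>

lemma above_add_ge:
  "above m 0 (K + n) + (1 - above m 0 (K + n)) * above n 0 K \<le> above (m + n) 0 K"
proof -
  let ?c = "above n 0 K" and ?p = "above m 0 (K + n)"
  have "ennreal (?p + (1 - ?p) * ?c) = ennreal (?c + (1 - ?c) * ?p)"
    by (simp add: algebra_simps)
  also have "\<dots> = (\<integral>\<^sup>+w. ennreal ?c + ennreal (1 - ?c) * indicator {K + n..} w \<partial>walk m 0)"
    by (subst nn_integral_add)
      (simp_all add: nn_integral_cmult above_nn_integral[symmetric] above_bounds ennreal_mult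
        measure_pmf.emeasure_space_1[simplified] del: nn_integral_indicator)
  also have "\<dots> \<le> (\<integral>\<^sup>+w. ennreal (above n w K) \<partial>walk m 0)"
  proof (intro nn_integral_mono)
    fix w
    show "ennreal ?c + ennreal (1 - ?c) * indicator {K + n..} w \<le> ennreal (above n w K)"
      using above_mono[of 0 w n K] above_1[of K n w] above_bounds
      by (cases "K + n \<le> w") (auto simp: ennreal_plus[symmetric] simp del: ennreal_plus)
  qed
  also have "\<dots> = ennreal (above (m + n) 0 K)"
    by (simp add: above_nn_integral walk_add nn_integral_bind_pmf del: nn_integral_indicator)
  finally show ?thesis
    by (subst (asm) ennreal_le_iff) (simp_all add: above_bounds)
qed

text \<open>Zero-one law: mass that escapes to infinity never comes back, and the chain restarted from
  the mass that does not escape has the same escape probability.\<close>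

lemma limit_dichotomy:
  assumes "limit K < 1"
  shows "limit \<longlonglongrightarrow> 0"
proof -
  have "convergent (\<lambda>n. - limit n)"
    using limit_bounds limit_antimono by (intro Bseq_mono_convergent BseqI'[of _ 1]) auto
  then obtain c where "(\<lambda>n. - limit n) \<longlonglongrightarrow> c" by (auto simp: convergent_def)
  then obtain \<theta> where \<theta>: "limit \<longlonglongrightarrow> \<theta>"
    using tendsto_minus[of "\<lambda>n. - limit n" c] by auto
  have \<theta>_le: "\<theta> \<le> limit L" for L
    by (rule LIMSEQ_le_const2[OF \<theta>]) (auto intro: limit_antimono)
  have \<theta>0: "0 \<le> \<theta>"
    using limit_bounds by (intro LIMSEQ_le_const[OF \<theta>]) auto
  have "\<theta> + (1 - \<theta>) * above n 0 K \<le> limit K" for n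
  proof -
    \<comment> \<open>Here \<open>m\<close> tends to infinity with \<open>n\<close> fixed, which
      replaces the first term by \<open>limit (K + n)\<close>, at least \<open>\<theta>\<close>;
      only afterwards does \<open>n\<close> tend to infinity.\<close>
    have "above m 0 (K + n) + (1 - above m 0 (K + n)) * above n 0 K \<le> limit K" for m
      using above_add_ge[of m K n] above_le_limit[of "m + n" K] by simp
    moreover have "(\<lambda>m. above m 0 (K + n) + (1 - above m 0 (K + n)) * above n 0 K)
        \<longlonglongrightarrow> limit (K + n) + (1 - limit (K + n)) * above n 0 K"
      by (intro tendsto_intros above_tendsto)
    ultimately have "limit (K + n) + (1 - limit (K + n)) * above n 0 K \<le> limit K"
      by (intro LIMSEQ_le_const2) auto
    moreover have "\<theta> * (1 - above n 0 K) \<le> limit (K + n) * (1 - above n 0 K)"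
      using \<theta>_le above_bounds by (intro mult_right_mono) auto
    ultimately show ?thesis by (simp add: algebra_simps)
  qed
  moreover have "(\<lambda>n. \<theta> + (1 - \<theta>) * above n 0 K) \<longlonglongrightarrow> \<theta> + (1 - \<theta>) * limit K"
    by (intro tendsto_intros above_tendsto)
  ultimately have "\<theta> + (1 - \<theta>) * limit K \<le> limit K"
    by (intro LIMSEQ_le_const2) auto
  then have "\<theta> * (1 - limit K) \<le> 0" by (simp add: algebra_simps)
  with assms \<theta>0 have "\<theta> = 0" by (simp add: mult_le_0_iff)
  with \<theta> show ?thesis by simp
qed

lemma prob_move_0: "measure_pmf.prob (walk n 0) {0} = 1 - above n 0 1"
proof -
  have "{0} = UNIV - {1::nat..}" by auto
  then show ?thesis
    unfolding above_def using measure_pmf.prob_compl[of "{1..}" "walk n 0"] by simp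
qed

section \<open>Mean drift of the walk\<close>

context
  fixes mu :: real
  assumes mu: "(\<integral>\<^sup>+e. ennreal (real e) \<partial>q) = ennreal mu" and mu0: "0 \<le> mu"
begin

text \<open>The last term is the unit that reflection saves when both the inflow and the site are
  empty and the bit is a sleep. The loss \<open>r\<close> stands on the left to avoid truncated
  subtraction in \<open>ennreal\<close>.\<close>

lemma nn_integral_move_drift:
  "(\<integral>\<^sup>+w. ennreal (real w) \<partial>move k) + ennreal r
     = ennreal (real k) + ennreal mu + (if k = 0 then ennreal (r * pmf q 0) else 0)"
proof -
  have "(\<integral>\<^sup>+w. ennreal (real w) \<partial>move k) + ennreal r
      = (\<integral>\<^sup>+e. (ennreal (1 - r) * ennreal (real (k + e)) + ennreal r * ennreal (real (k + e - 1))) + ennreal r \<partial>q)"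
    unfolding nn_integral_move
    by (subst (2) nn_integral_add) (simp_all add: measure_pmf.emeasure_space_1[simplified])
  also have "\<dots> = (\<integral>\<^sup>+e. (ennreal (real k) + ennreal (real e)) + (if k = 0 then ennreal r else 0) * indicator {0} e \<partial>q)"
  proof (intro nn_integral_cong)
    fix e
    have "(ennreal (1 - r) * ennreal (real (k + e)) + ennreal r * ennreal (real (k + e - 1))) + ennreal r
        = ennreal ((1 - r) * real (k + e) + r * real (k + e - 1) + r)"
      using r0 r1 by (simp add: ennreal_mult[symmetric] ennreal_plus[symmetric] del: ennreal_plus of_nat_add)
    also have "(1 - r) * real (k + e) + r * real (k + e - 1) + r
        = real k + real e + (if k = 0 \<and> e = 0 then r else 0)"
      by (cases "k + e") (auto simp: algebra_simps of_nat_diff)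
    finally show "(ennreal (1 - r) * ennreal (real (k + e)) + ennreal r * ennreal (real (k + e - 1))) + ennreal r
        = (ennreal (real k) + ennreal (real e)) + (if k = 0 then ennreal r else 0) * indicator {0} e"
      using r0 by (auto simp: indicator_def)
  qed
  also have "\<dots> = ennreal (real k) + ennreal mu + (if k = 0 then ennreal (r * pmf q 0) else 0)"
    using r0 by (simp add: nn_integral_add nn_integral_cmult mu measure_pmf.emeasure_space_1[simplified]
        emeasure_pmf_single ennreal_mult)
  finally show ?thesis .
qed

lemma nn_integral_walk_drift:
  "(\<integral>\<^sup>+w. ennreal (real w) \<partial>walk (Suc n) 0) + ennreal r
     = (\<integral>\<^sup>+w. ennreal (real w) \<partial>walk n 0) + ennreal mu + ennreal (r * pmf q 0 * (1 - above n 0 1))"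
proof -
  have "(\<integral>\<^sup>+w. ennreal (real w) \<partial>walk (Suc n) 0) + ennreal r
      = (\<integral>\<^sup>+k. (\<integral>\<^sup>+w. ennreal (real w) \<partial>move k) + ennreal r \<partial>walk n 0)"
    unfolding walk_Suc' nn_integral_bind_pmf
    by (simp add: nn_integral_add measure_pmf.emeasure_space_1[simplified])
  also have "\<dots> = (\<integral>\<^sup>+k. ennreal (real k) + ennreal mu + ennreal (r * pmf q 0) * indicator {0} k \<partial>walk n 0)"
    unfolding nn_integral_move_drift by (intro nn_integral_cong) auto
  also have "\<dots> = (\<integral>\<^sup>+w. ennreal (real w) \<partial>walk n 0) + ennreal mu + ennreal (r * pmf q 0 * (1 - above n 0 1))"
    using r0 by (simp add: nn_integral_add nn_integral_cmult measure_pmf.emeasure_space_1[simplified]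
        measure_pmf.emeasure_eq_measure prob_move_0 ennreal_mult above_bounds)
  finally show ?thesis .
qed

lemma walk_mean_finite: "(\<integral>\<^sup>+w. ennreal (real w) \<partial>walk n 0) < \<infinity>"
proof (induction n)
  case (Suc n)
  then have "(\<integral>\<^sup>+w. ennreal (real w) \<partial>walk (Suc n) 0) + ennreal r < \<infinity>"
    unfolding nn_integral_walk_drift by simp
  then show ?case by (simp del: walk.simps)
qed simp

text \<open>The mean of the walk is finite and nondecreasing, so its increment,
  \<open>mu - r\<close> plus \<open>r * pmf q 0\<close> times the probability of being at 0, is
  never negative. This gives \<open>r * above n 0 1 \<le> mu\<close>, hence
  \<open>limit 1 \<le> mu / r < 1\<close>, and the dichotomy applies.\<close>

theorem tight_if_subcritical:
  assumes "mu < r"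
  shows "limit \<longlonglongrightarrow> 0"
proof -
  have "r * above n 0 1 \<le> mu" for n
  proof -
    let ?E = "\<lambda>n. \<integral>\<^sup>+w. ennreal (real w) \<partial>walk n 0"
    have "mono (\<lambda>w. ennreal (real w))" by (auto simp: mono_def intro: ennreal_leI)
    from nn_integral_walk_Suc_ge[OF this, of n]
    have "?E n + ennreal r \<le> ?E (Suc n) + ennreal r"
      by (rule add_right_mono)
    also have "\<dots> = ?E n + (ennreal mu + ennreal (r * pmf q 0 * (1 - above n 0 1)))"
      unfolding nn_integral_walk_drift by (simp add: add.assoc)
    finally have "ennreal r \<le> ennreal mu + ennreal (r * pmf q 0 * (1 - above n 0 1))"
      using walk_mean_finite[of n] by (metis ennreal_add_left_cancel_le infinity_ennreal_def less_irrefl)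
    also have "\<dots> = ennreal (mu + r * pmf q 0 * (1 - above n 0 1))"
      using mu0 r0 above_bounds by (intro ennreal_plus[symmetric]) simp_all
    finally have "r \<le> mu + r * pmf q 0 * (1 - above n 0 1)"
      using mu0 r0 above_bounds[of n 0 1] by (subst (asm) ennreal_le_iff) simp_all
    also have "\<dots> \<le> mu + r * 1 * (1 - above n 0 1)"
      using r0 above_bounds[of n 0 1] by (intro add_left_mono mult_right_mono mult_left_mono pmf_le_1) simp_all
    finally show ?thesis by (simp add: algebra_simps)
  qed
  then have "r * limit 1 \<le> mu"
    by (intro LIMSEQ_le_const2[OF tendsto_mult_left[OF above_tendsto]]) auto
  with assms have "r * limit 1 < r * 1" by simp
  then have "limit 1 < 1" using r0 by simp
  then show ?thesis by (rule limit_dichotomy)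
qed

text \<open>Tightness controls probabilities but not means, so the drift is computed for the bounded
  function \<open>min w K\<close>. Up to \<open>K - L\<close> an occupation number truncated at
  \<open>L\<close> is counted in full; above that level the defect is at most
  \<open>mu + 2\<close>.\<close>

lemma truncated_drift:
  fixes K L :: nat
  assumes LK: "L \<le> K" and mL: "(\<integral>\<^sup>+e. ennreal (real (min e L)) \<partial>q) = ennreal mL"
  shows "ennreal (real (min k K)) + ennreal mL + ennreal (r * pmf q 0) * indicator {0} k
    \<le> (\<integral>\<^sup>+w. ennreal (real (min w K)) \<partial>move k) + ennreal r + ennreal (mu + 2) * indicator {K - L + 1..} k"
proof -
  have L: "ennreal (real (min k K)) + ennreal mL + ennreal (r * pmf q 0) * indicator {0} k
      = (\<integral>\<^sup>+e. ennreal (real (min k K)) + ennreal (real (min e L)) + ennreal r * indicator {0} k * indicator {0} e \<partial>q)"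
    using r0 by (simp add: nn_integral_add nn_integral_cmult mL measure_pmf.emeasure_space_1[simplified]
        nn_integral_multc emeasure_pmf_single ennreal_mult mult_ac)
  show ?thesis
  proof (cases "k \<le> K - L")
    case True
    have "ennreal (real (min k K)) + ennreal (real (min e L)) + ennreal r * indicator {0} k * indicator {0} e
        \<le> ennreal (1 - r) * ennreal (real (min (k + e) K)) + ennreal r * ennreal (real (min (k + e - 1) K)) + ennreal r" for e
    proof -
      have "real (min k K) + real (min e L) + r * (if k = 0 \<and> e = 0 then 1 else 0)
          \<le> (1 - r) * real (min (k + e) K) + r * real (min (k + e - 1) K) + r"
      proof (cases "k + e = 0")
        case False
        have "min k K + min e L \<le> min (k + e) K"
          using True LK by linarith
        then have "real (min k K) + real (min e L) \<le> real (min (k + e) K)"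
          by (simp only: of_nat_add[symmetric] of_nat_le_iff)
        moreover have "min (k + e) K \<le> Suc (min (k + e - 1) K)"
          by linarith
        then have "real (min (k + e) K) \<le> real (Suc (min (k + e - 1) K))"
          by (simp only: of_nat_le_iff)
        then have "real (min (k + e) K) \<le> real (min (k + e - 1) K) + 1"
          by (simp only: of_nat_Suc add.commute)
        then have "r * real (min (k + e) K) \<le> r * (real (min (k + e - 1) K) + 1)"
          using r0 by (intro mult_left_mono) auto
        moreover have "(1 - r) * real (min (k + e) K) = real (min (k + e) K) - r * real (min (k + e) K)"
          "r * (real (min (k + e - 1) K) + 1) = r * real (min (k + e - 1) K) + r"
          by (simp_all only: left_diff_distrib distrib_left mult_1 mult_1_right)
        moreover have "r * (if k = 0 \<and> e = 0 then 1 else 0) = 0"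
          using False by auto
        ultimately show ?thesis
          by linarith
      qed simp
      then have "ennreal (real (min k K) + real (min e L) + r * (if k = 0 \<and> e = 0 then 1 else 0))
          \<le> ennreal ((1 - r) * real (min (k + e) K) + r * real (min (k + e - 1) K) + r)"
        by (rule ennreal_leI)
      also have "ennreal ((1 - r) * real (min (k + e) K) + r * real (min (k + e - 1) K) + r)
        = ennreal (1 - r) * ennreal (real (min (k + e) K)) + ennreal r * ennreal (real (min (k + e - 1) K)) + ennreal r"
        using r0 r1 by (simp add: ennreal_mult ennreal_plus)
      also have "ennreal (real (min k K) + real (min e L) + r * (if k = 0 \<and> e = 0 then 1 else 0))
        = ennreal (real (min k K)) + ennreal (real (min e L)) + ennreal r * indicator {0} k * indicator {0} e"
        using r0 by (simp add: ennreal_plus indicator_def)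
      finally show ?thesis .
    qed
    then have "(\<integral>\<^sup>+e. ennreal (real (min k K)) + ennreal (real (min e L)) + ennreal r * indicator {0} k * indicator {0} e \<partial>q)
        \<le> (\<integral>\<^sup>+e. ennreal (1 - r) * ennreal (real (min (k + e) K)) + ennreal r * ennreal (real (min (k + e - 1) K)) + ennreal r \<partial>q)"
      by (intro nn_integral_mono) 
    also have "\<dots> = (\<integral>\<^sup>+w. ennreal (real (min w K)) \<partial>move k) + ennreal r"
      unfolding nn_integral_move by (subst nn_integral_add) (simp_all add: measure_pmf.emeasure_space_1[simplified])
    finally show ?thesis
      unfolding L by (rule order_trans) simp
  next
    \<comment> \<open>Near the truncation level a gain may be lost altogether, so only two crude
      facts are used: a step goes down by at most one, and \<open>mL \<le> mu\<close>.\<close>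
    case False
    have "(\<integral>\<^sup>+e. ennreal (real (min e L)) \<partial>q) \<le> (\<integral>\<^sup>+e. ennreal (real e) \<partial>q)"
      by (intro nn_integral_mono ennreal_leI) simp
    then have m: "ennreal mL \<le> ennreal mu" by (simp add: mL mu)
    have "ennreal (real (min k K)) \<le> (\<integral>\<^sup>+w. ennreal (real (min w K)) \<partial>move k) + 1"
    proof -
      have "ennreal (real (min k K)) = (\<integral>\<^sup>+e. ennreal (1 - r) * ennreal (real (min k K)) + ennreal r * ennreal (real (min k K)) \<partial>q)"
        using r0 r1 by (simp add: measure_pmf.emeasure_space_1[simplified] distrib_right[symmetric] ennreal_plus[symmetric] del: ennreal_plus)
      also have "\<dots> \<le> (\<integral>\<^sup>+e. (ennreal (1 - r) * ennreal (real (min (k + e) K)) + ennreal r * ennreal (real (min (k + e - 1) K))) + 1 \<partial>q)"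
      proof (intro nn_integral_mono)
        fix e
        have "ennreal r * ennreal (real (min k K)) \<le> ennreal r * (ennreal (real (min (k + e - 1) K)) + 1)"
          by (intro mult_left_mono) (auto simp: ennreal_plus[symmetric] ennreal_1[symmetric] intro!: ennreal_leI simp del: ennreal_plus ennreal_1)
        also have "\<dots> = ennreal r * ennreal (real (min (k + e - 1) K)) + ennreal r"
          by (simp add: distrib_left)
        also have "\<dots> \<le> ennreal r * ennreal (real (min (k + e - 1) K)) + 1"
          using r1 by (intro add_left_mono) (simp add: ennreal_le_1)
        finally have 1: "ennreal r * ennreal (real (min k K)) \<le> ennreal r * ennreal (real (min (k + e - 1) K)) + 1" .
        have "ennreal (1 - r) * ennreal (real (min k K)) \<le> ennreal (1 - r) * ennreal (real (min (k + e) K))"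
          by (intro mult_left_mono ennreal_leI) auto
        from add_mono[OF this 1]
        show "ennreal (1 - r) * ennreal (real (min k K)) + ennreal r * ennreal (real (min k K))
            \<le> (ennreal (1 - r) * ennreal (real (min (k + e) K)) + ennreal r * ennreal (real (min (k + e - 1) K))) + 1"
          by (simp add: add.assoc)
      qed
      also have "\<dots> = (\<integral>\<^sup>+w. ennreal (real (min w K)) \<partial>move k) + 1"
        unfolding nn_integral_move by (subst nn_integral_add) (simp_all add: measure_pmf.emeasure_space_1[simplified])
      finally show ?thesis .
    qed
    from add_mono[OF this m]
    have "ennreal (real (min k K)) + ennreal mL
        \<le> (\<integral>\<^sup>+w. ennreal (real (min w K)) \<partial>move k) + (1 + ennreal mu)"
      by (simp add: add.assoc)
    also have "1 + ennreal mu \<le> ennreal r + ennreal (mu + 2)"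
      using mu0 r0 by (simp add: ennreal_plus[symmetric] ennreal_1[symmetric] ennreal_leI del: ennreal_plus ennreal_1)
    finally show ?thesis
      using False by (simp add: add.assoc)
  qed
qed

lemma truncated_mean_tendsto:
  assumes "m < mu"
  obtains L mL where "(\<integral>\<^sup>+e. ennreal (real (min e L)) \<partial>q) = ennreal mL" "m < mL"
proof (cases "m < 0")
  case True
  then show ?thesis by (intro that[of 0 0]) simp_all
next
  case False
  have inc: "incseq (\<lambda>L e. ennreal (real (min e L)))"
    by (auto simp: incseq_def le_fun_def intro!: ennreal_leI)
  have sup: "(SUP L. ennreal (real (min e L))) = ennreal (real e)" for e :: nat
  proof (rule antisym)
    show "(SUP L. ennreal (real (min e L))) \<le> ennreal (real e)"
      by (intro SUP_least ennreal_leI) simp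
    show "ennreal (real e) \<le> (SUP L. ennreal (real (min e L)))"
      by (rule SUP_upper2[of e]) auto
  qed
  have "(SUP L. \<integral>\<^sup>+e. ennreal (real (min e L)) \<partial>q) = ennreal mu"
    using nn_integral_monotone_convergence_SUP[OF inc, of "measure_pmf q"] by (simp add: sup mu)
  then have "ennreal m < (SUP L. \<integral>\<^sup>+e. ennreal (real (min e L)) \<partial>q)"
    using assms False by (simp add: ennreal_lessI)
  then obtain L where L: "ennreal m < (\<integral>\<^sup>+e. ennreal (real (min e L)) \<partial>q)"
    by (auto simp: less_SUP_iff)
  have "(\<integral>\<^sup>+e. ennreal (real (min e L)) \<partial>q) \<le> ennreal mu"
    unfolding mu[symmetric] by (intro nn_integral_mono ennreal_leI) simp
  then obtain mL where mL: "0 \<le> mL" "(\<integral>\<^sup>+e. ennreal (real (min e L)) \<partial>q) = ennreal mL"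
    by (metis ennreal_cases ennreal_less_top infinity_ennreal_def not_le)
  with L have "m < mL" by (metis ennreal_leI not_le)
  with mL that show ?thesis by blast
qed

text \<open>For a tight walk the truncated mean would gain a fixed amount in every step, although it
  is bounded by \<open>K\<close>.\<close>

lemma escape_if_drift:
  assumes d: "0 < mu - r + r * pmf q 0 * (1 - limit 1)" and t: "limit \<longlonglongrightarrow> 0"
  shows False
proof -
  define d where "d = mu - r + r * pmf q 0 * (1 - limit 1)"
  have "0 < d" using d by (simp add: d_def)
  \<comment> \<open>Half of the drift \<open>d\<close> is kept: one quarter is given up to
    truncating the occupation number at \<open>L\<close>, another to the mass above
    \<open>K - L\<close>.\<close>
  obtain L mL where mL: "(\<integral>\<^sup>+e. ennreal (real (min e L)) \<partial>q) = ennreal mL" "mu - d / 4 < mL"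
    using truncated_mean_tendsto[of "mu - d / 4"] \<open>0 < d\<close> by auto
  have "0 < d / 4 / (mu + 2)" using \<open>0 < d\<close> mu0 by simp
  from order_tendstoD(2)[OF t this] obtain K0 where K0: "limit K0 < d / 4 / (mu + 2)"
    by (auto simp: eventually_sequentially)
  define K where "K = K0 + L"
  have K: "L \<le> K" "limit (K - L + 1) < d / 4 / (mu + 2)"
    using limit_antimono[of K0 "K - L + 1"] K0 by (auto simp: K_def)
  define X where "X n = (\<integral>\<^sup>+w. ennreal (real (min w K)) \<partial>walk n 0)" for n
  have XK: "X n \<le> ennreal (real K)" for n
  proof -
    have "X n \<le> (\<integral>\<^sup>+w. ennreal (real K) \<partial>walk n 0)"
      unfolding X_def by (intro nn_integral_mono ennreal_leI) simp
    then show ?thesis by (simp add: measure_pmf.emeasure_space_1[simplified])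
  qed
  define x where "x n = enn2real (X n)" for n
  have x: "X n = ennreal (x n)" "0 \<le> x n" "x n \<le> real K" for n
    using XK[of n] ennreal_less_top[of "real K"] unfolding x_def
    by (auto simp: top_unique less_top[symmetric] intro!: enn2real_leI dest: neq_top_trans[rotated])
  have step: "x n + d / 2 \<le> x (Suc n)" for n
  proof -
    have "X n + ennreal mL + ennreal (r * pmf q 0) * ennreal (1 - above n 0 1)
        = (\<integral>\<^sup>+k. ennreal (real (min k K)) + ennreal mL + ennreal (r * pmf q 0) * indicator {0} k \<partial>walk n 0)"
      unfolding X_def
      by (simp add: nn_integral_add nn_integral_cmult measure_pmf.emeasure_space_1[simplified]
          measure_pmf.emeasure_eq_measure prob_move_0)
    also have "\<dots> \<le> (\<integral>\<^sup>+k. (\<integral>\<^sup>+w. ennreal (real (min w K)) \<partial>move k) + ennreal r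
        + ennreal (mu + 2) * indicator {K - L + 1..} k \<partial>walk n 0)"
      by (intro nn_integral_mono truncated_drift[OF K(1) mL(1)])
    also have "\<dots> = X (Suc n) + ennreal r + ennreal (mu + 2) * ennreal (above n 0 (K - L + 1))"
      unfolding X_def walk_Suc' nn_integral_bind_pmf above_nn_integral
      by (simp add: nn_integral_add nn_integral_cmult measure_pmf.emeasure_space_1[simplified] del: nn_integral_indicator)
    finally have ineq: "ennreal (x n) + ennreal mL + ennreal (r * pmf q 0) * ennreal (1 - above n 0 1)
        \<le> ennreal (x (Suc n)) + ennreal r + ennreal (mu + 2) * ennreal (above n 0 (K - L + 1))"
      unfolding x(1) .
    have "ennreal (x n + mL + r * pmf q 0 * (1 - above n 0 1))
        \<le> ennreal (x n) + ennreal mL + ennreal (r * pmf q 0) * ennreal (1 - above n 0 1)"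
    proof (cases "0 \<le> mL")
      case True
      then show ?thesis
        using x(2) r0 above_bounds by (simp add: ennreal_plus ennreal_mult)
    next
      case False
      have "ennreal (x n + mL + r * pmf q 0 * (1 - above n 0 1)) \<le> ennreal (x n + r * pmf q 0 * (1 - above n 0 1))"
        using False by (intro ennreal_leI) simp
      then show ?thesis
        using False x(2) r0 above_bounds by (simp add: ennreal_plus ennreal_mult ennreal_neg)
    qed
    also note ineq
    also have "ennreal (x (Suc n)) + ennreal r + ennreal (mu + 2) * ennreal (above n 0 (K - L + 1))
        = ennreal (x (Suc n) + r + (mu + 2) * above n 0 (K - L + 1))"
      using x(2) r0 mu0 above_bounds by (simp add: ennreal_plus ennreal_mult)
    finally have "x n + mL + r * pmf q 0 * (1 - above n 0 1)
        \<le> x (Suc n) + r + (mu + 2) * above n 0 (K - L + 1)"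
      using x(2)[of "Suc n"] r0 mu0 above_bounds[of n 0 "K - L + 1"] by (subst (asm) ennreal_le_iff) simp_all
    moreover have "(mu + 2) * above n 0 (K - L + 1) \<le> d / 4"
    proof -
      have "above n 0 (K - L + 1) \<le> d / 4 / (mu + 2)"
        using above_le_limit[of n "K - L + 1"] K(2) by linarith
      then show ?thesis using mu0 by (simp only: pos_le_divide_eq mult.commute)
    qed
    moreover have "r * pmf q 0 * (1 - limit 1) \<le> r * pmf q 0 * (1 - above n 0 1)"
      using above_le_limit[of n 1] r0 by (intro mult_left_mono) auto
    ultimately show ?thesis
      using mL(2) by (simp add: d_def field_simps)
  qed
  have "real n * (d / 2) \<le> x n" for n
  proof (induction n)
    case (Suc n)
    then show ?case using step[of n] by (simp add: algebra_simps)
  qed (use x(2) in simp)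
  moreover obtain n where "real K / (d / 2) < real n"
    using reals_Archimedean2 by blast
  then have "real K < real n * (d / 2)"
    using \<open>0 < d\<close> by (simp add: field_simps)
  ultimately show False
    using x(3)[of n] by (meson not_le order_trans)
qed

text \<open>If the drift including the push at 0 stays positive, the walk is not tight and the
  dichotomy gives \<open>limit K = 1\<close>. Otherwise \<open>mu = r\<close> and, as 0 is charged
  by the law, the push can die out only if the walk leaves 0, that is \<open>limit 1 = 1\<close>.
  Then no level retains mass either, because from each positive level a step down has probability at
  least \<open>r * pmf q 0\<close>.\<close>

theorem escape_if_not_subcritical:
  assumes "r \<le> mu" and nc: "\<not> (\<exists>c. \<forall>e\<in>set_pmf q. e = c)"
  shows "limit K = 1"
proof (cases "0 < mu - r + r * pmf q 0 * (1 - limit 1)")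
  case True
  have "\<not> limit K < 1"
    using limit_dichotomy escape_if_drift[OF True] by blast
  then show ?thesis using limit_bounds[of K] by simp
next
  case False
  \<comment> \<open>Without mass at 0 all values are at least 1, and then
    \<open>mu = r \<le> 1\<close> forces the constant 1.\<close>
  have p0: "0 < pmf q 0"
  proof (rule ccontr)
    assume "\<not> 0 < pmf q 0"
    then have "0 \<notin> set_pmf q" by (simp add: pmf_positive_iff)
    then have ge: "1 \<le> e" if "e \<in> set_pmf q" for e
      using that by (cases e) auto
    have "mu = r" using False r0 limit_bounds[of 1] assms(1) by (smt (verit) mult_nonneg_nonneg pmf_nonneg)
    have "(\<integral>\<^sup>+e. ennreal (real (e - 1)) \<partial>q) + 1 = (\<integral>\<^sup>+e. ennreal (real (e - 1)) + 1 \<partial>q)"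
      by (subst nn_integral_add) (simp_all add: measure_pmf.emeasure_space_1[simplified])
    also have "\<dots> = (\<integral>\<^sup>+e. ennreal (real e) \<partial>q)"
    proof (intro nn_integral_cong_AE AE_pmfI)
      fix e assume "e \<in> set_pmf q"
      with ge[of e] show "ennreal (real (e - 1)) + 1 = ennreal (real e)"
        by (simp add: ennreal_1[symmetric] ennreal_plus[symmetric] of_nat_diff del: ennreal_1 ennreal_plus)
    qed
    also have "\<dots> \<le> 1"
      using \<open>mu = r\<close> r1 by (simp add: mu ennreal_le_1)
    finally have "1 + (\<integral>\<^sup>+e. ennreal (real (e - 1)) \<partial>q) \<le> 1 + 0" by (simp add: add.commute)
    then have "(\<integral>\<^sup>+e. ennreal (real (e - 1)) \<partial>q) = 0"
      using ennreal_add_left_cancel_le[of 1 "\<integral>\<^sup>+e. ennreal (real (e - 1)) \<partial>q" 0] by simp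
    then have "AE e in q. ennreal (real (e - 1)) = 0"
      by (subst (asm) nn_integral_0_iff_AE) auto
    then have "\<forall>e\<in>set_pmf q. e = 1"
      using ge by (auto simp: AE_measure_pmf_iff ennreal_eq_0_iff intro: antisym)
    with nc show False by blast
  qed
  have "r * pmf q 0 * (1 - limit 1) \<le> 0"
    using False assms(1) by simp
  moreover have "0 < r * pmf q 0"
    using r0 p0 by simp
  ultimately have l1: "limit 1 = 1"
    using limit_bounds(2)[of 1] mult_pos_pos[of "r * pmf q 0" "1 - limit 1"] by linarith
  show ?thesis
  proof (induction K)
    case 0
    have "above n 0 0 = 1" for n by (simp add: above_def)
    then show ?case using above_tendsto[of 0] by (simp add: LIMSEQ_const_iff)
  next
    case (Suc K)
    show ?case
    proof (cases K)
      case 0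
      then show ?thesis using l1 by simp
    next
      case (Suc K')
      \<comment> \<open>The walk steps from \<open>K\<close> to \<open>K - 1\<close> when the next
        site is empty and the bit is a sleep. So a fixed share of the mass at \<open>K\<close> is
        below \<open>K\<close> one step later, where by the induction hypothesis the mass vanishes
        in the limit.\<close>
      have down: "pmf (walk n 0) K * (r * pmf q 0) \<le> 1 - above (Suc n) 0 K" for n
      proof -
        have "ennreal (pmf (walk n 0) K * (r * pmf q 0)) = (\<integral>\<^sup>+k. ennreal (r * pmf q 0) * indicator {K} k \<partial>walk n 0)"
          using r0 by (subst nn_integral_cmult_indicator) (simp_all add: emeasure_pmf_single ennreal_mult mult.commute)
        also have "\<dots> \<le> (\<integral>\<^sup>+k. \<integral>\<^sup>+w. indicator {..<K} w \<partial>move k \<partial>walk n 0)"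
        proof (intro nn_integral_mono)
          fix k
          have "ennreal (r * pmf q 0) \<le> (\<integral>\<^sup>+w. indicator {..<K} w \<partial>move K)"
          proof -
            have "ennreal (r * pmf q 0) = (\<integral>\<^sup>+e. ennreal r * indicator {0} e \<partial>q)"
              using r0 by (simp add: nn_integral_cmult emeasure_pmf_single ennreal_mult)
            also have "\<dots> \<le> (\<integral>\<^sup>+e. ennreal (1 - r) * indicator {..<K} (K + e) + ennreal r * indicator {..<K} (K + e - 1) \<partial>q)"
              using Suc by (intro nn_integral_mono) (auto simp: indicator_def)
            finally show ?thesis by (simp only: nn_integral_move)
          qed
          then show "ennreal (r * pmf q 0) * indicator {K} k \<le> (\<integral>\<^sup>+w. indicator {..<K} w \<partial>move k)"
            by (auto simp: indicator_def)
        qed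
        also have "\<dots> = emeasure (walk (Suc n) 0) {..<K}"
          unfolding walk_Suc' emeasure_bind_pmf by simp
        also have "\<dots> = ennreal (1 - above (Suc n) 0 K)"
        proof -
          have "{..<K} = UNIV - {K..}" by auto
          then show ?thesis
            unfolding above_def measure_pmf.emeasure_eq_measure
            using measure_pmf.prob_compl[of "{K..}" "walk (Suc n) 0"] by (simp del: walk.simps)
        qed
        finally show ?thesis
          using above_bounds[of "Suc n" 0 K] by (subst (asm) ennreal_le_iff) simp_all
      qed
      have split: "above n 0 (Suc K) = above n 0 K - pmf (walk n 0) K" for n
      proof -
        have K: "{K..} = {Suc K..} \<union> {K}" by auto
        have "measure (walk n 0) ({Suc K..} \<union> {K}) = measure (walk n 0) {Suc K..} + measure (walk n 0) {K}"
          by (rule measure_pmf.finite_measure_Union) auto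
        then show ?thesis
          unfolding above_def K pmf.rep_eq by simp
      qed
      have "(\<lambda>n. (1 - above (Suc n) 0 K) / (r * pmf q 0)) \<longlonglongrightarrow> (1 - limit K) / (r * pmf q 0)"
        using r0 p0 by (intro tendsto_intros LIMSEQ_Suc[OF above_tendsto]) simp
      then have z: "(\<lambda>n. (1 - above (Suc n) 0 K) / (r * pmf q 0)) \<longlonglongrightarrow> 0"
        using Suc.IH by simp
      have "(\<lambda>n. pmf (walk n 0) K) \<longlonglongrightarrow> 0"
        using down \<open>0 < r * pmf q 0\<close>
        by (intro tendsto_sandwich[OF _ _ tendsto_const z] always_eventually) (auto simp: pos_le_divide_eq)
      from tendsto_diff[OF above_tendsto[of K] this] have "(\<lambda>n. above n 0 (Suc K)) \<longlonglongrightarrow> 1"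
        using Suc.IH by (simp add: split)
      with above_tendsto[of "Suc K"] show ?thesis
        by (rule LIMSEQ_unique)
    qed
  qed
qed

end

end

section \<open>Existence of barriers\<close>

instance clock :: countable
  by countable_datatype

locale arw_model = prob_space M for M :: "'w measure" +
  fixes lam :: ereal
    and eta0 :: "int \<Rightarrow> 'w \<Rightarrow> nat"
    and gap :: "clock \<Rightarrow> particle \<Rightarrow> nat \<Rightarrow> 'w \<Rightarrow> real"
  assumes lam_pos: "0 < lam"
    and randomness: "arw_randomness M lam eta0 gap"
    and ident: "\<And>x. distr M (count_space UNIV) (eta0 x) = distr M (count_space UNIV) (eta0 0)"
begin

section \<open>Laws of the sources and almost sure regularity of the clocks\<close>

definition V :: "source \<Rightarrow> 'w \<Rightarrow> real" where
  "V s = (case s of Init x \<Rightarrow> (\<lambda>w. real (eta0 x w)) | Gap c p k \<Rightarrow> gap c p k)"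

definition sources :: "source set" where
  "sources = range Init \<union> {Gap c p k | c p k. c \<in> clocks lam}"

lemma V_simps [simp]: "V (Init x) w = real (eta0 x w)" "V (Gap c p k) w = gap c p k w"
  by (simp_all add: V_def)

lemma V_fun: "V (Init x) = (\<lambda>w. real (eta0 x w))" "V (Gap c p k) = gap c p k"
  by (simp_all add: V_def)

lemma in_sources [simp]: "Init x \<in> sources" "Gap c p k \<in> sources \<longleftrightarrow> c \<in> clocks lam"
  by (auto simp: sources_def)

lemma indep_V: "indep_vars (\<lambda>_. borel) V sources"
  using randomness unfolding arw_randomness_def V_def[abs_def] sources_def by (rule conjunct1)

lemma rate_pos: "c \<in> clocks lam \<Longrightarrow> 0 < clock_rate lam c"
  using lam_pos by (cases lam; cases c) (auto simp: clocks_def split: if_splits)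

lemma gap_distributed: "c \<in> clocks lam \<Longrightarrow> distributed M lborel (gap c p k) (exponential_density (clock_rate lam c))"
  using randomness unfolding arw_randomness_def by blast

lemma measurable_V: "s \<in> sources \<Longrightarrow> V s \<in> borel_measurable M"
  using indep_V unfolding indep_vars_def by blast

lemma measurable_gap: "c \<in> clocks lam \<Longrightarrow> gap c p k \<in> borel_measurable M"
  using measurable_V[of "Gap c p k", unfolded V_fun] in_sources(2) by blast

lemma distr_gap: "c \<in> clocks lam \<Longrightarrow> distr M borel (gap c p k) = exp_law (clock_rate lam c)"
proof -
  assume "c \<in> clocks lam"
  have "distr M borel (gap c p k) = distr M lborel (gap c p k)"
    by (rule distr_cong) simp_all
  with distributed_distr_eq_density[OF gap_distributed[OF \<open>c \<in> clocks lam\<close>], of p k] show ?thesis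
    by (simp only:)
qed

lemma measurable_eta0: "eta0 x \<in> M \<rightarrow>\<^sub>M count_space UNIV"
proof -
  have m: "(\<lambda>w. real (eta0 x w)) \<in> borel_measurable M"
    by (rule measurable_V[OF in_sources(1), of x, unfolded V_fun])
  have "eta0 x -` {k} \<inter> space M \<in> sets M" for k
  proof -
    have "eta0 x -` {k} \<inter> space M = (\<lambda>w. real (eta0 x w)) -` {real k} \<inter> space M" by auto
    also have "\<dots> \<in> sets M" by (rule measurable_sets[OF m]) simp
    finally show ?thesis .
  qed
  then show ?thesis
    by (simp add: measurable_count_space_eq2_countable)
qed

lemma AE_gap_pos: "c \<in> clocks lam \<Longrightarrow> AE w in M. 0 < gap c p k w"
proof -
  assume c: "c \<in> clocks lam"
  have "prob {w \<in> space M. 0 < gap c p k w} = 1"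
    using exponential_distributedD_gt[OF gap_distributed[OF c] order_refl rate_pos[OF c], of p k] by simp
  then have "AE w in M. w \<in> {w \<in> space M. 0 < gap c p k w}"
    by (rule prob_eq_1[THEN iffD1, rotated]) (rule borel_measurable_less[OF borel_measurable_const measurable_gap[OF c]])
  then show ?thesis by (rule eventually_mono) simp
qed

lemma nn_integral_exp_gap:
  assumes c: "c \<in> clocks lam"
  shows "(\<integral>\<^sup>+w. ennreal (exp (- gap c p k w)) \<partial>M) = ennreal (clock_rate lam c / (1 + clock_rate lam c))"
proof -
  define r where "r = clock_rate lam c"
  have r: "0 < r" using rate_pos[OF c] by (simp add: r_def)
  have "(\<integral>\<^sup>+w. ennreal (exp (- gap c p k w)) \<partial>M) = (\<integral>\<^sup>+x. ennreal (exp (- x)) \<partial>exp_law r)"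
    unfolding r_def distr_gap[OF c, of p k, symmetric]
    by (rule nn_integral_distr[OF measurable_gap[OF c], symmetric]) simp
  also have "\<dots> = (\<integral>\<^sup>+x. ennreal (exponential_density r x) * ennreal (exp (- x)) \<partial>lborel)"
    by (rule nn_integral_density) simp_all
  also have "\<dots> = (\<integral>\<^sup>+x. ennreal (r / (1 + r)) * ennreal (exponential_density (1 + r) x) \<partial>lborel)"
  proof (rule nn_integral_cong)
    fix x
    have "exponential_density r x * exp (- x) = r / (1 + r) * exponential_density (1 + r) x"
    proof (cases "x < 0")
      case False
      have "exp (- x * r) * exp (- x) = exp (- x * (1 + r))"
        by (simp add: exp_add[symmetric] algebra_simps)
      then show ?thesis
        using False r unfolding exponential_density_def by (simp add: mult.assoc)
    qed (simp add: exponential_density_def)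
    then show "ennreal (exponential_density r x) * ennreal (exp (- x)) = ennreal (r / (1 + r)) * ennreal (exponential_density (1 + r) x)"
      using r by (subst (1 2) ennreal_mult[symmetric]) (auto simp: exponential_density_def)
  qed
  also have "\<dots> = ennreal (r / (1 + r)) * (\<integral>\<^sup>+x. ennreal (exponential_density (1 + r) x) \<partial>lborel)"
    by (rule nn_integral_cmult) simp
  also have "(\<integral>\<^sup>+x. ennreal (exponential_density (1 + r) x) \<partial>lborel) = 1"
    using prob_space.emeasure_space_1[OF prob_space_exponential_density[of "1 + r"]] r
    by (simp add: emeasure_density)
  finally show ?thesis by (simp add: r_def)
qed

text \<open>Exponential Markov inequality: the indicator is at most the exponential of
  \<open>t\<close> minus the ring time, and each of the \<open>k + 1\<close> waiting times
  contributes its Laplace transform at 1, \<open>rate / (1 + rate)\<close>. The factors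
  \<open>f\<close> of other sources are carried along, to apply the bound on an event that is
  independent of this clock.\<close>

lemma emeasure_ring_le:
  fixes f :: "source \<Rightarrow> real \<Rightarrow> real"
  assumes c: "c \<in> clocks lam" and J: "finite J" "J \<subseteq> sources" "\<And>j. Gap c p j \<notin> J"
    and f: "\<And>s. f s \<in> borel_measurable borel" "\<And>s x. 0 \<le> f s x"
  shows "(\<integral>\<^sup>+w. ennreal (\<Prod>s\<in>J. f s (V s w)) * indicator {w. (\<Sum>j\<le>k. gap c p j w) \<le> t} w \<partial>M)
    \<le> ennreal (exp t) * ennreal ((clock_rate lam c / (1 + clock_rate lam c)) ^ Suc k)
        * (\<Prod>s\<in>J. \<integral>\<^sup>+w. ennreal (f s (V s w)) \<partial>M)"
proof -
  define G where "G = Gap c p ` {..k}"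
  define h where "h s x = (if s \<in> J then f s x else exp (- x))" for s x
  have G: "finite G" "G \<subseteq> sources" "J \<inter> G = {}" "inj_on (Gap c p) {..k}"
    using c J by (auto simp: G_def inj_on_def)
  have hm: "h s \<in> borel_measurable borel" for s
  proof (cases "s \<in> J")
    case True
    then have "h s = f s" by (simp add: h_def fun_eq_iff)
    then show ?thesis by (simp only: f)
  next
    case False
    then have "h s = (\<lambda>x. exp (- x))" by (simp add: h_def fun_eq_iff)
    then show ?thesis by simp
  qed
  have JG: "finite (J \<union> G)" "J \<union> G \<subseteq> sources"
    using J G by auto
  have "indep_vars (\<lambda>_. borel) (\<lambda>s w. h s (V s w)) (J \<union> G)"
    by (rule indep_vars_compose2[OF indep_vars_subset[OF indep_V JG(2)] hm])
  from indep_vars_compose2[OF this, of "\<lambda>_. ennreal" "\<lambda>_. borel"]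
  have "indep_vars (\<lambda>_. borel) (\<lambda>s w. ennreal (h s (V s w))) (J \<union> G)"
    by simp
  from indep_vars_nn_integral[OF JG(1) this]
  have prod: "(\<integral>\<^sup>+w. (\<Prod>s\<in>J \<union> G. ennreal (h s (V s w))) \<partial>M) = (\<Prod>s\<in>J \<union> G. \<integral>\<^sup>+w. ennreal (h s (V s w)) \<partial>M)"
    by simp
  have "(\<integral>\<^sup>+w. ennreal (\<Prod>s\<in>J. f s (V s w)) * indicator {w. (\<Sum>j\<le>k. gap c p j w) \<le> t} w \<partial>M)
      \<le> (\<integral>\<^sup>+w. ennreal (exp t) * (\<Prod>s\<in>J \<union> G. ennreal (h s (V s w))) \<partial>M)"
  proof (rule nn_integral_mono)
    fix w
    have "(\<Prod>s\<in>J \<union> G. ennreal (h s (V s w))) = ennreal (\<Prod>s\<in>J. f s (V s w)) * ennreal (\<Prod>s\<in>G. exp (- V s w))"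
    proof -
      have "(\<Prod>s\<in>J. ennreal (h s (V s w))) = (\<Prod>s\<in>J. ennreal (f s (V s w)))"
        by (rule prod.cong) (simp_all add: h_def)
      also have "\<dots> = ennreal (\<Prod>s\<in>J. f s (V s w))"
        by (rule prod_ennreal) (rule f(2))
      finally have 1: "(\<Prod>s\<in>J. ennreal (h s (V s w))) = ennreal (\<Prod>s\<in>J. f s (V s w))" .
      have "(\<Prod>s\<in>G. ennreal (h s (V s w))) = (\<Prod>s\<in>G. ennreal (exp (- V s w)))"
      proof (rule prod.cong[OF refl])
        fix s assume "s \<in> G"
        then have "s \<notin> J" using G(3) by blast
        then show "ennreal (h s (V s w)) = ennreal (exp (- V s w))" by (simp add: h_def)
      qed
      also have "\<dots> = ennreal (\<Prod>s\<in>G. exp (- V s w))"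
        by (rule prod_ennreal) (rule exp_ge_zero)
      finally show ?thesis
        by (simp only: prod.union_disjoint[OF J(1) G(1) G(3)] 1)
    qed
    also have "(\<Prod>s\<in>G. exp (- V s w)) = exp (- (\<Sum>j\<le>k. gap c p j w))"
    proof -
      have "(\<Prod>s\<in>G. exp (- V s w)) = (\<Prod>j\<le>k. exp (- gap c p j w))"
        unfolding G_def prod.reindex[OF G(4)] by (simp only: comp_def V_simps)
      also have "\<dots> = exp (\<Sum>j\<le>k. - gap c p j w)"
        by (rule exp_sum[symmetric]) simp
      finally show ?thesis by (simp only: sum_negf)
    qed
    finally have "ennreal (exp t) * (\<Prod>s\<in>J \<union> G. ennreal (h s (V s w)))
        = ennreal (\<Prod>s\<in>J. f s (V s w)) * (ennreal (exp t) * ennreal (exp (- (\<Sum>j\<le>k. gap c p j w))))"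
      by (simp only: mult.left_commute)
    also have "ennreal (exp t) * ennreal (exp (- (\<Sum>j\<le>k. gap c p j w))) = ennreal (exp (t - (\<Sum>j\<le>k. gap c p j w)))"
      by (simp only: ennreal_mult[OF exp_ge_zero exp_ge_zero, symmetric] exp_add[symmetric] diff_conv_add_uminus)
    finally have *: "ennreal (exp t) * (\<Prod>s\<in>J \<union> G. ennreal (h s (V s w)))
        = ennreal (\<Prod>s\<in>J. f s (V s w)) * ennreal (exp (t - (\<Sum>j\<le>k. gap c p j w)))" .
    show "ennreal (\<Prod>s\<in>J. f s (V s w)) * indicator {w. (\<Sum>j\<le>k. gap c p j w) \<le> t} w
        \<le> ennreal (exp t) * (\<Prod>s\<in>J \<union> G. ennreal (h s (V s w)))"
      unfolding * by (intro mult_left_mono) (auto simp: indicator_def ennreal_1[symmetric] intro!: ennreal_leI simp del: ennreal_1)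
  qed
  also have "\<dots> = ennreal (exp t) * (\<integral>\<^sup>+w. (\<Prod>s\<in>J \<union> G. ennreal (h s (V s w))) \<partial>M)"
  proof (rule nn_integral_cmult, rule borel_measurable_prod_ennreal)
    fix s assume "s \<in> J \<union> G"
    then have "V s \<in> borel_measurable M" using J G measurable_V by blast
    from measurable_compose[OF measurable_compose[OF this hm] measurable_ennreal]
    show "(\<lambda>w. ennreal (h s (V s w))) \<in> borel_measurable M" .
  qed
  also have "\<dots> = ennreal (exp t) * ((\<Prod>s\<in>J. \<integral>\<^sup>+w. ennreal (f s (V s w)) \<partial>M) *
      ennreal ((clock_rate lam c / (1 + clock_rate lam c)) ^ Suc k))"
  proof -
    have "(\<Prod>s\<in>G. \<integral>\<^sup>+w. ennreal (h s (V s w)) \<partial>M) = (\<Prod>s\<in>G. ennreal (clock_rate lam c / (1 + clock_rate lam c)))"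
    proof (rule prod.cong[OF refl])
      fix s assume "s \<in> G"
      then obtain j where s: "s = Gap c p j" by (auto simp: G_def)
      have "h s (V s w) = exp (- gap c p j w)" for w
        using J(3)[of j] by (simp add: h_def s)
      then show "(\<integral>\<^sup>+w. ennreal (h s (V s w)) \<partial>M) = ennreal (clock_rate lam c / (1 + clock_rate lam c))"
        by (simp only: nn_integral_exp_gap[OF c])
    qed
    also have "\<dots> = ennreal ((clock_rate lam c / (1 + clock_rate lam c)) ^ Suc k)"
    proof -
      have "card G = Suc k" by (simp add: G_def card_image[OF G(4)])
      moreover have "0 \<le> clock_rate lam c / (1 + clock_rate lam c)" using rate_pos[OF c] by simp
      ultimately show ?thesis by (simp only: prod_constant ennreal_power)
    qed
    finally have 1: "(\<Prod>s\<in>G. \<integral>\<^sup>+w. ennreal (h s (V s w)) \<partial>M)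
      = ennreal ((clock_rate lam c / (1 + clock_rate lam c)) ^ Suc k)" .
    have 2: "(\<Prod>s\<in>J. \<integral>\<^sup>+w. ennreal (h s (V s w)) \<partial>M) = (\<Prod>s\<in>J. \<integral>\<^sup>+w. ennreal (f s (V s w)) \<partial>M)"
      by (intro prod.cong) (simp_all add: h_def)
    show ?thesis
      unfolding prod by (simp only: prod.union_disjoint[OF J(1) G(1) G(3)] 1 2)
  qed
  finally show ?thesis
    by (simp only: mult.assoc mult.commute mult.left_commute)
qed

lemma measurable_ring_sum:
  assumes "c \<in> clocks lam"
  shows "(\<lambda>w. \<Sum>j\<le>k. gap c p j w) \<in> borel_measurable M"
  using measurable_gap[OF assms] by (intro borel_measurable_sum)

lemma AE_ring_unbounded:
  assumes c: "c \<in> clocks lam"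
  shows "AE w in M. \<exists>k. t < (\<Sum>j\<le>k. gap c p j w)"
proof -
  let ?q = "clock_rate lam c / (1 + clock_rate lam c)"
  have q: "0 \<le> ?q" "?q < 1" using rate_pos[OF c] by (auto simp: field_simps)
  define N where "N = {w \<in> space M. \<forall>k. (\<Sum>j\<le>k. gap c p j w) \<le> t}"
  have N: "N \<in> sets M"
    unfolding N_def
    by (rule sets.sets_Collect_countable_All) (rule borel_measurable_le[OF measurable_ring_sum[OF c] borel_measurable_const])
  have "emeasure M N \<le> ennreal (exp t * ?q ^ Suc k)" for k
  proof -
    have "emeasure M N = (\<integral>\<^sup>+w. indicator N w \<partial>M)" using N by simp
    also have "\<dots> \<le> (\<integral>\<^sup>+w. ennreal (\<Prod>s\<in>({} :: source set). 1) * indicator {w. (\<Sum>j\<le>k. gap c p j w) \<le> t} w \<partial>M)"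
      by (intro nn_integral_mono) (auto simp: N_def indicator_def)
    also have "\<dots> \<le> ennreal (exp t * ?q ^ Suc k)"
      using emeasure_ring_le[OF c, where J = "{}" and p = p and f = "\<lambda>_ _. 1" and k = k and t = t] q
      by (simp add: ennreal_mult del: power_Suc)
    finally show ?thesis .
  qed
  then have le: "prob N \<le> exp t * ?q ^ Suc k" for k
    using q by (simp add: emeasure_eq_measure del: power_Suc)
  have "(\<lambda>k. exp t * ?q ^ Suc k) \<longlonglongrightarrow> exp t * 0"
    using q by (intro tendsto_mult tendsto_const LIMSEQ_Suc[OF LIMSEQ_realpow_zero])
  then have "prob N \<le> 0"
    using le by (intro LIMSEQ_le_const[of _ _ "prob N"]) auto
  then have "N \<in> null_sets M"
    using N by (simp add: emeasure_eq_measure null_sets_def measure_le_0_iff)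
  then show ?thesis
    by (rule AE_I') (auto simp: N_def not_less)
qed

text \<open>By independence and Fubini, as an exponential law has no atoms; \<open>Y\<close> may
  have any law.\<close>

lemma AE_indep_neq:
  assumes ind: "indep_var borel X borel Y" and X: "distr M borel X = exp_law r"
  shows "AE w in M. X w \<noteq> (Y w :: real)"
proof -
  have m: "X \<in> borel_measurable M" "Y \<in> borel_measurable M"
    by (rule indep_var_rv1[OF ind], rule indep_var_rv2[OF ind])
  interpret X: prob_space "distr M borel X" by (rule prob_space_distr[OF m(1)])
  interpret Y: prob_space "distr M borel Y" by (rule prob_space_distr[OF m(2)])
  interpret P: pair_prob_space "distr M borel X" "distr M borel Y" ..
  let ?D = "{z \<in> space (borel \<Otimes>\<^sub>M borel). fst z = (snd z :: real)}"
  have D': "?D \<in> sets (borel \<Otimes>\<^sub>M borel)"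
    by (rule borel_measurable_eq[OF measurable_fst measurable_snd])
  have "sets (distr M borel X \<Otimes>\<^sub>M distr M borel Y) = sets (borel \<Otimes>\<^sub>M borel)"
    by (rule sets_pair_measure_cong) simp_all
  with D' have D: "?D \<in> sets (distr M borel X \<Otimes>\<^sub>M distr M borel Y)"
    by (simp only:)
  have "emeasure M {w \<in> space M. X w = Y w} = emeasure (distr M (borel \<Otimes>\<^sub>M borel) (\<lambda>w. (X w, Y w))) ?D"
  proof -
    have "{w \<in> space M. X w = Y w} = (\<lambda>w. (X w, Y w)) -` ?D \<inter> space M"
      by (auto simp: space_pair_measure)
    then show ?thesis
      by (simp only: emeasure_distr[OF measurable_Pair[OF m] D'])
  qed
  also have "\<dots> = emeasure (distr M borel X \<Otimes>\<^sub>M distr M borel Y) ?D"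
    using indep_var_distribution_eq[THEN iffD1, OF ind] by (simp only:)
  also have "\<dots> = (\<integral>\<^sup>+y. emeasure (distr M borel X) ((\<lambda>x. (x, y)) -` ?D) \<partial>distr M borel Y)"
    by (rule P.emeasure_pair_measure_alt2[OF D])
  also have "\<dots> = (\<integral>\<^sup>+y. 0 \<partial>distr M borel Y)"
  proof (rule nn_integral_cong)
    fix y :: real
    have "(\<lambda>x. (x, y)) -` ?D = {y}" by (auto simp: space_pair_measure)
    moreover have "{y} \<in> null_sets (exp_law r)"
    proof (subst null_sets_density_iff)
      show "(\<lambda>x. ennreal (exponential_density r x)) \<in> borel_measurable lborel" by simp
      show "{y} \<in> sets lborel \<and> (AE x in lborel. x \<in> {y} \<longrightarrow> ennreal (exponential_density r x) = 0)"
        by (rule conjI, simp, rule eventually_mono[OF AE_lborel_singleton[of y]]) simp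
    qed
    ultimately show "emeasure (distr M borel X) ((\<lambda>x. (x, y)) -` ?D) = 0"
      by (simp only: X null_setsD1)
  qed
  finally have "emeasure M {w \<in> space M. X w = Y w} = 0"
    by simp
  then have "{w \<in> space M. X w = Y w} \<in> null_sets M"
    by (intro null_setsI borel_measurable_eq m)
  then show ?thesis
    by (rule AE_I') auto
qed

text \<open>Solved for the first waiting time of \<open>(c, p)\<close>, an equality of ring times
  says that this exponential variable equals a function of other, independent waiting times.\<close>

lemma AE_rings_distinct:
  assumes c: "c \<in> clocks lam" "c' \<in> clocks lam" and ne: "(c, p) \<noteq> (c', p')"
  shows "AE w in M. (\<Sum>j\<le>k. gap c p j w) \<noteq> (\<Sum>j\<le>k'. gap c' p' j w)"
proof -
  define I1 where "I1 = Gap c p ` {1..k}"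
  define I2 where "I2 = Gap c' p' ` {..k'}"
  define i where "i = Gap c p 0"
  \<comment> \<open>The later waiting times of \<open>(c, p)\<close> change sides in the equation
    and so carry a minus sign.\<close>
  define h where "h s x = (if s \<in> I1 then - x else x)" for s and x :: real
  have I: "finite (I1 \<union> I2)" "i \<notin> I1 \<union> I2" "insert i (I1 \<union> I2) \<subseteq> sources" "I1 \<inter> I2 = {}"
    "inj_on (Gap c p) {1..k}" "inj_on (Gap c' p') {..k'}"
    using c ne by (auto simp: I1_def I2_def i_def inj_on_def)
  have "indep_vars (\<lambda>_. borel) (\<lambda>s w. h s (V s w)) (insert i (I1 \<union> I2))"
  proof (rule indep_vars_compose2[OF indep_vars_subset[OF indep_V I(3)]])
    fix s
    have "h s = (\<lambda>x. - x) \<or> h s = (\<lambda>x. x)"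
      by (auto simp: h_def fun_eq_iff)
    then show "h s \<in> borel_measurable borel"
      by (elim disjE) simp_all
  qed
  from indep_vars_sum[OF I(1,2) this]
  have "indep_var borel (\<lambda>w. h i (V i w)) borel (\<lambda>w. \<Sum>s\<in>I1 \<union> I2. h s (V s w))" .
  moreover have "h i (V i w) = gap c p 0 w" for w
    using I(2) by (simp add: h_def) (simp add: i_def)
  moreover have "(\<Sum>s\<in>I1 \<union> I2. h s (V s w)) = (\<Sum>j\<le>k'. gap c' p' j w) - (\<Sum>j=1..k. gap c p j w)" for w
  proof -
    have "(\<Sum>s\<in>I1. h s (V s w)) = - (\<Sum>j=1..k. gap c p j w)"
      unfolding I1_def sum.reindex[OF I(5)] by (simp add: h_def I1_def sum_negf)
    moreover have "(\<Sum>s\<in>I2. h s (V s w)) = (\<Sum>s\<in>I2. V s w)"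
      using I(4) by (intro sum.cong) (auto simp: h_def)
    moreover have "(\<Sum>s\<in>I2. V s w) = (\<Sum>j\<le>k'. gap c' p' j w)"
      unfolding I2_def sum.reindex[OF I(6)] by simp
    ultimately show ?thesis
      using I by (subst sum.union_disjoint) auto
  qed
  ultimately have "indep_var borel (gap c p 0) borel (\<lambda>w. (\<Sum>j\<le>k'. gap c' p' j w) - (\<Sum>j=1..k. gap c p j w))"
    by simp
  from AE_indep_neq[OF this distr_gap[OF c(1)]] show ?thesis
  proof eventually_elim
    case (elim w)
    have "(\<Sum>j\<le>k. gap c p j w) = gap c p 0 w + (\<Sum>j=1..k. gap c p j w)"
      by (simp add: sum.atLeast_Suc_atMost atMost_atLeast0)
    with elim show ?case by auto
  qed
qed

lemma AE_regular: "AE w in M. regular lam (\<lambda>c p k. gap c p k w)"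
proof -
  have pos: "AE w in M. \<forall>c p k. c \<in> clocks lam \<longrightarrow> 0 < gap c p k w"
    using AE_gap_pos by (auto simp: AE_all_countable intro: AE_I2)
  have unb: "AE w in M. \<forall>c p (t :: nat). c \<in> clocks lam \<longrightarrow> (\<exists>k. real t < (\<Sum>j\<le>k. gap c p j w))"
    using AE_ring_unbounded by (auto simp: AE_all_countable intro: AE_I2)
  have dist: "AE w in M. \<forall>c p k c' p' k'. c \<in> clocks lam \<longrightarrow> c' \<in> clocks lam \<longrightarrow> (c, p) \<noteq> (c', p') \<longrightarrow>
      (\<Sum>j\<le>k. gap c p j w) \<noteq> (\<Sum>j\<le>k'. gap c' p' j w)"
    using AE_rings_distinct by (auto simp: AE_all_countable intro: AE_I2)
  from pos unb dist show ?thesis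
  proof eventually_elim
    case (elim w)
    let ?g = "\<lambda>c p k. gap c p k w"
    have mono: "strict_mono (\<lambda>k. \<Sum>j\<le>k. gap c p j w)" if "c \<in> clocks lam" for c p
      using elim(1)[rule_format, OF that] by (intro strict_monoI_Suc) simp
    have "inj_on (ring_time ?g) {(c, p, k). c \<in> clocks lam}"
    proof (rule inj_onI)
      fix r r' assume r: "r \<in> {(c, p, k). c \<in> clocks lam}" "r' \<in> {(c, p, k). c \<in> clocks lam}"
        and eq: "ring_time ?g r = ring_time ?g r'"
      obtain c p k c' p' k' where [simp]: "r = (c, p, k)" "r' = (c', p', k')"
        by (metis prod.collapse)
      have c: "c \<in> clocks lam" "c' \<in> clocks lam" using r by auto
      have *: "(c, p) = (c', p')"
        using elim(3)[rule_format, OF c, of p p' k k'] eq by auto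
      then have "k = k'"
        using eq strict_mono_eq[OF mono[OF c(1), of p], of k k'] by auto
      with * show "r = r'" by auto
    qed
    moreover have "finite {k. ring_time ?g (c, p, k) \<le> t}" if c: "c \<in> clocks lam" for c p t
    proof -
      obtain k where k: "real (nat \<lceil>t\<rceil>) < (\<Sum>j\<le>k. gap c p j w)"
        using elim(2) c by blast
      have "{k. ring_time ?g (c, p, k) \<le> t} \<subseteq> {..k}"
      proof clarsimp
        fix k' assume "(\<Sum>j\<le>k'. gap c p j w) \<le> t"
        then have "(\<Sum>j\<le>k'. gap c p j w) < (\<Sum>j\<le>k. gap c p j w)"
          using k by linarith
        then show "k' \<le> k"
          using strict_mono_less[OF mono[OF c, of p], of k' k] by simp
      qed
      then show ?thesis by (rule finite_subset) simp
    qed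
    ultimately show ?case
      using elim(1) by (auto simp: regular_def simp del: ring_time.simps)
  qed
qed

end

context arw_model
begin

section \<open>Barriers from independence of the sites\<close>

lemma prob_eta0: "prob {w \<in> space M. eta0 x w \<in> X} = prob {w \<in> space M. eta0 0 w \<in> X}"
proof -
  have "prob {w \<in> space M. eta0 y w \<in> X} = measure (distr M (count_space UNIV) (eta0 y)) X" for y
    by (subst measure_distr[OF measurable_eta0]) (auto intro!: arg_cong[where f = prob])
  then show ?thesis by (simp only: ident[of x])
qed

lemma sets_eta0: "{w \<in> space M. eta0 x w \<in> X} \<in> sets M"
proof -
  have "{w \<in> space M. eta0 x w \<in> X} = eta0 x -` X \<inter> space M" by auto
  then show ?thesis
    using measurable_sets[OF measurable_eta0, of X x] by simp
qed

text \<open>In a barrier at \<open>y\<close>, the particles of the last \<open>m\<close> sites are few and do not ring before time \<open>T\<close>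
  (the functions \<open>f\<close> are the indicators of this); the other particles would need many rings.\<close>

lemma emeasure_near_not_far:
  fixes mu :: real
  assumes mean: "(\<integral>\<^sup>+w. ennreal (real (eta0 0 w)) \<partial>M) = ennreal mu" and mu: "0 \<le> mu"
    and J: "finite J" "J \<subseteq> sources" "\<And>c z l k. Gap c (z, l) k \<in> J \<Longrightarrow> y - int m < z" "\<And>z. Init z \<in> J \<Longrightarrow> y - int m < z"
    and f: "\<And>s. f s \<in> borel_measurable borel" "\<And>s x. f s x = 0 \<or> f s x = (1 :: real)"
  shows "emeasure M {w \<in> space M. (\<forall>s\<in>J. f s (V s w) = 1) \<and>
        (\<exists>a l. l < eta0 (y - int m - int a) w \<and> (\<Sum>j\<le>m + a. gap Jump (y - int m - int a, l) j w) \<le> T)}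
    \<le> ennreal (exp T * mu * (1 / 2) ^ m) * (\<Prod>s\<in>J. \<integral>\<^sup>+w. ennreal (f s (V s w)) \<partial>M)" (is "emeasure M ?X \<le> _")
    and "{w \<in> space M. (\<forall>s\<in>J. f s (V s w) = 1) \<and>
        (\<exists>a l. l < eta0 (y - int m - int a) w \<and> (\<Sum>j\<le>m + a. gap Jump (y - int m - int a, l) j w) \<le> T)} \<in> sets M"
proof -
  let ?z = "\<lambda>a. y - int m - int a"
  let ?P = "\<Prod>s\<in>J. \<integral>\<^sup>+w. ennreal (f s (V s w)) \<partial>M"
  define E where "E a l = {w \<in> space M. (\<forall>s\<in>J. f s (V s w) = 1) \<and> l < eta0 (?z a) w \<and>
     (\<Sum>j\<le>m + a. gap Jump (?z a, l) j w) \<le> T}" for a l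
  have near: "{w \<in> space M. \<forall>s\<in>J. f s (V s w) = 1} \<in> sets M"
  proof (rule sets.sets_Collect_finite_All[OF _ J(1)])
    fix s assume "s \<in> J"
    then have "V s \<in> borel_measurable M" using J measurable_V by blast
    from borel_measurable_eq[OF measurable_compose[OF this f(1)] borel_measurable_const]
    show "{w \<in> space M. f s (V s w) = 1} \<in> sets M" .
  qed
  have E_sets: "E a l \<in> sets M" for a l
  proof -
    have "E a l = {w \<in> space M. \<forall>s\<in>J. f s (V s w) = 1} \<inter> {w \<in> space M. eta0 (?z a) w \<in> {l<..}} \<inter>
        {w \<in> space M. (\<Sum>j\<le>m + a. gap Jump (?z a, l) j w) \<le> T}"
      by (auto simp: E_def)
    also have "\<dots> \<in> sets M"
      by (intro sets.Int near sets_eta0 borel_measurable_le[OF measurable_ring_sum[OF Jump_in_clocks] borel_measurable_const])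
    finally show ?thesis .
  qed
  have E_le: "emeasure M (E a l) \<le> ennreal (exp T * (1 / 2) ^ (m + a + 1)) * ?P * emeasure M {w \<in> space M. l < eta0 0 w}" for a l
  proof -
    let ?s = "Init (?z a)"
    \<comment> \<open>The occupation number of the far site becomes one more independent factor: the
      indicator that particle number \<open>l\<close> exists there.\<close>
    define f' where "f' s x = (if s = ?s then (if real l < x then 1 else 0) else f s x)" for s and x :: real
    have sJ: "?s \<notin> J" using J(4)[of "?z a"] by auto
    have f'm: "f' s \<in> borel_measurable borel" for s
    proof (cases "s = ?s")
      case True
      then have "f' s = (\<lambda>x. indicator {real l<..} x)" by (auto simp: f'_def indicator_def fun_eq_iff)
      then show ?thesis by simp
    next
      case False
      then have "f' s = f s" by (auto simp: f'_def fun_eq_iff)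
      then show ?thesis by (simp only: f(1))
    qed
    have f'0: "0 \<le> f' s x" for s x
      using f(2)[of s x] by (auto simp: f'_def)
    have J': "finite (insert ?s J)" "insert ?s J \<subseteq> sources" "\<And>j. Gap Jump (?z a, l) j \<notin> insert ?s J"
      using J(1,2) J(3)[of Jump "?z a" l] by auto
    have "emeasure M (E a l) = (\<integral>\<^sup>+w. indicator (E a l) w \<partial>M)"
      using E_sets by simp
    also have "\<dots> \<le> (\<integral>\<^sup>+w. ennreal (\<Prod>s\<in>insert ?s J. f' s (V s w)) *
        indicator {w. (\<Sum>j\<le>m + a. gap Jump (?z a, l) j w) \<le> T} w \<partial>M)"
    proof (rule nn_integral_mono)
      fix w
      have "(\<Prod>s\<in>insert ?s J. f' s (V s w)) = 1" if "w \<in> E a l"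
      proof (rule prod.neutral, rule ballI)
        fix s assume "s \<in> insert ?s J"
        then show "f' s (V s w) = 1"
          using that sJ by (auto simp: f'_def E_def)
      qed
      then show "indicator (E a l) w \<le> ennreal (\<Prod>s\<in>insert ?s J. f' s (V s w)) *
        indicator {w. (\<Sum>j\<le>m + a. gap Jump (?z a, l) j w) \<le> T} w"
        by (auto simp: indicator_def E_def)
    qed
    also have "\<dots> \<le> ennreal (exp T) * ennreal ((clock_rate lam Jump / (1 + clock_rate lam Jump)) ^ Suc (m + a))
        * (\<Prod>s\<in>insert ?s J. \<integral>\<^sup>+w. ennreal (f' s (V s w)) \<partial>M)"
      by (rule emeasure_ring_le[OF Jump_in_clocks J' f'm f'0])
    also have "(\<Prod>s\<in>insert ?s J. \<integral>\<^sup>+w. ennreal (f' s (V s w)) \<partial>M)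
        = emeasure M {w \<in> space M. l < eta0 0 w} * ?P"
    proof -
      have "(\<integral>\<^sup>+w. ennreal (f' ?s (V ?s w)) \<partial>M) = (\<integral>\<^sup>+w. indicator {w \<in> space M. eta0 (?z a) w \<in> {l<..}} w \<partial>M)"
        by (rule nn_integral_cong) (simp add: f'_def indicator_def)
      also have "\<dots> = emeasure M {w \<in> space M. eta0 (?z a) w \<in> {l<..}}"
        by (rule nn_integral_indicator[OF sets_eta0])
      also have "\<dots> = emeasure M {w \<in> space M. eta0 0 w \<in> {l<..}}"
        unfolding emeasure_eq_measure prob_eta0[of "?z a"] ..
      finally have 1: "(\<integral>\<^sup>+w. ennreal (f' ?s (V ?s w)) \<partial>M) = emeasure M {w \<in> space M. l < eta0 0 w}"
        by simp
      have 2: "(\<Prod>s\<in>J. \<integral>\<^sup>+w. ennreal (f' s (V s w)) \<partial>M) = ?P"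
      proof (rule prod.cong[OF refl])
        fix s assume "s \<in> J"
        then have "s \<noteq> ?s" using sJ by auto
        then show "(\<integral>\<^sup>+w. ennreal (f' s (V s w)) \<partial>M) = (\<integral>\<^sup>+w. ennreal (f s (V s w)) \<partial>M)"
          by (simp add: f'_def)
      qed
      show ?thesis
        unfolding prod.insert[OF J(1) sJ] 1 2 ..
    qed
    also have "ennreal (exp T) * ennreal ((clock_rate lam Jump / (1 + clock_rate lam Jump)) ^ Suc (m + a))
        = ennreal (exp T * (1 / 2) ^ (m + a + 1))"
      by (subst ennreal_mult[symmetric]) simp_all
    finally show ?thesis by (simp only: mult.assoc mult.commute mult.left_commute)
  qed
  have X: "?X = (\<Union>a. \<Union>l. E a l)"
    by (auto simp: E_def)
  have E_UN: "(\<Union>l. E a l) \<in> sets M" for a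
    by (rule sets.countable_UN) (use E_sets in blast)
  show "?X \<in> sets M"
    unfolding X by (rule sets.countable_UN) (use E_UN in blast)
  have "emeasure M ?X \<le> (\<Sum>a. emeasure M (\<Union>l. E a l))"
    unfolding X by (rule emeasure_subadditive_countably) (use E_UN in blast)
  also have "\<dots> \<le> (\<Sum>a. \<Sum>l. emeasure M (E a l))"
  proof (intro suminf_le)
    show "emeasure M (\<Union>l. E a l) \<le> (\<Sum>l. emeasure M (E a l))" for a
      by (rule emeasure_subadditive_countably) (use E_sets in blast)
  qed simp_all
  also have "\<dots> \<le> (\<Sum>a. \<Sum>l. ennreal (exp T * (1 / 2) ^ (m + a + 1)) * ?P * emeasure M {w \<in> space M. l < eta0 0 w})"
    by (intro suminf_le E_le) auto
  \<comment> \<open>Summed over \<open>l\<close>, the tail probabilities give the mean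
    \<open>mu\<close>; the remaining sum over \<open>a\<close> is geometric.\<close>
  also have "\<dots> = (\<Sum>a. ennreal (exp T * (1 / 2) ^ (m + a + 1)) * ?P * ennreal mu)"
  proof -
    have "(\<Sum>l. emeasure M {w \<in> space M. l < eta0 0 w}) = (\<integral>\<^sup>+w. of_nat (eta0 0 w) \<partial>M)"
      by (rule nn_integral_nat_function[OF measurable_eta0, symmetric])
    also have "\<dots> = ennreal mu"
      by (simp add: mean[symmetric] ennreal_of_nat_eq_real_of_nat)
    finally show ?thesis by simp
  qed
  also have "\<dots> = (\<Sum>a. ennreal (exp T * mu * (1 / 2) ^ (m + 1) * (1 / 2) ^ a) * ?P)"
  proof (rule suminf_cong)
    fix a
    have "ennreal (exp T * (1 / 2) ^ (m + a + 1)) * ennreal mu = ennreal (exp T * mu * (1 / 2) ^ (m + 1) * (1 / 2) ^ a)"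
      using mu by (subst ennreal_mult[symmetric]) (simp_all add: power_add mult_ac)
    moreover have "ennreal (exp T * (1 / 2) ^ (m + a + 1)) * ?P * ennreal mu
        = ennreal (exp T * (1 / 2) ^ (m + a + 1)) * ennreal mu * ?P"
      by (simp only: mult.assoc mult.commute[of ?P])
    ultimately show "ennreal (exp T * (1 / 2) ^ (m + a + 1)) * ?P * ennreal mu
        = ennreal (exp T * mu * (1 / 2) ^ (m + 1) * (1 / 2) ^ a) * ?P"
      by (simp only:)
  qed
  also have "\<dots> = (\<Sum>a. ennreal (exp T * mu * (1 / 2) ^ (m + 1) * (1 / 2) ^ a)) * ?P"
    by simp
  also have "(\<Sum>a. ennreal (exp T * mu * (1 / 2) ^ (m + 1) * (1 / 2) ^ a)) = ennreal (exp T * mu * (1 / 2) ^ (m + 1) * 2)"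
  proof (rule suminf_ennreal_eq)
    show "(\<lambda>a. exp T * mu * (1 / 2) ^ (m + 1) * (1 / 2) ^ a) sums (exp T * mu * (1 / 2) ^ (m + 1) * 2)"
      using geometric_sums[of "1 / 2 :: real"] by (intro sums_mult) simp
  qed (use mu in simp)
  also have "exp T * mu * (1 / 2) ^ (m + 1) * 2 = exp T * mu * (1 / 2) ^ m"
    by simp
  finally show "emeasure M ?X \<le> ennreal (exp T * mu * (1 / 2) ^ m) * ?P" .
qed

definition barrier_event :: "real \<Rightarrow> int \<Rightarrow> 'w set" where
  "barrier_event T y = {w \<in> space M. barrier (\<lambda>c p k. gap c p k w) (\<lambda>x. eta0 x w) T y}"

text \<open>Everything random at the site \<open>- int i\<close>. Numbering the sites from right to
  left turns the far left into a tail.\<close>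

definition site_sources :: "nat \<Rightarrow> source set" where
  "site_sources i = insert (Init (- int i)) {Gap c (- int i, l) k | c l k. c \<in> clocks lam}"

definition site_events :: "nat \<Rightarrow> 'w set set" where
  "site_events i = sigma_sets (space M) (\<Union>s\<in>site_sources i. {V s -` X \<inter> space M | X. X \<in> sets borel})"

lemma site_sources: "site_sources i \<subseteq> sources"
  by (auto simp: site_sources_def)

lemma indep_site_events: "indep_sets site_events UNIV"
  unfolding site_events_def[abs_def]
proof (rule indep_sets_collect_sigma)
  have "indep_sets (\<lambda>s. {V s -` X \<inter> space M | X. X \<in> sets borel}) sources"
    using indep_V unfolding indep_vars_def2 by blast
  then show "indep_sets (\<lambda>s. {V s -` X \<inter> space M | X. X \<in> sets borel}) (\<Union>j. site_sources j)"
    by (rule indep_sets_mono_index[rotated]) (use site_sources in auto)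
  show "disjoint_family_on site_sources UNIV"
    by (auto simp: disjoint_family_on_def site_sources_def)
  fix i j
  show "Int_stable {V i -` X \<inter> space M | X. X \<in> sets borel}"
  proof (rule Int_stableI)
    fix a b assume "a \<in> {V i -` X \<inter> space M | X. X \<in> sets borel}" "b \<in> {V i -` X \<inter> space M | X. X \<in> sets borel}"
    then obtain X Y where "a = V i -` X \<inter> space M" "b = V i -` Y \<inter> space M" "X \<in> sets borel" "Y \<in> sets borel"
      by auto
    then have "a \<inter> b = V i -` (X \<inter> Y) \<inter> space M" "X \<inter> Y \<in> sets borel" by auto
    then show "a \<inter> b \<in> {V i -` X \<inter> space M | X. X \<in> sets borel}" by blast
  qed
qed

text \<open>A barrier at \<open>- int j\<close> only concerns particles starting at or to the left
  of it, hence sources of the sites numbered \<open>j\<close> or more.\<close>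

lemma barrier_event_tail:
  assumes "n \<le> j"
  shows "barrier_event T (- int j) \<in> sigma_sets (space M) (\<Union> (site_events ` {n..}))"
proof -
  define F where "F = sigma (space M) (\<Union> (site_events ` {n..}))"
  have sub: "\<Union> (site_events ` {n..}) \<subseteq> Pow (space M)"
  proof -
    have "site_events i \<subseteq> Pow (space M)" for i
      unfolding site_events_def by (rule sigma_sets_into_sp[THEN subsetI[OF PowI]]) auto
    then show ?thesis by blast
  qed
  have F: "space F = space M" "sets F = sigma_sets (space M) (\<Union> (site_events ` {n..}))"
    using sub by (simp_all add: F_def)
  have V_F: "V s \<in> borel_measurable F" if s: "s \<in> site_sources i" "n \<le> i" for s i
  proof (rule measurableI)
    fix X :: "real set" assume "X \<in> sets borel"
    then have "V s -` X \<inter> space M \<in> site_events i"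
      unfolding site_events_def using s(1) by (intro sigma_sets.Basic) blast
    then show "V s -` X \<inter> space F \<in> sets F"
      unfolding F using s(2) by (intro sigma_sets.Basic) auto
  qed simp
  have "{w \<in> space F. \<forall>p. fst p \<le> - int j \<longrightarrow> snd p < eta0 (fst p) w \<longrightarrow>
      T < (\<Sum>i\<le>nat (- int j - fst p). gap Jump p i w)} \<in> sets F"
  proof (rule sets.sets_Collect_countable_All)
    fix p :: particle
    show "{w \<in> space F. fst p \<le> - int j \<longrightarrow> snd p < eta0 (fst p) w \<longrightarrow>
      T < (\<Sum>i\<le>nat (- int j - fst p). gap Jump p i w)} \<in> sets F"
    proof (cases "fst p \<le> - int j")
      case True
      define i where "i = nat (- fst p)"
      have i: "n \<le> i" "fst p = - int i" using True assms by (auto simp: i_def)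
      have e: "V (Init (fst p)) \<in> borel_measurable F"
        by (rule V_F[OF _ i(1)]) (simp add: site_sources_def i)
      have g: "V (Gap Jump p k) \<in> borel_measurable F" for k
        by (rule V_F[OF _ i(1)]) (cases p, use i(2) in \<open>auto simp: site_sources_def\<close>)
      have "{w \<in> space F. V (Init (fst p)) w \<le> real (snd p)} \<union>
          {w \<in> space F. T < (\<Sum>i\<le>nat (- int j - fst p). V (Gap Jump p i) w)} \<in> sets F"
        by (intro sets.Un borel_measurable_le[OF e borel_measurable_const]
            borel_measurable_less[OF borel_measurable_const borel_measurable_sum[OF g]])
      also have "{w \<in> space F. V (Init (fst p)) w \<le> real (snd p)} \<union>
          {w \<in> space F. T < (\<Sum>i\<le>nat (- int j - fst p). V (Gap Jump p i) w)}
        = {w \<in> space F. fst p \<le> - int j \<longrightarrow> snd p < eta0 (fst p) w \<longrightarrow>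
            T < (\<Sum>i\<le>nat (- int j - fst p). gap Jump p i w)}"
        using True by auto
      finally show ?thesis .
    next
      case False
      then have "{w \<in> space F. fst p \<le> - int j \<longrightarrow> snd p < eta0 (fst p) w \<longrightarrow>
        T < (\<Sum>i\<le>nat (- int j - fst p). gap Jump p i w)} = space F" by auto
      then show ?thesis by (simp only: sets.top)
    qed
  qed
  then show ?thesis
    unfolding F(2) F(1) barrier_event_def barrier_def
    by (rule back_subst[where P = "\<lambda>X. X \<in> sigma_sets (space M) (\<Union> (site_events ` {n..}))"]) auto
qed

lemma site_events_sets: "site_events i \<subseteq> sets M"
proof -
  have "{V s -` X \<inter> space M | X. X \<in> sets borel} \<subseteq> sets M" if "s \<in> site_sources i" for s
  proof -
    have "V s \<in> borel_measurable M" using that site_sources by (intro measurable_V) auto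
    from measurable_sets[OF this] show ?thesis by blast
  qed
  then show ?thesis
    unfolding site_events_def by (intro sets.sigma_sets_subset UN_least)
qed

lemma barrier_event_sets: "barrier_event T (- int j) \<in> sets M"
proof -
  have "sigma_sets (space M) (\<Union> (site_events ` {j..})) \<subseteq> sets M"
    by (intro sets.sigma_sets_subset UN_least site_events_sets)
  with barrier_event_tail[OF order_refl] show ?thesis by blast
qed

text \<open>The near event is a finite product with factors bounded below alike at all sites, and
  once \<open>m\<close> is large the far particles destroy at most half of its probability. What
  remains is a bound uniform in \<open>j\<close>.\<close>

lemma prob_barrier_event:
  fixes mu :: real
  assumes mean: "(\<integral>\<^sup>+w. ennreal (real (eta0 0 w)) \<partial>M) = ennreal mu" and mu: "0 \<le> mu" and T: "0 \<le> T"
  obtains \<delta> where "0 < \<delta>" "\<And>j. \<delta> \<le> prob (barrier_event T (- int j))"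
proof -
  obtain C where C: "0 < prob {w \<in> space M. eta0 0 w \<in> {..C}}"
  proof (rule ccontr)
    assume no: "\<not> thesis"
    have "{w \<in> space M. eta0 0 w \<in> {..C}} \<in> null_sets M" for C
    proof (rule null_setsI[OF _ sets_eta0])
      have "\<not> 0 < prob {w \<in> space M. eta0 0 w \<in> {..C}}" using no that by blast
      then show "emeasure M {w \<in> space M. eta0 0 w \<in> {..C}} = 0"
        by (simp add: emeasure_eq_measure measure_le_0_iff not_less)
    qed
    then have "(\<Union>C. {w \<in> space M. eta0 0 w \<in> {..C}}) \<in> null_sets M"
      by (rule null_sets_UN)
    also have "(\<Union>C. {w \<in> space M. eta0 0 w \<in> {..C}}) = space M" by auto
    finally show False using emeasure_space_1 by (simp add: null_sets_def)
  qed
  define pC where "pC = prob {w \<in> space M. eta0 0 w \<in> {..C}}"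
  \<comment> \<open>The share of the near event that far particles can destroy, by
    \<open>emeasure_near_not_far\<close>; \<open>m\<close> is chosen to push it below one
    half.\<close>
  have "(\<lambda>m. exp T * mu * (1 / 2) ^ m) \<longlonglongrightarrow> exp T * mu * 0"
    by (intro tendsto_mult tendsto_const LIMSEQ_realpow_zero) simp_all
  from order_tendstoD(2)[OF this, of "1 / 2"] obtain m where m: "exp T * mu * (1 / 2) ^ m < 1 / 2"
    by (auto simp: eventually_sequentially)
  \<comment> \<open>A lower bound for each of the \<open>m + m * C\<close> factors of the near
    event: \<open>m\<close> occupation numbers at most \<open>C\<close>, and \<open>m * C\<close>
    first rings after \<open>T\<close>.\<close>
  define c0 where "c0 = min pC (exp (- T))"
  have c0: "0 < c0" "c0 \<le> 1" using C T by (auto simp: c0_def pC_def min_le_iff_disj)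
  show ?thesis
  proof (rule that)
    show "0 < c0 ^ (m + m * C) / 2" using c0 by simp
    fix j
    define y where "y = - int j"
    define S where "S = {y - int m<..y}"
    define J where "J = Init ` S \<union> (\<lambda>p. Gap Jump p 0) ` (S \<times> {..<C})"
    define f :: "source \<Rightarrow> real \<Rightarrow> real"
      where "f s x = (case s of Init z \<Rightarrow> indicator {..real C} x | Gap c p k \<Rightarrow> indicator {T<..} x)" for s x
    have S: "finite S" "card S = m" by (auto simp: S_def)
    have J: "finite J" "J \<subseteq> sources" "\<And>c z l k. Gap c (z, l) k \<in> J \<Longrightarrow> y - int m < z" "\<And>z. Init z \<in> J \<Longrightarrow> y - int m < z"
      using S by (auto simp: J_def S_def)
    have fm: "f s \<in> borel_measurable borel" for s
      by (cases s) (simp_all add: f_def[abs_def])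
    have f01: "f s x = 0 \<or> f s x = 1" for s x
      by (cases s) (auto simp: f_def indicator_def)
    let ?P = "\<Prod>s\<in>J. \<integral>\<^sup>+w. ennreal (f s (V s w)) \<partial>M"
    define g where "g s = (case s of Init z \<Rightarrow> pC | Gap c p k \<Rightarrow> exp (- T))" for s :: source
    have fac: "(\<integral>\<^sup>+w. ennreal (f s (V s w)) \<partial>M) = ennreal (g s)" if s: "s \<in> J" for s
    proof (cases s)
      case (Init z)
      have "(\<integral>\<^sup>+w. ennreal (f s (V s w)) \<partial>M) = (\<integral>\<^sup>+w. indicator {w \<in> space M. eta0 z w \<in> {..C}} w \<partial>M)"
        by (rule nn_integral_cong) (simp add: Init f_def indicator_def)
      also have "\<dots> = emeasure M {w \<in> space M. eta0 z w \<in> {..C}}"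
        by (rule nn_integral_indicator[OF sets_eta0])
      finally show ?thesis
        unfolding emeasure_eq_measure prob_eta0[of z] by (simp add: Init g_def pC_def)
    next
      case (Gap c p k)
      have c: "c \<in> clocks lam" "clock_rate lam c = 1" using s by (auto simp: Gap J_def)
      have sets: "{w \<in> space M. T < gap c p k w} \<in> sets M"
        by (rule borel_measurable_less[OF borel_measurable_const measurable_gap[OF c(1)]])
      have "(\<integral>\<^sup>+w. ennreal (f s (V s w)) \<partial>M) = (\<integral>\<^sup>+w. indicator {w \<in> space M. T < gap c p k w} w \<partial>M)"
        by (rule nn_integral_cong) (simp add: Gap f_def indicator_def)
      also have "\<dots> = emeasure M {w \<in> space M. T < gap c p k w}"
        by (rule nn_integral_indicator[OF sets])
      also have "\<dots> = ennreal (exp (- T))"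
        using exponential_distributedD_gt[OF gap_distributed[OF c(1)] T rate_pos[OF c(1)], of p k] c
        by (simp add: emeasure_eq_measure)
      finally show ?thesis by (simp add: Gap g_def)
    qed
    have g0: "0 \<le> g s" "c0 \<le> g s" for s
      using c0 by (auto simp: g_def c0_def pC_def split: source.split)
    have P: "?P = ennreal (prod g J)"
      using fac g0 by (subst prod_ennreal[symmetric]) (auto intro!: prod.cong)
    have cardJ: "card J = m + m * C"
    proof -
      have "card (Init ` S) = m" "card ((\<lambda>p. Gap Jump p 0) ` (S \<times> {..<C})) = m * C"
        using S by (simp_all add: card_image inj_on_def card_cartesian_product)
      moreover have "Init ` S \<inter> (\<lambda>p. Gap Jump p 0) ` (S \<times> {..<C}) = {}" by auto
      ultimately show ?thesis
        unfolding J_def using S by (subst card_Un_disjoint) auto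
    qed
    have gJ: "c0 ^ (m + m * C) \<le> prod g J"
      using prod_mono[of J "\<lambda>_. c0" g] g0 c0 by (simp add: cardJ)
    define near where "near = {w \<in> space M. \<forall>s\<in>J. f s (V s w) = 1}"
    define far where "far = {w \<in> space M. (\<forall>s\<in>J. f s (V s w) = 1) \<and>
        (\<exists>a l. l < eta0 (y - int m - int a) w \<and> (\<Sum>j\<le>m + a. gap Jump (y - int m - int a, l) j w) \<le> T)}"
    have near_prob: "emeasure M near = ?P"
    proof -
      have ind: "indep_vars (\<lambda>_. borel) (\<lambda>s w. f s (V s w)) J"
        by (rule indep_vars_compose2[OF indep_vars_subset[OF indep_V J(2)] fm])
      from indep_vars_compose2[OF this, of "\<lambda>_. ennreal" "\<lambda>_. borel"]
      have "indep_vars (\<lambda>_. borel) (\<lambda>s w. ennreal (f s (V s w))) J" by simp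
      from indep_vars_nn_integral[OF J(1) this]
      have "?P = (\<integral>\<^sup>+w. (\<Prod>s\<in>J. ennreal (f s (V s w))) \<partial>M)" by simp
      also have "\<dots> = (\<integral>\<^sup>+w. indicator near w \<partial>M)"
      proof (rule nn_integral_cong)
        fix w assume w: "w \<in> space M"
        show "(\<Prod>s\<in>J. ennreal (f s (V s w))) = indicator near w"
        proof (cases "w \<in> near")
          case True
          then show ?thesis by (simp add: near_def)
        next
          case False
          then obtain s where "s \<in> J" "f s (V s w) = 0"
            using w f01 by (auto simp: near_def)
          then have "\<exists>s\<in>J. ennreal (f s (V s w)) = 0"
            by (intro bexI[of _ s]) simp_all
          from prod_zero[OF J(1) this] have "(\<Prod>s\<in>J. ennreal (f s (V s w))) = 0" .
          with False show ?thesis by simp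
        qed
      qed
      also have "\<dots> = emeasure M near"
      proof (rule nn_integral_indicator)
        show "near \<in> sets M"
          unfolding near_def
        proof (rule sets.sets_Collect_finite_All[OF _ J(1)])
          fix s assume "s \<in> J"
          then have "V s \<in> borel_measurable M" using J measurable_V by blast
          from borel_measurable_eq[OF measurable_compose[OF this fm] borel_measurable_const]
          show "{w \<in> space M. f s (V s w) = 1} \<in> sets M" .
        qed
      qed
      finally show ?thesis ..
    qed
    have far_prob: "emeasure M far \<le> ennreal (1 / 2) * ?P"
    proof -
      have "emeasure M far \<le> ennreal (exp T * mu * (1 / 2) ^ m) * ?P"
        unfolding far_def by (rule emeasure_near_not_far(1)[OF mean mu J fm f01])
      also have "\<dots> \<le> ennreal (1 / 2) * ?P"
        using m by (intro mult_right_mono ennreal_leI) auto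
      finally show ?thesis .
    qed
    have AE_sub: "AE w in M. w \<in> near \<longrightarrow> w \<in> barrier_event T y \<union> far"
    proof -
      have "AE w in M. \<forall>p k. 0 < gap Jump p k w"
        using AE_gap_pos[OF Jump_in_clocks] by (auto simp: AE_all_countable)
      then show ?thesis
        using AE_space
      proof eventually_elim
        case (elim w)
        show ?case
        proof (intro impI UnCI)
          assume near: "w \<in> near" and nf: "w \<notin> far"
          have n1: "f s (V s w) = 1" if "s \<in> J" for s
            using near that by (simp add: near_def)
          have "T < ring_time (\<lambda>c p k. gap c p k w) (Jump, p, nat (y - fst p))"
            if p: "fst p \<le> y" "snd p < eta0 (fst p) w" for p
          proof (cases "fst p \<le> y - int m")
            case True
            define a where "a = nat (y - int m - fst p)"
            have a: "fst p = y - int m - int a" "m + a = nat (y - fst p)"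
              using True by (auto simp: a_def)
            have "\<not> (\<Sum>j\<le>m + a. gap Jump (y - int m - int a, snd p) j w) \<le> T"
              using near nf elim(2) p(2) unfolding far_def near_def a(1) by auto
            then show ?thesis
              by (simp add: a(1)[symmetric] a(2))
          next
            case False
            then have pS: "fst p \<in> S" using p by (auto simp: S_def)
            then have "Init (fst p) \<in> J" by (simp add: J_def)
            from n1[OF this] have "eta0 (fst p) w \<le> C" by (auto simp: f_def indicator_def split: if_splits)
            then have "Gap Jump p 0 \<in> J"
              using pS p by (cases p) (auto simp: J_def)
            from n1[OF this] have "T < gap Jump p 0 w" by (auto simp: f_def indicator_def split: if_splits)
            also have "gap Jump p 0 w = (\<Sum>j\<in>{0}. gap Jump p j w)" by simp
            also have "\<dots> \<le> (\<Sum>j\<le>nat (y - fst p). gap Jump p j w)"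
            proof (rule sum_mono2)
              show "0 \<le> gap Jump p b w" for b
                by (rule less_imp_le) (use elim(1) in blast)
            qed simp_all
            finally show ?thesis by simp
          qed
          then show "w \<in> barrier_event T y"
            using elim(2) by (auto simp: barrier_event_def barrier_def simp del: ring_time.simps)
        qed
      qed
    qed
    have By: "barrier_event T y \<in> sets M"
      unfolding y_def by (rule barrier_event_sets)
    have "ennreal (prod g J) \<le> emeasure M (barrier_event T y) + ennreal (1 / 2) * ennreal (prod g J)"
    proof -
      have "far \<in> sets M"
        unfolding far_def by (rule emeasure_near_not_far(2)[OF mean mu J fm f01])
      with By have "barrier_event T y \<union> far \<in> sets M" by (rule sets.Un)
      with AE_sub have "emeasure M near \<le> emeasure M (barrier_event T y \<union> far)"
        by (rule emeasure_mono_AE)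
      also have "\<dots> \<le> emeasure M (barrier_event T y) + emeasure M far"
        by (rule emeasure_subadditive[OF By \<open>far \<in> sets M\<close>])
      also have "\<dots> \<le> emeasure M (barrier_event T y) + ennreal (1 / 2) * ?P"
        by (rule add_left_mono[OF far_prob])
      finally show ?thesis
        unfolding near_prob P .
    qed
    also have "ennreal (1 / 2) * ennreal (prod g J) = ennreal (1 / 2 * prod g J)"
      by (rule ennreal_mult[symmetric]) (simp_all add: prod_nonneg g0)
    also have "emeasure M (barrier_event T y) + ennreal (1 / 2 * prod g J)
        = ennreal (prob (barrier_event T y) + 1 / 2 * prod g J)"
      unfolding emeasure_eq_measure by (rule ennreal_plus[symmetric]) (simp_all add: prod_nonneg g0)
    finally have "prod g J \<le> prob (barrier_event T y) + 1 / 2 * prod g J"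
      using g0 by (subst (asm) ennreal_le_iff) (auto intro!: add_nonneg_nonneg prod_nonneg)
    then show "c0 ^ (m + m * C) / 2 \<le> prob (barrier_event T (- int j))"
      using gJ by (simp add: y_def)
  qed
qed

text \<open>Having barriers at infinitely many sites to the left is a tail event of the independent
  sites. Its probability is at least the uniform bound of \<open>prob_barrier_event\<close>, so it
  is positive and hence 1.\<close>

lemma AE_barriers:
  fixes mu :: real
  assumes mean: "(\<integral>\<^sup>+w. ennreal (real (eta0 0 w)) \<partial>M) = ennreal mu" and mu: "0 \<le> mu" and T: "0 \<le> T"
  shows "AE w in M. \<forall>x. \<exists>y<x. barrier (\<lambda>c p k. gap c p k w) (\<lambda>x. eta0 x w) T y"
proof -
  obtain \<delta> where \<delta>: "0 < \<delta>" "\<And>j. \<delta> \<le> prob (barrier_event T (- int j))"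
    using prob_barrier_event[OF mean mu T] by blast
  let ?B = "\<lambda>j. barrier_event T (- int j)"
  let ?L = "\<Inter>n. \<Union>j\<in>{n..}. ?B j"
  have U: "(\<Union>j\<in>{n..}. ?B j) \<in> sets M" for n
    by (rule sets.countable_UN') (use barrier_event_sets in auto)
  have L: "?L \<in> sets M"
    by (rule sets.countable_INT') (use U in auto)
  have tail: "?L \<in> tail_events site_events"
    unfolding tail_events_def
  proof
    fix n
    interpret S: sigma_algebra "space M" "sigma_sets (space M) (\<Union> (site_events ` {n..}))"
      using site_events_sets sets.sets_into_space by (intro sigma_algebra_sigma_sets) blast
    \<comment> \<open>Starting the unions at \<open>max m n\<close> leaves the limit superior
      unchanged and shows that it is determined by the sites numbered at least
      \<open>n\<close>.\<close>
    have "(\<Union>j\<in>{max m n..}. ?B j) \<in> sigma_sets (space M) (\<Union> (site_events ` {n..}))" for m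
    proof (rule S.countable_UN')
      show "?B ` {max m n..} \<subseteq> sigma_sets (space M) (\<Union> (site_events ` {n..}))"
        using barrier_event_tail by auto
    qed auto
    then have "(\<Inter>m. \<Union>j\<in>{max m n..}. ?B j) \<in> sigma_sets (space M) (\<Union> (site_events ` {n..}))"
      by (intro S.countable_INT) auto
    also have "(\<Inter>m. \<Union>j\<in>{max m n..}. ?B j) = ?L"
    proof (intro equalityI INT_greatest)
      fix k
      show "(\<Inter>m. \<Union>j\<in>{max m n..}. ?B j) \<subseteq> (\<Union>j\<in>{k..}. ?B j)"
        by (rule order_trans[OF INT_lower[of k]]) auto
      show "?L \<subseteq> (\<Union>j\<in>{max k n..}. ?B j)"
        by (rule INT_lower) simp
    qed
    finally show "?L \<in> sigma_sets (space M) (\<Union> (site_events ` {n..}))" .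
  qed
  have "prob ?L = 0 \<or> prob ?L = 1"
  proof (rule kolmogorov_0_1_law[OF _ indep_site_events tail])
    fix i
    show "sigma_algebra (space M) (site_events i)"
      unfolding site_events_def by (rule sigma_algebra_sigma_sets) auto
  qed
  moreover have "\<delta> \<le> prob ?L"
  proof -
    have "(\<lambda>n. prob (\<Union>j\<in>{n..}. ?B j)) \<longlonglongrightarrow> prob ?L"
    proof (rule finite_Lim_measure_decseq)
      show "range (\<lambda>n. \<Union>j\<in>{n..}. ?B j) \<subseteq> sets M" using U by auto
      show "decseq (\<lambda>n. \<Union>j\<in>{n..}. ?B j)" 
        unfolding decseq_def by (intro allI impI UN_mono) auto
    qed
    moreover have "\<delta> \<le> prob (\<Union>j\<in>{n..}. ?B j)" for n
      using \<delta>(2)[of n] finite_measure_mono[OF _ U[of n], of "?B n"] by force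
    ultimately show ?thesis
      by (intro LIMSEQ_le_const) auto
  qed
  ultimately have "prob ?L = 1" using \<delta>(1) by auto
  then have "AE w in M. w \<in> ?L"
    by (rule prob_eq_1[OF L, THEN iffD1])
  then show ?thesis
  proof eventually_elim
    case (elim w)
    show ?case
    proof
      fix x :: int
      obtain j where "Suc (nat (- x)) \<le> j" "w \<in> ?B j"
        using elim by auto
      then show "\<exists>y<x. barrier (\<lambda>c p k. gap c p k w) (\<lambda>x. eta0 x w) T y"
        by (intro exI[of _ "- int j"]) (auto simp: barrier_event_def)
    qed
  qed
qed

lemma AE_tame:
  fixes mu :: real
  assumes mean: "(\<integral>\<^sup>+w. ennreal (real (eta0 0 w)) \<partial>M) = ennreal mu" and mu: "0 \<le> mu"
  shows "AE w in M. tame lam (\<lambda>c p k. gap c p k w) (\<lambda>x. eta0 x w)"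
proof -
  have "AE w in M. \<forall>T :: nat. \<forall>x. \<exists>y<x. barrier (\<lambda>c p k. gap c p k w) (\<lambda>x. eta0 x w) (real T) y"
    by (rule AE_all_countable[THEN iffD2], intro allI AE_barriers[OF mean mu]) simp
  with AE_regular show ?thesis
    by eventually_elim (simp add: tame_def)
qed

end

section \<open>Fixation and the flux\<close>

lemma rings_cong:
  assumes "\<And>i. i \<in> I \<Longrightarrow> g i = h i"
  shows "rings m I g t = rings m I h t"
proof (cases m)
  case (Suc m')
  have f: "first I g a \<longleftrightarrow> first I h a" for a
    using assms by (auto simp: first_def)
  show ?thesis
  proof (cases "\<exists>a. first I g a")
    case True
    then obtain a where a: "first I g a" by blast
    then have aI: "a \<in> I" and ah: "first I h a" using f by (auto simp: first_def)
    have "advance I a g = advance I a h"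
      using assms aI by (auto simp: advance_def restrict_def)
    then show ?thesis
      unfolding Suc rings_Suc_first[OF a] rings_Suc_first[OF ah] using assms[OF aI] by simp
  next
    case False
    then show ?thesis
      unfolding Suc using f by simp
  qed
qed simp

text \<open>The outflow mean before anything is revealed, as a function of a list of occupation
  numbers. Lists of naturals form a countable type, which keeps measurability simple.\<close>

primrec list_mean :: "(nat \<Rightarrow> real) \<Rightarrow> real \<Rightarrow> nat list \<Rightarrow> nat \<Rightarrow> real" where
  "list_mean f r [] k = f k"
| "list_mean f r (e # es) k = (1 - r) * list_mean f r es (k + e) + r * list_mean f r es (k + e - 1)"

text \<open>When no particle is at the site, truncated subtraction makes both branches equal, so the
  case distinction disappears. For \<open>lam = \<infinity>\<close> the density is 1, and the preset
  sleeps have just the weight that unrevealed bits would have.\<close>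

lemma outflow_mean_blank:
  "outflow_mean f (critical_density lam) eta (\<lambda>_ _. blank lam) ys k
     = list_mean f (critical_density lam) (map eta ys) k"
proof -
  have "outflow_mean f r eta (\<lambda>_ _. b) ys k = list_mean f r (map eta ys) k"
    if "b = None \<or> b = Some True \<and> r = 1" for b r
  proof (induction ys arbitrary: k)
    case (Cons y ys)
    with that show ?case
      by (elim disjE; cases "k + eta y = 0") (simp_all add: algebra_simps)
  qed simp
  then show ?thesis
    by (simp add: blank_def critical_density_def)
qed

lemma list_mean_bounds:
  assumes "\<And>k. 0 \<le> f k \<and> f k \<le> 1" "0 \<le> r" "r \<le> 1"
  shows "0 \<le> list_mean f r es k \<and> list_mean f r es k \<le> 1"
proof (induction es arbitrary: k)
  case (Cons e es)
  have "0 \<le> (1 - r) * list_mean f r es (k + e) + r * list_mean f r es (k + e - 1)"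
    using Cons assms by (intro add_nonneg_nonneg mult_nonneg_nonneg) auto
  moreover have "(1 - r) * list_mean f r es (k + e) + r * list_mean f r es (k + e - 1) \<le> (1 - r) * 1 + r * 1"
    using Cons assms by (intro add_mono mult_left_mono) auto
  ultimately show ?case by simp
qed (use assms in simp)

lemma measurable_map_list:
  assumes "\<And>y. y \<in> set ys \<Longrightarrow> g y \<in> N \<rightarrow>\<^sub>M count_space (UNIV :: nat set)"
  shows "(\<lambda>w. map (\<lambda>y. g y w) ys) \<in> N \<rightarrow>\<^sub>M count_space UNIV"
  using assms
proof (induction ys)
  case (Cons y ys)
  have "(\<lambda>w. (g y w, map (\<lambda>y. g y w) ys)) \<in> N \<rightarrow>\<^sub>M count_space UNIV \<Otimes>\<^sub>M count_space UNIV"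
    using Cons by (intro measurable_Pair) auto
  then have "(\<lambda>w. (g y w, map (\<lambda>y. g y w) ys)) \<in> N \<rightarrow>\<^sub>M count_space (UNIV \<times> UNIV)"
    by (simp only: pair_measure_countable[OF countableI_type countableI_type])
  from measurable_compose[OF this, of "\<lambda>(x, xs). x # xs" "count_space UNIV"] show ?case
    by simp
qed simp

lemma measurable_nat_floor: "(\<lambda>x :: real. nat \<lfloor>x\<rfloor>) \<in> borel \<rightarrow>\<^sub>M count_space UNIV"
  by (rule measurable_compose[OF measurable_real_floor]) simp

lemma nn_integral_distr':
  assumes T: "T \<in> M \<rightarrow>\<^sub>M M'" and f: "f \<in> borel_measurable M'"
  shows "(\<integral>\<^sup>+y. f y \<partial>distr M M' T) = (\<integral>\<^sup>+w. f (T w) \<partial>M)"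
proof (rule nn_integral_distr[OF T])
  show "f \<in> borel_measurable (distr M M' T)" using f by (simp only: measurable_distr_eq1)
qed

section \<open>Conditioning on discrete data and limits of events\<close>

context prob_space
begin

lemma nn_integral_indep_var:
  assumes ind: "indep_var S X T Y" and F: "F \<in> borel_measurable (S \<Otimes>\<^sub>M T)"
  shows "(\<integral>\<^sup>+w. F (X w, Y w) \<partial>M) = (\<integral>\<^sup>+w. \<integral>\<^sup>+w'. F (X w, Y w') \<partial>M \<partial>M)"
proof -
  have X: "X \<in> M \<rightarrow>\<^sub>M S" and Y: "Y \<in> M \<rightarrow>\<^sub>M T"
    by (rule indep_var_rv1[OF ind], rule indep_var_rv2[OF ind])
  interpret DY: prob_space "distr M T Y" by (rule prob_space_distr[OF Y])
  have eq: "distr M S X \<Otimes>\<^sub>M distr M T Y = distr M (S \<Otimes>\<^sub>M T) (\<lambda>w. (X w, Y w))"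
    using indep_var_distribution_eq[THEN iffD1, OF ind] by blast
  have F': "F \<in> borel_measurable (S \<Otimes>\<^sub>M distr M T Y)"
    using F measurable_cong_sets[OF sets_pair_measure_cong[OF refl sets_distr] refl] by blast
  have F'': "F \<in> borel_measurable (distr M S X \<Otimes>\<^sub>M distr M T Y)"
    using F measurable_cong_sets[OF sets_pair_measure_cong[OF sets_distr sets_distr] refl] by blast
  have "(\<integral>\<^sup>+w. F (X w, Y w) \<partial>M) = (\<integral>\<^sup>+z. F z \<partial>distr M (S \<Otimes>\<^sub>M T) (\<lambda>w. (X w, Y w)))"
    by (rule nn_integral_distr'[OF measurable_Pair[OF X Y] F, symmetric])
  also have "\<dots> = (\<integral>\<^sup>+x. \<integral>\<^sup>+y. F (x, y) \<partial>distr M T Y \<partial>distr M S X)"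
    unfolding eq[symmetric] by (rule DY.nn_integral_fst[OF F'', symmetric])
  also have "\<dots> = (\<integral>\<^sup>+w. \<integral>\<^sup>+y. F (X w, y) \<partial>distr M T Y \<partial>M)"
    by (rule nn_integral_distr'[OF X DY.borel_measurable_nn_integral_fst[OF F']])
  also have "\<dots> = (\<integral>\<^sup>+w. \<integral>\<^sup>+w'. F (X w, Y w') \<partial>M \<partial>M)"
  proof (rule nn_integral_cong)
    fix w assume "w \<in> space M"
    then have "X w \<in> space S" using measurable_space[OF X] by blast
    from measurable_compose[OF measurable_Pair1'[OF this] F]
    have "(\<lambda>y. F (X w, y)) \<in> borel_measurable T" .
    from nn_integral_distr'[OF Y this]
    show "(\<integral>\<^sup>+y. F (X w, y) \<partial>distr M T Y) = (\<integral>\<^sup>+w'. F (X w, Y w') \<partial>M)" .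
  qed
  finally show ?thesis .
qed

lemma nn_integral_indep_var_compose:
  assumes ind: "indep_var S X T Y" and f: "f \<in> S \<rightarrow>\<^sub>M S'" and g: "g \<in> T \<rightarrow>\<^sub>M T'"
    and F: "F \<in> borel_measurable (S' \<Otimes>\<^sub>M T')"
  shows "(\<integral>\<^sup>+w. F (f (X w), g (Y w)) \<partial>M) = (\<integral>\<^sup>+w. \<integral>\<^sup>+w'. F (f (X w), g (Y w')) \<partial>M \<partial>M)"
proof -
  have "(\<lambda>z. (f (fst z), g (snd z))) \<in> S \<Otimes>\<^sub>M T \<rightarrow>\<^sub>M S' \<Otimes>\<^sub>M T'"
    by (rule measurable_Pair[OF measurable_compose[OF measurable_fst f] measurable_compose[OF measurable_snd g]])
  from nn_integral_indep_var[OF ind measurable_compose[OF this F]] show ?thesis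
    by (simp only: fst_conv snd_conv)
qed

text \<open>Conditioning on a countable random variable by summation over its values. It is made for
  the initial configuration in a box: once its value is fixed, the particles and hence the index set
  of the clocks are deterministic.\<close>

lemma emeasure_le_by_values:
  fixes H :: "'a \<Rightarrow> 'c :: countable"
  assumes H: "H \<in> M \<rightarrow>\<^sub>M count_space UNIV" and E: "E \<subseteq> space M"
    and Es: "\<And>e. E \<inter> {w \<in> space M. H w = e} \<in> sets M"
    and f: "f \<in> borel_measurable M"
    and le: "\<And>e. emeasure M (E \<inter> {w \<in> space M. H w = e}) \<le> (\<integral>\<^sup>+w. f w * indicator {w \<in> space M. H w = e} w \<partial>M)"
  shows "E \<in> sets M" and "emeasure M E \<le> (\<integral>\<^sup>+w. f w \<partial>M)"
proof -
  let ?P = "\<lambda>i. {w \<in> space M. to_nat (H w) = i}"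
  have Pe: "?P i = {} \<or> (\<exists>e. ?P i = {w \<in> space M. H w = e})" for i
  proof (cases "\<exists>e. to_nat (e :: 'c) = i")
    case True
    then obtain e :: 'c where "to_nat e = i" by blast
    then have "?P i = {w \<in> space M. H w = e}" by auto
    then show ?thesis by blast
  qed auto
  have EP: "E = (\<Union>i. E \<inter> ?P i)" using E by auto
  have Ps: "?P i \<in> sets M" for i
  proof -
    have "?P i = H -` {e. to_nat e = i} \<inter> space M" by auto
    then show ?thesis using measurable_sets[OF H, of "{e. to_nat e = i}"] by simp
  qed
  have EPs: "E \<inter> ?P i \<in> sets M" for i
    using Pe[of i]
  proof (elim disjE exE)
    fix e assume "?P i = {w \<in> space M. H w = e}"
    with Es[of e] show ?thesis by (simp only:)
  next
    assume "?P i = {}"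
    then show ?thesis by (simp only: Int_empty_right sets.empty_sets)
  qed
  show "E \<in> sets M"
    by (subst EP, rule sets.countable_UN) (use EPs in blast)
  have "emeasure M E = (\<Sum>i. emeasure M (E \<inter> ?P i))"
  proof -
    have "(\<Sum>i. emeasure M (E \<inter> ?P i)) = emeasure M (\<Union>i. E \<inter> ?P i)"
      by (rule suminf_emeasure) (use EPs in \<open>auto simp: disjoint_family_on_def\<close>)
    with EP show ?thesis by (simp only:)
  qed
  also have "\<dots> \<le> (\<Sum>i. \<integral>\<^sup>+w. f w * indicator (?P i) w \<partial>M)"
  proof (intro suminf_le summableI)
    fix i
    show "emeasure M (E \<inter> ?P i) \<le> (\<integral>\<^sup>+w. f w * indicator (?P i) w \<partial>M)"
      using Pe[of i]
    proof (elim disjE exE)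
      fix e assume "?P i = {w \<in> space M. H w = e}"
      with le[of e] show ?thesis by (simp only:)
    qed (simp only: Int_empty_right emeasure_empty zero_le)
  qed
  also have "\<dots> = (\<integral>\<^sup>+w. (\<Sum>i. f w * indicator (?P i) w) \<partial>M)"
    by (rule nn_integral_suminf[symmetric])
      (rule borel_measurable_times_ennreal[OF f borel_measurable_indicator[OF Ps]])
  also have "\<dots> = (\<integral>\<^sup>+w. f w \<partial>M)"
  proof (rule nn_integral_cong)
    fix w assume w: "w \<in> space M"
    have "(\<Sum>i. f w * indicator (?P i) w) = (\<Sum>i. if i = to_nat (H w) then f w else 0)"
      using w by (intro suminf_cong) (simp add: indicator_def)
    also have "\<dots> = f w"
      by (subst suminf_finite[of "{to_nat (H w)}"]) auto
    finally show "(\<Sum>i. f w * indicator (?P i) w) = f w" .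
  qed
  finally show "emeasure M E \<le> (\<integral>\<^sup>+w. f w \<partial>M)" .
qed

text \<open>Fatou's inequality for events, used once for each of the limits in \<open>m\<close>,
  \<open>n\<close> and \<open>T\<close>. The threshold \<open>N\<close> is there because the
  estimates hold once the box contains the window.\<close>

lemma emeasure_eventually_le:
  assumes "\<And>n. N \<le> n \<Longrightarrow> {w \<in> space M. P n w} \<in> sets M \<and> emeasure M {w \<in> space M. P n w} \<le> c"
  shows "{w \<in> space M. \<forall>\<^sub>F n in sequentially. P n w} \<in> sets M \<and>
    emeasure M {w \<in> space M. \<forall>\<^sub>F n in sequentially. P n w} \<le> c"
proof -
  define X where "X n = {w \<in> space M. P n w}" for n
  have X: "\<And>n. N \<le> n \<Longrightarrow> X n \<in> sets M" and le: "\<And>n. N \<le> n \<Longrightarrow> emeasure M (X n) \<le> c"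
    using assms by (auto simp: X_def)
  let ?Y = "\<lambda>k. \<Inter>n\<in>{N + k..}. X n"
  have eq: "{w \<in> space M. \<forall>\<^sub>F n in sequentially. P n w} = (\<Union>k. ?Y k)"
  proof (intro set_eqI iffI)
    fix w assume "w \<in> {w \<in> space M. \<forall>\<^sub>F n in sequentially. P n w}"
    then obtain k where "\<And>n. k \<le> n \<Longrightarrow> w \<in> X n" by (auto simp: eventually_sequentially X_def)
    then have "w \<in> ?Y k" by simp
    then show "w \<in> (\<Union>k. ?Y k)" by blast
  next
    fix w assume "w \<in> (\<Union>k. ?Y k)"
    then obtain k where k: "\<And>n. N + k \<le> n \<Longrightarrow> w \<in> X n" by auto
    have "w \<in> space M" using k[of "N + k"] sets.sets_into_space[OF X[of "N + k"]] by auto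
    with k show "w \<in> {w \<in> space M. \<forall>\<^sub>F n in sequentially. P n w}"
      by (auto simp: eventually_sequentially X_def)
  qed
  have Y: "?Y k \<in> sets M" for k
    by (rule sets.countable_INT') (auto intro: X)
  have "{w \<in> space M. \<forall>\<^sub>F n in sequentially. P n w} \<in> sets M"
    unfolding eq by (rule sets.countable_UN) (use Y in blast)
  moreover have "(\<lambda>k. emeasure M (?Y k)) \<longlonglongrightarrow> emeasure M (\<Union>k. ?Y k)"
  proof (rule Lim_emeasure_incseq)
    show "range ?Y \<subseteq> sets M" using Y by blast
    show "incseq ?Y"
      unfolding incseq_def by (intro allI impI INT_anti_mono) auto
  qed
  moreover have "emeasure M (?Y k) \<le> c" for k
  proof -
    have "emeasure M (?Y k) \<le> emeasure M (X (N + k))"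
      by (rule emeasure_mono[OF INT_lower]) (use X in auto)
    also have "\<dots> \<le> c" by (rule le) simp
    finally show ?thesis .
  qed
  ultimately show ?thesis
    unfolding eq by (intro conjI LIMSEQ_le_const2) auto
qed

end

context arw_model
begin

section \<open>Occupation numbers and clocks as independent data\<close>

abbreviation "gaps w \<equiv> \<lambda>c p k. gap c p k w"
abbreviation "etas w \<equiv> \<lambda>x. eta0 x w"
abbreviation "rho \<equiv> critical_density lam"

lemma rho: "0 < rho" "rho \<le> 1"
  using lam_pos by (cases lam; simp add: critical_density_def)+

definition eta_law :: "nat pmf" where
  "eta_law = Abs_pmf (distr M (count_space UNIV) (eta0 0))"

lemma measure_eta_law: "measure_pmf eta_law = distr M (count_space UNIV) (eta0 x)"
proof -
  interpret D: prob_space "distr M (count_space UNIV) (eta0 0)"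
    by (rule prob_space_distr[OF measurable_eta0])
  have "AE x in distr M (count_space UNIV) (eta0 0). measure (distr M (count_space UNIV) (eta0 0)) {x} \<noteq> 0"
    by (subst D.AE_support_countable) (auto intro!: exI[of _ UNIV])
  then show ?thesis
    unfolding eta_law_def ident[of x]
    by (subst Abs_pmf_inverse) (auto intro: D.prob_space_axioms)
qed

lemma nn_integral_eta_law: "(\<integral>\<^sup>+e. f e \<partial>eta_law) = (\<integral>\<^sup>+w. f (eta0 x w) \<partial>M)"
  unfolding measure_eta_law[of x] by (rule nn_integral_distr'[OF measurable_eta0]) simp

lemma measurable_eta_list: "(\<lambda>w. map (etas w) ys) \<in> M \<rightarrow>\<^sub>M count_space UNIV"
  by (rule measurable_map_list) (rule measurable_eta0)

lemma measurable_Init_nat: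
  assumes "Init y \<in> S"
  shows "(\<lambda>f. nat \<lfloor>(f (Init y) :: real)\<rfloor>) \<in> PiM S (\<lambda>_. borel) \<rightarrow>\<^sub>M count_space UNIV"
proof -
  have "(\<lambda>f. f (Init y) :: real) \<in> PiM S (\<lambda>_. borel) \<rightarrow>\<^sub>M borel"
    by (rule measurable_component_singleton[OF assms])
  from measurable_compose[OF this measurable_nat_floor] show ?thesis .
qed

lemma nn_integral_eta_list:
  fixes F :: "nat \<times> nat list \<Rightarrow> ennreal"
  assumes "y \<notin> set ys"
  shows "(\<integral>\<^sup>+w. F (eta0 y w, map (etas w) ys) \<partial>M) = (\<integral>\<^sup>+w. \<integral>\<^sup>+w'. F (eta0 y w, map (etas w') ys) \<partial>M \<partial>M)"
proof -
  have ind: "indep_var (PiM {Init y} (\<lambda>_. borel)) (\<lambda>w. restrict (\<lambda>i. V i w) {Init y})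
      (PiM (Init ` set ys) (\<lambda>_. borel)) (\<lambda>w. restrict (\<lambda>i. V i w) (Init ` set ys))"
    using assms by (intro indep_var_restrict[OF indep_V]) auto
  have f: "(\<lambda>f :: source \<Rightarrow> real. nat \<lfloor>f (Init y)\<rfloor>) \<in> PiM {Init y} (\<lambda>_. borel) \<rightarrow>\<^sub>M count_space UNIV"
    by (rule measurable_Init_nat) simp
  have g: "(\<lambda>f :: source \<Rightarrow> real. map (\<lambda>y. nat \<lfloor>f (Init y)\<rfloor>) ys) \<in> PiM (Init ` set ys) (\<lambda>_. borel) \<rightarrow>\<^sub>M count_space UNIV"
    by (rule measurable_map_list, rule measurable_Init_nat) simp
  have F: "F \<in> borel_measurable (count_space UNIV \<Otimes>\<^sub>M count_space UNIV)"
    by (simp add: pair_measure_countable)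
  have e: "map (\<lambda>y. nat \<lfloor>restrict (\<lambda>i. V i w) (Init ` set ys) (Init y)\<rfloor>) ys = map (etas w) ys" for w
    by simp
  have e': "nat \<lfloor>restrict (\<lambda>i. V i w) {Init y} (Init y)\<rfloor> = eta0 y w" for w
    by simp
  show ?thesis
    using nn_integral_indep_var_compose[OF ind f g F] unfolding e e' by (simp only:)
qed

sublocale W: reflected_walk eta_law rho
  by standard (rule rho)+

text \<open>Every site of the window performs one step of the walk. Independence separates the first
  occupation number from the others, and the identical distribution turns it into a draw from
  \<open>eta_law\<close>.\<close>

lemma nn_integral_list_mean:
  assumes "distinct ys"
  shows "(\<integral>\<^sup>+w. ennreal (list_mean (\<lambda>k. if K \<le> k then 1 else 0) rho (map (etas w) ys) k) \<partial>M)
    = ennreal (W.above (length ys) k K)"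
  using assms
proof (induction ys arbitrary: k)
  case Nil
  then show ?case by (simp add: W.above_0 emeasure_space_1)
next
  case (Cons y ys)
  let ?f = "\<lambda>k. if K \<le> k then 1 else 0 :: real"
  let ?l = "list_mean ?f rho"
  have b: "0 \<le> ?l es k" for es k
    using list_mean_bounds[of ?f rho es k] rho by auto
  define F where "F z = ennreal (?l (fst z # snd z) k)" for z
  have "(\<integral>\<^sup>+w. F (eta0 y w, map (etas w) ys) \<partial>M) = (\<integral>\<^sup>+w. \<integral>\<^sup>+w'. F (eta0 y w, map (etas w') ys) \<partial>M \<partial>M)"
    by (rule nn_integral_eta_list) (use Cons.prems in simp)
  also have "\<dots> = (\<integral>\<^sup>+e. \<integral>\<^sup>+w'. F (e, map (etas w') ys) \<partial>M \<partial>eta_law)"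
    by (rule nn_integral_eta_law[symmetric])
  also have "\<dots> = (\<integral>\<^sup>+e. ennreal ((1 - rho) * W.above (length ys) (k + e) K
      + rho * W.above (length ys) (k + e - 1) K) \<partial>eta_law)"
  proof (rule nn_integral_cong)
    fix e
    have m: "(\<lambda>w. ennreal c * ennreal (?l (map (etas w) ys) j)) \<in> borel_measurable M" for c j
      by (rule measurable_compose[OF measurable_eta_list]) simp
    have m': "(\<lambda>w. ennreal (?l (map (etas w) ys) j)) \<in> borel_measurable M" for j
      by (rule measurable_compose[OF measurable_eta_list]) simp
    have "(\<integral>\<^sup>+w'. F (e, map (etas w') ys) \<partial>M)
        = (\<integral>\<^sup>+w'. ennreal (1 - rho) * ennreal (?l (map (etas w') ys) (k + e))
            + ennreal rho * ennreal (?l (map (etas w') ys) (k + e - 1)) \<partial>M)"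
      using b rho by (intro nn_integral_cong) (simp add: F_def ennreal_plus ennreal_mult)
    also have "\<dots> = ennreal (1 - rho) * ennreal (W.above (length ys) (k + e) K)
        + ennreal rho * ennreal (W.above (length ys) (k + e - 1) K)"
      using Cons by (simp only: nn_integral_add[OF m m] nn_integral_cmult[OF m'] distinct.simps simp_thms)
    also have "\<dots> = ennreal ((1 - rho) * W.above (length ys) (k + e) K + rho * W.above (length ys) (k + e - 1) K)"
      using rho W.above_bounds by (simp add: ennreal_plus ennreal_mult)
    finally show "(\<integral>\<^sup>+w'. F (e, map (etas w') ys) \<partial>M)
      = ennreal ((1 - rho) * W.above (length ys) (k + e) K + rho * W.above (length ys) (k + e - 1) K)" .
  qed
  also have "\<dots> = ennreal (W.above (Suc (length ys)) k K)"
    by (rule W.above_Suc[symmetric])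
  finally show ?case
    by (simp only: F_def fst_conv snd_conv list.map length_Cons)
qed

definition clock_vec :: "particle set \<Rightarrow> 'w \<Rightarrow> clock \<times> particle \<Rightarrow> nat \<Rightarrow> real" where
  "clock_vec A w = (\<lambda>i\<in>clocks lam \<times> A. \<lambda>k. gap (fst i) (snd i) k w)"

lemma distr_gap_seq:
  assumes c: "c \<in> clocks lam"
  shows "distr M (PiM UNIV (\<lambda>_. borel)) (\<lambda>w k. gap c p k w) = exp_seq (clock_rate lam c)"
proof -
  have "indep_vars (\<lambda>k. PiM {Gap c p k} (\<lambda>_. borel)) (\<lambda>k w. restrict (\<lambda>s. V s w) {Gap c p k}) UNIV"
    using c by (intro indep_vars_restrict[OF indep_V]) (auto simp: disjoint_family_on_def)
  from indep_vars_compose2[OF this, of "\<lambda>k f. f (Gap c p k)" "\<lambda>_. borel"]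
  have "indep_vars (\<lambda>_. borel) (\<lambda>k w. gap c p k w) UNIV"
    by simp
  from indep_vars_iff_distr_eq_PiM[THEN iffD1, OF UNIV_not_empty measurable_gap[OF c] this]
  have "distr M (PiM UNIV (\<lambda>_. borel)) (\<lambda>w. \<lambda>k\<in>UNIV. gap c p k w) = PiM UNIV (\<lambda>k. distr M borel (gap c p k))" .
  then show ?thesis
    by (simp only: exp_seq_def distr_gap[OF c] restrict_UNIV)
qed

lemma measurable_gap_seq:
  assumes "c \<in> clocks lam"
  shows "(\<lambda>w k. gap c p k w) \<in> M \<rightarrow>\<^sub>M PiM UNIV (\<lambda>_. borel)"
  by (rule measurable_PiM_single'[OF measurable_gap[OF assms]], intro Pi_I PiE_I) simp_all

lemma distr_clock_vec:
  assumes "clocks lam \<times> A \<noteq> {}"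
  shows "distr M (clock_space (clocks lam \<times> A)) (clock_vec A) = clock_law (\<lambda>i. clock_rate lam (fst i)) (clocks lam \<times> A)"
proof -
  let ?I = "clocks lam \<times> A"
  let ?K = "\<lambda>i. {Gap (fst i) (snd i) k | k. True}"
  have "indep_vars (\<lambda>i. PiM (?K i) (\<lambda>_. borel)) (\<lambda>i w. restrict (\<lambda>s. V s w) (?K i)) ?I"
    by (rule indep_vars_restrict[OF indep_V]) (auto simp: disjoint_family_on_def)
  from indep_vars_compose2[OF this, of "\<lambda>i f k. f (Gap (fst i) (snd i) k)" "\<lambda>_. PiM UNIV (\<lambda>_. borel)"]
  have "indep_vars (\<lambda>_. PiM UNIV (\<lambda>_. borel)) (\<lambda>i w k. restrict (\<lambda>s. V s w) (?K i) (Gap (fst i) (snd i) k)) ?I"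
  proof -
    have "(\<lambda>f k. f (Gap (fst i) (snd i) k)) \<in> PiM (?K i) (\<lambda>_. borel) \<rightarrow>\<^sub>M PiM UNIV (\<lambda>_. borel :: real measure)"
      for i :: "clock \<times> particle"
    proof (rule measurable_PiM_single')
      fix k
      show "(\<lambda>f. f (Gap (fst i) (snd i) k)) \<in> PiM (?K i) (\<lambda>_. borel) \<rightarrow>\<^sub>M (borel :: real measure)"
        by (rule measurable_component_singleton) blast
    qed (intro Pi_I PiE_I, simp_all)
    then show "indep_vars (\<lambda>_. PiM UNIV (\<lambda>_. borel)) (\<lambda>i w k. restrict (\<lambda>s. V s w) (?K i) (Gap (fst i) (snd i) k)) ?I"
      by (rule indep_vars_compose2[OF \<open>indep_vars (\<lambda>i. PiM (?K i) (\<lambda>_. borel)) (\<lambda>i w. restrict (\<lambda>s. V s w) (?K i)) ?I\<close>])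
  qed
  moreover have "(\<lambda>i w k. restrict (\<lambda>s. V s w) (?K i) (Gap (fst i) (snd i) k)) = (\<lambda>i w k. gap (fst i) (snd i) k w)"
    by (intro ext) (simp only: restrict_apply V_simps, auto)
  ultimately have "indep_vars (\<lambda>_. PiM UNIV (\<lambda>_. borel)) (\<lambda>i w k. gap (fst i) (snd i) k w) ?I"
    by (simp only:)
  moreover have "(\<lambda>w k. gap (fst i) (snd i) k w) \<in> M \<rightarrow>\<^sub>M PiM UNIV (\<lambda>_. borel)" if "i \<in> ?I" for i
    by (rule measurable_gap_seq) (use that in \<open>simp only: mem_Times_iff\<close>)
  ultimately have "distr M (clock_space ?I) (\<lambda>w. \<lambda>i\<in>?I. \<lambda>k. gap (fst i) (snd i) k w)
      = PiM ?I (\<lambda>i. distr M (PiM UNIV (\<lambda>_. borel)) (\<lambda>w k. gap (fst i) (snd i) k w))"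
    by (rule indep_vars_iff_distr_eq_PiM'[THEN iffD1, OF assms, rotated])
  also have "\<dots> = PiM ?I (\<lambda>i. exp_seq (clock_rate lam (fst i)))"
    by (rule PiM_cong[OF refl], rule distr_gap_seq) (simp only: mem_Times_iff)
  finally show ?thesis
    by (simp only: clock_vec_def[abs_def] clock_law_def)
qed

lemma nn_integral_eta_clock:
  fixes F :: "nat list \<times> (clock \<times> particle \<Rightarrow> nat \<Rightarrow> real) \<Rightarrow> ennreal"
  assumes F: "F \<in> borel_measurable (count_space UNIV \<Otimes>\<^sub>M clock_space (clocks lam \<times> A))"
  shows "(\<integral>\<^sup>+w. F (map (etas w) ys, clock_vec A w) \<partial>M)
    = (\<integral>\<^sup>+w. \<integral>\<^sup>+w'. F (map (etas w) ys, clock_vec A w') \<partial>M \<partial>M)"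
proof -
  let ?G = "{Gap c p k | c p k. c \<in> clocks lam}" and ?I = "clocks lam \<times> A"
  let ?\<phi> = "\<lambda>f :: source \<Rightarrow> real. map (\<lambda>y. nat \<lfloor>f (Init y)\<rfloor>) ys" and ?\<psi> = "\<lambda>f :: source \<Rightarrow> real. \<lambda>i\<in>?I. \<lambda>k. f (Gap (fst i) (snd i) k)"
  have ind: "indep_var (PiM (Init ` set ys) (\<lambda>_. borel)) (\<lambda>w. restrict (\<lambda>i. V i w) (Init ` set ys))
      (PiM ?G (\<lambda>_. borel)) (\<lambda>w. restrict (\<lambda>i. V i w) ?G)"
    by (rule indep_var_restrict[OF indep_V]) auto
  have \<phi>: "?\<phi> \<in> PiM (Init ` set ys) (\<lambda>_. borel) \<rightarrow>\<^sub>M count_space UNIV"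
    by (rule measurable_map_list, rule measurable_Init_nat) simp
  have \<psi>: "?\<psi> \<in> PiM ?G (\<lambda>_. borel) \<rightarrow>\<^sub>M clock_space ?I"
  proof (rule measurable_clock_spaceI)
    fix i k assume i: "i \<in> ?I"
    then have "Gap (fst i) (snd i) k \<in> ?G" by auto
    from measurable_component_singleton[OF this, of "\<lambda>_. borel :: real measure"] i
    show "(\<lambda>f. ?\<psi> f i k) \<in> borel_measurable (PiM ?G (\<lambda>_. borel))"
      by (simp only: restrict_apply' if_True)
  qed simp
  have e: "?\<phi> (restrict (\<lambda>i. V i w) (Init ` set ys)) = map (etas w) ys" for w
    by simp
  have e': "?\<psi> (restrict (\<lambda>i. V i w) ?G) = clock_vec A w" for w
    unfolding clock_vec_def by (intro restrict_ext ext) (auto simp: restrict_def)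
  show ?thesis
    using nn_integral_indep_var_compose[OF ind \<phi> \<psi> F] unfolding e e' by (simp only:)
qed

end

lemma card_particles_within:
  assumes "y \<in> {- int n..int n}"
  shows "card {p \<in> particles_within n eta. fst p = y} = eta y"
proof -
  have "{p \<in> particles_within n eta. fst p = y} = {y} \<times> {..<eta y}"
    using assms by (auto simp: particles_within_def)
  then show ?thesis by simp
qed

lemma particles_within_cong:
  "(\<And>x. x \<in> {- int n..int n} \<Longrightarrow> eta x = eta' x) \<Longrightarrow> particles_within n eta = particles_within n eta'"
  by (auto simp: particles_within_def)

lemma rings_empty: "rings m {} g t = []"
  using set_rings[of m "{}" g t] by simp

context prob_space
begin

lemma AE_not_all_if_emeasure_tendsto_0:
  assumes P: "\<And>j. {w \<in> space M. P j w} \<in> sets M \<and> emeasure M {w \<in> space M. P j w} \<le> ennreal (a j)"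
    and a: "a \<longlonglongrightarrow> 0"
  shows "AE w in M. \<exists>j :: nat. \<not> P j w"
proof -
  let ?N = "\<Inter>j. {w \<in> space M. P j w}"
  have N: "?N \<in> sets M"
    by (rule sets.countable_INT') (use P in auto)
  have "emeasure M ?N \<le> ennreal (a j)" for j
  proof -
    have "emeasure M ?N \<le> emeasure M {w \<in> space M. P j w}"
      by (rule emeasure_mono) (use P in auto)
    with P[of j] show ?thesis by (blast intro: order_trans)
  qed
  then have "emeasure M ?N \<le> ennreal 0"
    by (intro LIMSEQ_le_const[OF tendsto_ennrealI[OF a]]) blast
  then have 0: "emeasure M ?N = 0" by simp
  show ?thesis
    by (rule AE_I[OF _ 0 N]) blast
qed

end

context arw_model
begin

section \<open>Martingale bounds for events of the approximations\<close>

lemma measurable_clock_vec: "clock_vec A \<in> M \<rightarrow>\<^sub>M clock_space (clocks lam \<times> A)"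
proof (rule measurable_clock_spaceI)
  fix i k assume i: "i \<in> clocks lam \<times> A"
  then have "gap (fst i) (snd i) k \<in> borel_measurable M"
    by (intro measurable_gap) auto
  with i show "(\<lambda>w. clock_vec A w i k) \<in> borel_measurable M"
    by (simp only: clock_vec_def restrict_apply if_True)
qed (simp add: clock_vec_def)

text \<open>Markov's inequality for the martingale: \<open>Hf\<close> is at least 1 when
  \<open>\<Psi>\<close> holds at the end and keeps its mean, so its initial value bounds the
  probability.\<close>

lemma nn_integral_rings_le:
  fixes \<Psi> :: "system \<Rightarrow> bool" and Hf :: "(int \<Rightarrow> nat \<Rightarrow> bool option) \<Rightarrow> real"
  assumes A: "finite A" and nonneg: "\<And>D. 0 \<le> Hf D"
    and bound: "\<And>s D. consistent lam A s D \<Longrightarrow> \<Psi> s \<Longrightarrow> 1 \<le> Hf D"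
    and harmonic: "\<And>s D. consistent lam A s D \<Longrightarrow>
      (\<Sum>i\<in>clocks lam \<times> A. clock_rate lam (fst i) * Hf (reveal A i s D))
        = (\<Sum>i\<in>clocks lam \<times> A. clock_rate lam (fst i)) * Hf D"
  shows "(\<integral>\<^sup>+w. (if \<Psi> (reach lam A (rings m (clocks lam \<times> A) (clock_vec A w) t)) then 1 else 0) \<partial>M)
    \<le> ennreal (Hf (\<lambda>_ _. blank lam))"
proof -
  let ?I = "clocks lam \<times> A" and ?D = "\<lambda>_ _. blank lam"
  let ?q = "\<lambda>l. if \<Psi> (reach lam A l) then 1 else 0 :: ennreal"
  let ?h = "\<lambda>l. ennreal (Hf (snd (fold (estep lam A) l (start lam A, ?D))))"
  have fI: "finite ?I" using A by (simp add: finite_clocks)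
  have le: "?q l \<le> ?h l" if l: "set l \<subseteq> ?I" for l
  proof (cases "\<Psi> (reach lam A l)")
    case True
    obtain s D where sD: "fold (estep lam A) l (start lam A, ?D) = (s, D)" by fastforce
    have "set l \<subseteq> UNIV \<times> A" using l by auto
    from consistent_fold[OF A this consistent_start[OF A, of lam]]
    have "s = reach lam A l" "consistent lam A s D"
      unfolding sD prod.case reach_def by blast+
    with True have "1 \<le> Hf D" using bound by blast
    then have "ennreal 1 \<le> ennreal (Hf D)" by (rule ennreal_leI)
    then show ?thesis using True sD by simp
  qed simp
  show ?thesis
  proof (cases "?I = {}")
    \<comment> \<open>Without particles there are no clocks and no rings; the law of the clock
      family is identified for a nonempty index set only.\<close>
    case True
    have "(\<integral>\<^sup>+w. ?q (rings m ?I (clock_vec A w) t) \<partial>M) = (\<integral>\<^sup>+w. ?q [] \<partial>M)"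
      by (simp only: True rings_empty)
    also have "\<dots> = ?q []"
      by (simp add: emeasure_space_1)
    also have "\<dots> \<le> ?h []" by (rule le) simp
    finally show ?thesis by simp
  next
    case False
    have "(\<integral>\<^sup>+w. ?q (rings m ?I (clock_vec A w) t) \<partial>M)
        \<le> (\<integral>\<^sup>+w. ?h (rings m ?I (clock_vec A w) t) \<partial>M)"
      by (intro nn_integral_mono le set_rings)
    also have "\<dots> = (\<integral>\<^sup>+g. ?h (rings m ?I g t) \<partial>distr M (clock_space ?I) (clock_vec A))"
      by (rule nn_integral_distr'[OF measurable_clock_vec measurable_rings_fixed[OF fI], symmetric])
    also have "\<dots> = (\<integral>\<^sup>+g. ?h (rings m ?I g t) \<partial>clock_law (\<lambda>i. clock_rate lam (fst i)) ?I)"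
      by (simp only: distr_clock_vec[OF False])
    also have "\<dots> = ennreal (Hf (snd (start lam A, ?D)))"
    proof (rule nn_integral_fold_rings[where f = "estep lam A" and H = "\<lambda>x. Hf (snd x)"
          and P = "\<lambda>x. consistent lam A (fst x) (snd x)", OF fI])
      fix i assume "i \<in> ?I"
      then show "0 < clock_rate lam (fst i)" by (intro rate_pos) auto
    next
      fix x i assume x: "consistent lam A (fst x) (snd x)" and "i \<in> ?I"
      moreover obtain c p where i: "i = (c, p)" by (cases i)
      ultimately have "p \<in> A" by simp
      from consistent_estep[OF A this x, of c]
      show "consistent lam A (fst (estep lam A i x)) (snd (estep lam A i x))"
        by (cases x) (simp add: estep_def i)
    next
      fix x assume x: "consistent lam A (fst x) (snd x)"
      have e: "snd (estep lam A i x) = reveal A i (fst x) (snd x)" for i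
        by (cases x) (simp add: estep_def)
      show "(\<Sum>i\<in>?I. clock_rate lam (fst i) * Hf (snd (estep lam A i x)))
          = (\<Sum>i\<in>?I. clock_rate lam (fst i)) * Hf (snd x)"
        unfolding e by (rule harmonic[OF x])
    next
      show "consistent lam A (fst (start lam A, ?D)) (snd (start lam A, ?D))"
        unfolding fst_conv snd_conv by (rule consistent_start[OF A])
    qed (rule nonneg)
    finally show ?thesis by (simp only: snd_conv)
  qed
qed

text \<open>The preceding bound holds for each initial configuration in the box, since the clocks
  are independent of it. Averaging over the configuration yields the integral on the right.\<close>

lemma emeasure_cut_le:
  fixes \<Psi> :: "particle set \<Rightarrow> system \<Rightarrow> bool" and Hf :: "particle set \<Rightarrow> (int \<Rightarrow> nat \<Rightarrow> bool option) \<Rightarrow> real"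
  assumes nonneg: "\<And>A D. 0 \<le> Hf A D"
    and bound: "\<And>eta s D. consistent lam (particles_within n eta) s D \<Longrightarrow>
      \<Psi> (particles_within n eta) s \<Longrightarrow> 1 \<le> Hf (particles_within n eta) D"
    and harmonic: "\<And>A s D. finite A \<Longrightarrow> consistent lam A s D \<Longrightarrow>
      (\<Sum>i\<in>clocks lam \<times> A. clock_rate lam (fst i) * Hf A (reveal A i s D))
        = (\<Sum>i\<in>clocks lam \<times> A. clock_rate lam (fst i)) * Hf A D"
  shows "{w \<in> space M. \<Psi> (particles_within n (etas w)) (cut lam (gaps w) (etas w) n m T)} \<in> sets M \<and>
    emeasure M {w \<in> space M. \<Psi> (particles_within n (etas w)) (cut lam (gaps w) (etas w) n m T)}
      \<le> (\<integral>\<^sup>+w. ennreal (Hf (particles_within n (etas w)) (\<lambda>_ _. blank lam)) \<partial>M)"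
    (is "?E \<in> _ \<and> _")
proof -
  \<comment> \<open>The list holds the occupation numbers of the sites from \<open>- int n\<close>
    to \<open>int n\<close>, so site \<open>x\<close> has index \<open>x + int n\<close>. The
    particle set thus is a function of a countable random variable.\<close>
  define B where "B e = particles_within n (\<lambda>x. e ! nat (x + int n))" for e :: "nat list"
  let ?ys = "[- int n..int n]"
  let ?H = "\<lambda>w. map (etas w) ?ys"
  have B: "particles_within n (etas w) = B (?H w)" for w
    unfolding B_def by (rule particles_within_cong) auto
  have finB: "finite (B e)" for e
    unfolding B_def by (rule finite_particles)
  let ?I = "\<lambda>e. clocks lam \<times> B e"
  let ?q = "\<lambda>e g. if \<Psi> (B e) (reach lam (B e) (rings m (?I e) g (real T))) then 1 else 0 :: ennreal"
  have cut: "cut lam (gaps w) (etas w) n m T = reach lam (B (?H w)) (rings m (?I (?H w)) (clock_vec (B (?H w)) w) (real T))" for w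
  proof -
    have "rings m (?I (?H w)) (case_prod (gaps w)) (real T) = rings m (?I (?H w)) (clock_vec (B (?H w)) w) (real T)"
      by (rule rings_cong) (auto simp: clock_vec_def)
    then show ?thesis by (simp only: cut_def Let_def B)
  qed
  have mq: "?q e \<in> borel_measurable (clock_space (?I e))" for e
    by (rule measurable_rings_fixed) (simp add: finB finite_clocks)
  have mqw: "(\<lambda>w. ?q e (clock_vec (B e) w)) \<in> borel_measurable M" for e
    by (rule measurable_compose[OF measurable_clock_vec mq])
  have Hs: "{w \<in> space M. ?H w = e} \<in> sets M" for e
  proof -
    have "{w \<in> space M. ?H w = e} = ?H -` {e} \<inter> space M" by auto
    then show ?thesis using measurable_sets[OF measurable_eta_list, of "{e}" ?ys] by simp
  qed
  have Ee: "?E \<inter> {w \<in> space M. ?H w = e}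
      = (\<lambda>w. ?q e (clock_vec (B e) w)) -` {1} \<inter> space M \<inter> {w \<in> space M. ?H w = e}" for e
    unfolding cut B by (auto split: if_splits)
  have Es: "?E \<inter> {w \<in> space M. ?H w = e} \<in> sets M" for e
    unfolding Ee by (rule sets.Int[OF measurable_sets[OF mqw] Hs]) simp
  have le: "emeasure M (?E \<inter> {w \<in> space M. ?H w = e})
      \<le> (\<integral>\<^sup>+w. ennreal (Hf (B (?H w)) (\<lambda>_ _. blank lam)) * indicator {w \<in> space M. ?H w = e} w \<partial>M)" for e
  proof -
    define F where "F z = indicator {e} (fst z) * ?q e (snd z)" for z
    have F: "F \<in> borel_measurable (count_space UNIV \<Otimes>\<^sub>M clock_space (?I e))"
      unfolding F_def[abs_def]
      by (intro borel_measurable_times_ennreal measurable_compose[OF measurable_fst]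
          measurable_compose[OF measurable_snd mq] borel_measurable_count_space)
    have "emeasure M (?E \<inter> {w \<in> space M. ?H w = e}) = (\<integral>\<^sup>+w. indicator (?E \<inter> {w \<in> space M. ?H w = e}) w \<partial>M)"
      by (rule nn_integral_indicator[OF Es, symmetric])
    also have "\<dots> = (\<integral>\<^sup>+w. F (?H w, clock_vec (B e) w) \<partial>M)"
      by (rule nn_integral_cong, unfold cut B) (auto simp: F_def indicator_def)
    also have "\<dots> = (\<integral>\<^sup>+w. \<integral>\<^sup>+w'. F (?H w, clock_vec (B e) w') \<partial>M \<partial>M)"
      by (rule nn_integral_eta_clock[OF F])
    also have "\<dots> \<le> (\<integral>\<^sup>+w. ennreal (Hf (B (?H w)) (\<lambda>_ _. blank lam)) * indicator {w \<in> space M. ?H w = e} w \<partial>M)"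
    proof (rule nn_integral_mono)
      fix w assume w: "w \<in> space M"
      show "(\<integral>\<^sup>+w'. F (?H w, clock_vec (B e) w') \<partial>M)
          \<le> ennreal (Hf (B (?H w)) (\<lambda>_ _. blank lam)) * indicator {w \<in> space M. ?H w = e} w"
      proof (cases "?H w = e")
        case True
        have "(\<integral>\<^sup>+w'. F (?H w, clock_vec (B e) w') \<partial>M) = (\<integral>\<^sup>+w'. ?q e (clock_vec (B e) w') \<partial>M)"
          by (simp only: F_def fst_conv snd_conv True) simp
        also have "\<dots> \<le> ennreal (Hf (B e) (\<lambda>_ _. blank lam))"
        proof (rule nn_integral_rings_le[OF finB nonneg])
          show "1 \<le> Hf (B e) D" if "consistent lam (B e) s D" "\<Psi> (B e) s" for s D
            using bound that unfolding B_def by blast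
        qed (rule harmonic[OF finB])
        finally show ?thesis using True w by simp
      qed (simp add: F_def)
    qed
    finally show ?thesis .
  qed
  have f: "(\<lambda>w. ennreal (Hf (B (?H w)) (\<lambda>_ _. blank lam))) \<in> borel_measurable M"
    by (rule measurable_compose[OF measurable_eta_list]) simp
  show ?thesis
    unfolding B[symmetric]
    using emeasure_le_by_values[OF measurable_eta_list _ Es f le] unfolding B[symmetric] by blast
qed

section \<open>Flux estimates and the phase transition\<close>

abbreviation "at_least K \<equiv> \<lambda>k :: nat. if K \<le> k then 1 else 0 :: real"

lemma outflow_mean_particles_within:
  assumes "- int n \<le> w0" "x \<le> int n"
  shows "outflow_mean (at_least K) rho (\<lambda>y. card {p \<in> particles_within n eta. fst p = y}) (\<lambda>_ _. blank lam) [w0..x] 0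
    = list_mean (at_least K) rho (map eta [w0..x]) 0"
proof -
  have "map (\<lambda>y. card {p \<in> particles_within n eta. fst p = y}) [w0..x] = map eta [w0..x]"
    using assms by (intro map_cong refl card_particles_within) auto
  then show ?thesis by (simp only: outflow_mean_blank)
qed

text \<open>The window \<open>[-n..x]\<close> has no inflow, so a flux of at least \<open>K\<close>
  forces its outflow mean to be 1. Initially this mean averages to the chance that the walk is at
  least \<open>K\<close> after as many steps as the window has sites, which is at most
  \<open>limit K\<close> uniformly in \<open>n\<close>, \<open>m\<close> and
  \<open>T\<close>.\<close>

lemma emeasure_flux_ge:
  assumes n: "nat \<bar>x\<bar> \<le> n"
  shows "{w \<in> space M. K \<le> flux lam (gaps w) (etas w) n m T x} \<in> sets M \<and>
    emeasure M {w \<in> space M. K \<le> flux lam (gaps w) (etas w) n m T x} \<le> ennreal (W.limit K)"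
proof -
  let ?Hf = "\<lambda>A D. outflow_mean (at_least K) rho (\<lambda>y. card {p \<in> A. fst p = y}) D [- int n..x] 0"
  have b: "0 \<le> ?Hf A D" for A D
    using outflow_mean_bounds[of "at_least K" rho] rho by simp
  have "{w \<in> space M. K \<le> flux lam (gaps w) (etas w) n m T x} \<in> sets M \<and>
    emeasure M {w \<in> space M. K \<le> flux lam (gaps w) (etas w) n m T x}
      \<le> (\<integral>\<^sup>+w. ennreal (?Hf (particles_within n (etas w)) (\<lambda>_ _. blank lam)) \<partial>M)"
    unfolding flux_def
  proof (rule emeasure_cut_le[where \<Psi> = "\<lambda>A s. K \<le> crossed A (fst s) x" and Hf = ?Hf, OF b])
    fix eta s D
    let ?A = "particles_within n eta"
    assume c: "consistent lam ?A s D" and K: "K \<le> crossed ?A (fst s) x"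
    have z: "- int n - 1 + 1 = - int n" "- int n - 1 + int (nat (x + int n + 1)) = x"
      using n by auto
    \<comment> \<open>No particle of the box starts to the left of \<open>- int n\<close>, so
      nothing has entered the window.\<close>
    have "{p \<in> ?A. fst p \<le> - int n - 1 \<and> - int n - 1 < fst s p} = {}"
      by (auto simp: particles_within_def)
    then have "crossed ?A (fst s) (- int n - 1) = 0"
      by (simp only: crossed_def card.empty)
    then have k: "crossed ?A (fst s) (- int n - 1) \<le> 0" by simp
    have c': "consistent lam ?A (fst s, snd s) D" using c by simp
    have "K \<le> crossed ?A (fst s) (- int n - 1 + int (nat (x + int n + 1)))"
      unfolding z by (rule K)
    from outflow_mean_eq_1[OF finite_particles c' refl this k]
    have "?Hf ?A D = 1" unfolding z .
    then show "1 \<le> ?Hf ?A D" by simp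
  next
    fix A s D assume "finite A" "consistent lam A s D"
    then show "(\<Sum>i\<in>clocks lam \<times> A. clock_rate lam (fst i) * ?Hf A (reveal A i s D))
        = (\<Sum>i\<in>clocks lam \<times> A. clock_rate lam (fst i)) * ?Hf A D"
      by (rule outflow_mean_harmonic[OF _ _ lam_pos]) simp
  qed
  moreover have "(\<integral>\<^sup>+w. ennreal (?Hf (particles_within n (etas w)) (\<lambda>_ _. blank lam)) \<partial>M)
      = ennreal (W.above (length [- int n..x]) 0 K)"
  proof -
    have "?Hf (particles_within n (etas w)) (\<lambda>_ _. blank lam) = list_mean (at_least K) rho (map (etas w) [- int n..x]) 0" for w
      by (rule outflow_mean_particles_within) (use n in auto)
    then show ?thesis by (simp only: nn_integral_list_mean[OF distinct_upto])
  qed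
  moreover have "\<dots> \<le> ennreal (W.limit K)"
    by (rule ennreal_leI) (rule W.above_le_limit)
  ultimately show ?thesis by (simp only:) (blast intro: order_trans)
qed

text \<open>One minus the outflow mean is harmonic as well, and equals 1 when the window is quiet
  and fewer than \<open>K\<close> particles have left it. Neglecting the inflow at \<open>w0\<close>
  is harmless by \<open>outflow_mean_eq_0\<close>, so the window can stay fixed while
  \<open>n\<close> grows.\<close>

lemma emeasure_flux_less_quiet:
  assumes n: "nat \<bar>x\<bar> \<le> n" "nat \<bar>w0\<bar> \<le> n" and w0: "w0 \<le> x"
  shows "{w \<in> space M. flux lam (gaps w) (etas w) n m T x < K \<and> quiet lam (gaps w) (etas w) n m T {w0..x}} \<in> sets M \<and>
    emeasure M {w \<in> space M. flux lam (gaps w) (etas w) n m T x < K \<and> quiet lam (gaps w) (etas w) n m T {w0..x}}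
      \<le> ennreal (1 - W.above (nat (x - w0 + 1)) 0 K)"
proof -
  let ?h = "\<lambda>A D. outflow_mean (at_least K) rho (\<lambda>y. card {p \<in> A. fst p = y}) D [w0..x] 0"
  let ?Hf = "\<lambda>A D. 1 - ?h A D"
  let ?l = "\<lambda>w. list_mean (at_least K) rho (map (etas w) [w0..x]) 0"
  have b: "0 \<le> ?Hf A D" for A D
    using outflow_mean_bounds[of "at_least K" rho] rho by simp
  have l: "0 \<le> ?l w" for w
    using list_mean_bounds[of "at_least K" rho] rho by simp
  have l1: "?l w \<le> 1" for w
    using list_mean_bounds[of "at_least K" rho] rho by simp
  have "{w \<in> space M. flux lam (gaps w) (etas w) n m T x < K \<and> quiet lam (gaps w) (etas w) n m T {w0..x}} \<in> sets M \<and>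
    emeasure M {w \<in> space M. flux lam (gaps w) (etas w) n m T x < K \<and> quiet lam (gaps w) (etas w) n m T {w0..x}}
      \<le> (\<integral>\<^sup>+w. ennreal (?Hf (particles_within n (etas w)) (\<lambda>_ _. blank lam)) \<partial>M)"
    unfolding flux_def quiet_def
  proof (rule emeasure_cut_le[where \<Psi> = "\<lambda>A s. crossed A (fst s) x < K \<and> (\<forall>p\<in>A. fst s p \<in> {w0..x} \<longrightarrow> \<not> snd s p)"
        and Hf = ?Hf, OF b])
    fix eta s D
    let ?A = "particles_within n eta"
    assume c: "consistent lam ?A s D"
      and K: "crossed ?A (fst s) x < K \<and> (\<forall>p\<in>?A. fst s p \<in> {w0..x} \<longrightarrow> \<not> snd s p)"
    have z: "w0 - 1 + 1 = w0" "w0 - 1 + int (nat (x - w0 + 1)) = x"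
      using w0 by auto
    have c': "consistent lam ?A (fst s, snd s) D" using c by simp
    have "crossed ?A (fst s) (w0 - 1 + int (nat (x - w0 + 1))) < K"
      unfolding z using K by blast
    moreover have "\<not> snd s p" if "p \<in> ?A" "fst s p \<in> {w0 - 1 + 1..w0 - 1 + int (nat (x - w0 + 1))}" for p
      using that K unfolding z by blast
    ultimately have "outflow_mean (at_least K) rho (\<lambda>y. card {p \<in> ?A. fst p = y}) D
        [w0 - 1 + 1..w0 - 1 + int (nat (x - w0 + 1))] 0 = 0"
      by (rule outflow_mean_eq_0[OF finite_particles c' refl _ le0])
    then have "?h ?A D = 0" unfolding z .
    then show "1 \<le> ?Hf ?A D" by simp
  next
    fix A s D assume "finite A" "consistent lam A s D"
    then have "(\<Sum>i\<in>clocks lam \<times> A. clock_rate lam (fst i) * ?h A (reveal A i s D))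
        = (\<Sum>i\<in>clocks lam \<times> A. clock_rate lam (fst i)) * ?h A D"
      by (rule outflow_mean_harmonic[OF _ _ lam_pos]) simp
    then show "(\<Sum>i\<in>clocks lam \<times> A. clock_rate lam (fst i) * ?Hf A (reveal A i s D))
        = (\<Sum>i\<in>clocks lam \<times> A. clock_rate lam (fst i)) * ?Hf A D"
      by (simp only: right_diff_distrib sum_subtractf mult_1_right)
  qed
  moreover have "(\<integral>\<^sup>+w. ennreal (?Hf (particles_within n (etas w)) (\<lambda>_ _. blank lam)) \<partial>M)
      = (\<integral>\<^sup>+w. 1 - ennreal (?l w) \<partial>M)"
    using n by (subst outflow_mean_particles_within) (auto simp: l ennreal_minus[symmetric] simp del: ennreal_minus)
  moreover have "\<dots> = (\<integral>\<^sup>+w. 1 \<partial>M) - (\<integral>\<^sup>+w. ennreal (?l w) \<partial>M)"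
  proof (rule nn_integral_diff)
    show "(\<lambda>w. ennreal (?l w)) \<in> borel_measurable M"
      by (rule measurable_compose[OF measurable_eta_list]) simp
    show "(\<integral>\<^sup>+w. ennreal (?l w) \<partial>M) \<noteq> \<infinity>"
      by (subst nn_integral_list_mean) simp_all
    show "AE w in M. ennreal (?l w) \<le> 1"
      using l1 by simp
  qed simp
  moreover have "\<dots> = ennreal (1 - W.above (nat (x - w0 + 1)) 0 K)"
    by (subst nn_integral_list_mean)
      (simp_all add: emeasure_space_1 ennreal_minus[OF W.above_bounds(1), symmetric])
  ultimately show ?thesis by (simp only:)
qed

text \<open>The bound \<open>limit K\<close> on a flux of at least \<open>K\<close> is uniform in
  \<open>m\<close>, \<open>n\<close> and \<open>T\<close>, so it survives the three limits, and it
  tends to 0 with growing \<open>K\<close>. Almost surely the flux through every site is therefore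
  bounded, and \<open>passive_if_flux_bounded\<close> applies sitewise.\<close>

lemma fixates_if_subcritical:
  assumes mean: "(\<integral>\<^sup>+w. ennreal (real (eta0 0 w)) \<partial>M) = ennreal mu" and mu: "0 \<le> mu" "mu < rho"
  shows "fixates M lam eta0 gap"
proof -
  have "W.limit \<longlonglongrightarrow> 0"
    by (rule W.tight_if_subcritical[OF _ mu]) (simp only: nn_integral_eta_law[of _ 0] mean)
  then have "AE w in M. \<exists>K. \<not> (\<forall>\<^sub>F T in sequentially. \<forall>\<^sub>F n in sequentially. \<forall>\<^sub>F m in sequentially.
      K \<le> flux lam (gaps w) (etas w) n m T x)" for x
    by (rule AE_not_all_if_emeasure_tendsto_0[rotated])
      (intro emeasure_eventually_le[where N = 0] emeasure_eventually_le[where N = "nat \<bar>x\<bar>"] emeasure_flux_ge)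
  then have "AE w in M. \<forall>x. \<exists>K. \<not> (\<forall>\<^sub>F T in sequentially. \<forall>\<^sub>F n in sequentially. \<forall>\<^sub>F m in sequentially.
      K \<le> flux lam (gaps w) (etas w) n m T x)"
    by (simp only: AE_all_countable simp_thms)
  with AE_tame[OF mean mu(1)] show ?thesis
    unfolding fixates_def
  proof eventually_elim
    case (elim w)
    have "\<exists>t0\<ge>0. \<forall>t\<ge>t0. fst (arw lam (etas w) (gaps w) t x) = 0" for x
      by (rule passive_if_flux_bounded[OF elim(1)]) (use elim(2) in blast)
    then obtain t0 where t0: "\<And>x. 0 \<le> t0 x" "\<And>x t. t0 x \<le> t \<Longrightarrow> fst (arw lam (etas w) (gaps w) t x) = 0"
      by metis
    show ?case
    proof (intro allI)
      fix a b :: int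
      \<comment> \<open>The sum is a common upper bound of the finitely many nonnegative fixation
        times.\<close>
      have "\<forall>t\<ge>sum t0 {a..b}. \<forall>x\<in>{a..b}. fst (arw lam (etas w) (gaps w) t x) = 0"
        using member_le_sum[of _ "{a..b}" t0] t0 by (fastforce intro: order_trans)
      then show "\<exists>T\<ge>0. \<forall>t\<ge>T. \<forall>x\<in>{a..b}. fst (arw lam (etas w) (gaps w) t x) = 0"
        using t0(1) by (intro exI[of _ "sum t0 {a..b}"] conjI sum_nonneg) auto
    qed
  qed
qed

text \<open>Fixation would keep the flux through 0 below some \<open>K\<close> while every window to
  the left of 0 becomes quiet. For fixed \<open>K\<close> the window of \<open>j + 1\<close> sites
  allows this with probability at most \<open>1 - above (j + 1) 0 K\<close>, which tends to
  \<open>1 - limit K = 0\<close>; and \<open>K\<close> ranges over a countable set.\<close>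

lemma not_fixates_if_not_subcritical:
  assumes mean: "(\<integral>\<^sup>+w. ennreal (real (eta0 0 w)) \<partial>M) = ennreal mu" and mu: "0 \<le> mu" "rho \<le> mu"
    and nc: "\<not> (\<exists>c. AE w in M. eta0 0 w = c)"
  shows "\<not> fixates M lam eta0 gap"
proof
  assume "fixates M lam eta0 gap"
  have nc': "\<not> (\<exists>c. \<forall>e\<in>set_pmf eta_law. e = c)"
  proof
    assume "\<exists>c. \<forall>e\<in>set_pmf eta_law. e = c"
    then obtain c where "\<forall>e\<in>set_pmf eta_law. e = c" by blast
    then have "AE e in distr M (count_space UNIV) (eta0 0). e = c"
      unfolding measure_eta_law[of 0, symmetric] by (simp add: AE_measure_pmf_iff)
    then have "AE w in M. eta0 0 w = c"
      by (subst (asm) AE_distr_iff[OF measurable_eta0]) simp_all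
    with nc show False by blast
  qed
  have lim: "W.limit K = 1" for K
    by (rule W.escape_if_not_subcritical[OF _ mu nc']) (simp only: nn_integral_eta_law[of _ 0] mean)
  let ?G = "\<lambda>K w0 w. \<forall>\<^sub>F T in sequentially. \<forall>\<^sub>F n in sequentially. \<forall>\<^sub>F m in sequentially.
    flux lam (gaps w) (etas w) n m T 0 < K \<and> quiet lam (gaps w) (etas w) n m T {w0..0}"
  have "AE w in M. \<exists>j. \<not> ?G K (- int j) w" for K
  proof (rule AE_not_all_if_emeasure_tendsto_0)
    fix j
    show "{w \<in> space M. ?G K (- int j) w} \<in> sets M \<and>
        emeasure M {w \<in> space M. ?G K (- int j) w} \<le> ennreal (1 - W.above (nat (0 - (- int j) + 1)) 0 K)"
      by (intro emeasure_eventually_le[where N = 0] emeasure_eventually_le[where N = j]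
          emeasure_flux_less_quiet) auto
  next
    have "(\<lambda>j. 1 - W.above (Suc j) 0 K) \<longlonglongrightarrow> 1 - W.limit K"
      by (intro tendsto_diff tendsto_const LIMSEQ_Suc W.above_tendsto)
    moreover have "nat (0 - (- int j) + 1) = Suc j" for j by simp
    ultimately show "(\<lambda>j. 1 - W.above (nat (0 - (- int j) + 1)) 0 K) \<longlonglongrightarrow> 0"
      by (simp only: lim diff_self)
  qed
  then have "AE w in M. \<forall>K. \<exists>j. \<not> ?G K (- int j) w"
    by (simp only: AE_all_countable simp_thms)
  with AE_tame[OF mean mu(1)] \<open>fixates M lam eta0 gap\<close>[unfolded fixates_def] have "AE w in M. False"
  proof eventually_elim
    case (elim w)
    then obtain K where "\<forall>w0\<le>0. ?G K w0 w"
      using flux_bounded_if_passive[OF elim(1), of 0] by blast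
    then have "?G K (- int j) w" for j by simp
    with elim(3) show False by blast
  qed
  then show False by (simp only: AE_const)
qed

end

theorem theorem1:
  fixes M :: "'w measure"
    and lam :: ereal
    and eta0 :: "int \<Rightarrow> 'w \<Rightarrow> nat"
    and gap :: "clock \<Rightarrow> particle \<Rightarrow> nat \<Rightarrow> 'w \<Rightarrow> real"
    and mu :: real
  assumes "prob_space M"
    and "0 < lam"
    and "arw_randomness M lam eta0 gap"
    and identically_distributed:
      "\<And>x. distr M (count_space UNIV) (eta0 x) = distr M (count_space UNIV) (eta0 0)"
    and non_constant: "\<not> (\<exists>c. AE w in M. eta0 0 w = c)"
    and finite_mean: "integrable M (\<lambda>w. real (eta0 0 w))"
    and mean: "mu = (\<integral>w. real (eta0 0 w) \<partial>M)"
  shows "(mu < critical_density lam \<longrightarrow> fixates M lam eta0 gap) \<and>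
         (mu > critical_density lam \<longrightarrow> \<not> fixates M lam eta0 gap) \<and>
         (mu = critical_density lam \<longrightarrow> \<not> fixates M lam eta0 gap)"
proof -
  interpret arw_model M lam eta0 gap
    using assms(1-4) by (intro arw_model.intro arw_model_axioms.intro)
  have "(\<integral>\<^sup>+w. ennreal (real (eta0 0 w)) \<partial>M) = ennreal mu"
    unfolding mean by (rule nn_integral_eq_integral[OF finite_mean]) simp
  moreover have "0 \<le> mu" unfolding mean by simp
  ultimately show ?thesis
    using fixates_if_subcritical not_fixates_if_not_subcritical non_constant by force
qed

end
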